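(* Let algorithm iRPMVR be run with the error-dissipation condition in force (constants $c_e,\mu,\nu$, random variables $\mathcal E_k$). Let $\kappa\ge0$ and assume $$0<\bar\alpha<\min\bigl\{C_\alpha,\ 1/(L_F+2L_R+2\sqrt{\nu/\gamma}+4\ell_RC_0\kappa/\gamma)\bigr\}.$$ Set $\sigma_0:=\frac1{2\alpha}-\frac{L_F}2-L_R$, $\tau:=\sqrt{\nu/\gamma}$, $a_\eta:=\gamma(\sigma_0-\tau/2)-\nu/(2\tau)-2\ell_RC_0\kappa$, $a_{\hat\eta}:=\gamma/(2\alpha)$, $C_\Theta:=1+2(\ell_f+\alpha^{-1})^2$, $C_{\rm comp}:=\max\{C_\Theta/a_{\hat\eta},2\nu/a_\eta\}$, $C_{\rm tol}:=\max\{1,4C_{\rm comp}\ell_RC_0\}$ and $$A_0:=C_{\rm comp}\bigl(\Phi(x^0)-\inf_{x\in\mathcal M}\Phi(x)\bigr)+c_e\Bigl(2+\frac{C_{\rm comp}}{2\tau}\Bigr)\mathbb E[\mathcal E_0].$$ Let $\epsilon>0$ be sufficiently small so that $\epsilon^2/C_{\rm tol}\le\bar\Delta$, set $K_\epsilon:=\max\{1,\lceil2A_0\epsilon^{-2}\rceil\}$, and choose, with $\eta^{-1}:=0$, $$\Delta_k=\min\bigl\{\bar\Delta,\max\{\kappa\|\eta^{k-1}\|^2,\varsigma_k\}\bigr\},\qquad\varsigma_k:=\epsilon^2/C_{\rm tol}\ (0\le k\le K_\epsilon-1),\qquad\varsigma_k:=0\ (k\ge K_\epsilon).$$ Then $\min_{0\le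 k<K_\epsilon}\mathbb E[\Theta_k^2]\le\epsilon^2$. The total numbers of inner iterations required (over the outer iterations $k=0,\dots,K_\epsilon-1$) by Algorithm 1-FISTA, Algorithm 1-NFG, and Algorithm 1-AR are $O(\epsilon^{-4})$, $O\bigl(\epsilon^{-3}\log(1+\epsilon^{-2})\bigr)$, and $O(\epsilon^{-3})$, respectively.
   Context: Setting. $\mathcal M\subseteq\mathbb R^d$ is a compact embedded Riemannian submanifold (induced Euclidean metric) of dimension $d-p$, with tangent spaces $T_x\mathcal M$, normal spaces $N_x\mathcal M=(T_x\mathcal M)^\perp$, tangent bundle $T\mathcal M=\{(x,\eta):x\in\mathcal M,\eta\in T_x\mathcal M\}$; $P_S$ is Euclidean projection onto a closed convex set $S$. $\Phi=F+R$, $F=\frac1n\sum_{j=1}^nf_j$. Each $f_j:\mathbb R^d\to\mathbb R$ is $C^1$; there is an open neighborhood $U$ of $\mathcal M$ on which every $\nabla f_j$ is Lipschitz with common constant $\ell_f$; $\|\nabla f_j(x)\|\le M_f$ for all $x\in\mathcal M$ and all $j$ ($M_f>0$ independent of $n$); $R:\mathbb R^d\to\mathbb R$ is convex and $\ell_R$-Lipschitz. $\operatorname{grad}h(x)=P_{T_x\mathcal M}\nabla h(x)$. $\operatorname{Retr}:T\mathcal M\to\mathcal M$ is a retraction (smooth, $\operatorname{Retr}_x(0)=x$, $D\operatorname{Retr}_x(0)=\mathrm{Id}$). $\mathcal M$ is covered by finitely many open sets $V_\ell$ with $\overline{V_\ell}\subseteq U_\ell$, $U_\ell$ open carrying smooth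 local defining functions $\psi_\ell:U_\ell\to\mathbb R^p$ of $\mathcal M$ whose differential has full row rank on $U_\ell\cap\mathcal M$; for $x\in\mathcal M$ pick $\ell(x)$ with $x\in V_{\ell(x)}$ and set $B_x:=D\psi_{\ell(x)}(x)$, so $\ker B_x=T_x\mathcal M$; the singular values of all $B_x$ lie in an interval $[\underline C_B,\overline C_B]$, $\underline C_B>0$. $C_0>0$ is a constant with $\operatorname{dist}(v,T_x\mathcal M)\le C_0\|B_xv\|$ for all $x\in\mathcal M$, $v\in\mathbb R^d$. Algorithm iRPMVR. Choose $x^0\in\mathcal M$, stepsize $0<\alpha\le\bar\alpha$, $0<\gamma\le1$, $\bar\Delta\ge0$, $0\le\bar\chi<1$, $M_u:=c_fM_f$ with $c_f\ge1$. Parameters $\gamma_k\in[\gamma,1]$, $\Delta_k\in[0,\bar\Delta]$, $\chi_k\in[0,\bar\chi]$ are chosen before sampling the $k$-th batch using only available history. Initialize $u^0=\hat u^0=\bar m^0=\operatorname{grad}F(x^0)$. For $k=0,1,\dots$ (outer iterations): (a) if $k\ne0$, sample a random batch $\mathcal B_k$ from $\{1,\dots,n\}$, form from it and the current estimator state an estimator $u^k\in T_{x^k}\mathcal M$ of $\operatorname{grad}F(x^k)$, and set $\hat u^k=P_{\overline B(0,M_u)}u^k$; (b) $m^k=\chi_k\bar m^k+(1-\chi_k)\hat u^k$; (c) with $F_k(\eta):=\langle m^k,\eta\rangle+\frac1{2\alpha}\|\eta\|^2+R(x^k+\eta)$ and $G_k(\lambda):=F_k^*(-B_{x^k}^\top\lambda)$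 ($F_k^*$ the Fenchel conjugate) apply an inner routine to $\min_\lambda G_k(\lambda)$ to find $\lambda^k\in\mathbb R^p$ with $\|\nabla G_k(\lambda^k)\|\le\Delta_k$; (d) $w^k=\operatorname{prox}_{\alpha R}(x^k-\alpha(m^k+B_{x^k}^\top\lambda^k))-x^k$, $\eta^k=P_{T_{x^k}\mathcal M}w^k$; (e) $x^{k+1}=\operatorname{Retr}_{x^k}(\gamma_k\eta^k)$; (f) $\bar m^{k+1}=P_{T_{x^{k+1}}\mathcal M}m^k$. The exact tangent step is $\hat\eta^k:=\arg\min_{\eta\in T_{x^k}\mathcal M}F_k(\eta)$ and $e^k:=m^k-\operatorname{grad}F(x^k)$. $\mathcal F_k$ is the natural filtration of the history before $\mathcal B_k$ is sampled (so $x^k,\bar m^k,\gamma_k,\Delta_k,\chi_k$ are $\mathcal F_k$-measurable); $\mathbb E_k=\mathbb E[\cdot\mid\mathcal F_k]$. Inner routines. Each $G_k$ is convex with $\alpha\overline C_B^2$-Lipschitz gradient and has a minimizer $\lambda_k^*$ with $\|\lambda_k^*\|\le2(M_u+\ell_R)/\underline C_B$. Algorithm 1-FISTA: iRPMVR whose inner routine is Nesterov's accelerated gradient method (FISTA with zero nonsmooth term) applied to $G_k$ from the zero vector; it reaches $\|\nabla G_k\|\le\Delta_k$ within $O(\Delta_k^{-1})$ inner iterations. Algorithm 1-NFG: the inner routine is Nesterov's fast gradient method applied to $G_k(\lambda)+\frac{\delta_k}2\|\lambda\|^2$ with $\delta_k>0$ proportional to $\Delta_k$; by known estimates it reaches $\|\nabla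 G_k\|\le\Delta_k$ within $O(\Delta_k^{-1/2}\log(1+\Delta_k^{-1}))$ inner iterations. Algorithm 1-AR: the inner routine is the accumulative regularization method, which solves by accelerated gradient a sequence of regularized dual problems with moving proximal centers and increasing regularization parameters; by known estimates it reaches $\|\nabla G_k\|\le\Delta_k$ within $O(\Delta_k^{-1/2})$ inner iterations. Error-dissipation condition: there are constants $c_e,\mu,\nu>0$ and nonnegative $\mathcal F_k$-measurable random variables $\mathcal E_k$, $\mathbb E[\mathcal E_0]<\infty$, with $\mathbb E_k[\|e^k\|^2]+\mu\mathcal E_k\le c_e(\mathcal E_k-\mathbb E_k[\mathcal E_{k+1}])+\nu\mathbb E_k[\|\eta^k\|^2]$ for every $k\ge0$. Criticality measure: for $x\in\mathcal M$, $\eta\in T_x\mathcal M$, $\Theta(x,\eta):=\sqrt{\operatorname{dist}^2(0,\nabla F(x+\eta)+\partial R(x+\eta)+N_x\mathcal M)+\|\eta\|^2}$, and $\Theta_k:=\Theta(x^k,\hat\eta^k)$. Constants. $\delta,C_R,C_Q,L_R,L_\Phi,L_F>0$ are fixed such that for all $x\in\mathcal M$, $\eta\in T_x\mathcal M$, $\|\eta\|\le\delta$: $\|\operatorname{Retr}_x(\eta)-x\|\le C_R\|\eta\|$, $\|\operatorname{Retr}_x(\eta)-x-\eta\|\le C_Q\|\eta\|^2$, $|R(\operatorname{Retr}_x(\eta))-R(x+\eta)|\le L_R\|\eta\|^2$, $|\Phi(\operatorname{Retr}_x(\eta))-\Phi(x+\eta)|\le L_\Phi\|\eta\|^2$, $F(\operatorname{Retr}_x(\eta))-F(x)-\langle\operatorname{grad}F(x),\eta\rangle\le\frac{L_F}2\|\eta\|^2$.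 $\delta_T,L_T>0$ are fixed such that, for all $j$ (and likewise for $F$ in place of $f_j$), $\|\operatorname{grad}f_j(\operatorname{Retr}_x(\eta))-P_{T_{\operatorname{Retr}_x(\eta)}\mathcal M}\operatorname{grad}f_j(x)\|\le L_T\|\eta\|$ for $x\in\mathcal M$, $\eta\in T_x\mathcal M$ with $\|\eta\|\le\delta_T$, and $\|\operatorname{grad}f_j(y^i)-P_{T_{y^i}\mathcal M}\operatorname{grad}f_j(y^0)\|\le L_T\sum_{k=0}^{i-1}\|\zeta^k\|$ whenever $y^{k+1}=\operatorname{Retr}_{y^k}(\zeta^k)$ with $y^k\in\mathcal M$, $\zeta^k\in T_{y^k}\mathcal M$, $\|\zeta^k\|\le\delta_T$ for $k=0,\dots,i-1$. Finally $$C_\alpha:=\left(\frac{\sqrt{\ell_RC_0\bar\Delta+(M_u+\ell_R)\min\{\delta,\delta_T\}}-\sqrt{\ell_RC_0\bar\Delta}}{M_u+\ell_R}\right)^2.$$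
   Formalization: The radius δ is additionally assumed small enough that x+η lies in the neighborhood U (where the gradients are Lipschitz) for all x in M and tangent η with ‖η‖ ≤ δ; otherwise ∇F at x+η̂ is uncontrolled and the bound on Θ can fail. *)

theory Defs
  imports "HOL-Probability.Probability"
begin

section \<open>Calculus, convexity, embedded submanifolds\<close>

definition gradient :: "('a::euclidean_space \<Rightarrow> real) \<Rightarrow> 'a \<Rightarrow> 'a" where
  "gradient h x = (THE g. GDERIV h x :> g)"

text \<open>For open \<^term>\<open>S\<close> this is \<open>C\<^sup>k\<close>-regularity: all iterated directional derivatives
  of order at most \<open>k\<close> exist and are continuous.\<close>

primrec Ck_on :: "nat \<Rightarrow> ('a::euclidean_space \<Rightarrow> 'b::euclidean_space) \<Rightarrow> 'a set \<Rightarrow> bool" where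
  "Ck_on 0 h S \<longleftrightarrow> continuous_on S h"
| "Ck_on (Suc k) h S \<longleftrightarrow> (\<forall>x\<in>S. h differentiable (at x)) \<and>
     (\<forall>v. Ck_on k (\<lambda>x. frechet_derivative h (at x) v) S)"

definition smooth_on :: "('a::euclidean_space \<Rightarrow> 'b::euclidean_space) \<Rightarrow> 'a set \<Rightarrow> bool" where
  "smooth_on h S \<longleftrightarrow> (\<forall>k. Ck_on k h S)"

text \<open>Velocities at \<^term>\<open>x\<close> of \<open>C\<^sup>1\<close> curves running in the set.\<close>

definition tangent_space :: "'a::euclidean_space set \<Rightarrow> 'a \<Rightarrow> 'a set" where
  "tangent_space M x = {v. \<exists>c r. 0 < r \<and> c ` {-r<..<r} \<subseteq> M \<and> c 0 = x \<and>
     c C1_differentiable_on {-r<..<r} \<and> (c has_vector_derivative v) (at (0::real))}"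

definition normal_space :: "'a::euclidean_space set \<Rightarrow> 'a \<Rightarrow> 'a set" where
  "normal_space M x = {v. \<forall>t\<in>tangent_space M x. orthogonal v t}"

definition tangent_bundle :: "'a::euclidean_space set \<Rightarrow> ('a \<times> 'a) set" where
  "tangent_bundle M = Sigma M (tangent_space M)"

definition rgrad :: "'a::euclidean_space set \<Rightarrow> ('a \<Rightarrow> real) \<Rightarrow> 'a \<Rightarrow> 'a" where
  "rgrad M h x = closest_point (tangent_space M x) (gradient h x)"

definition subdiff :: "('a::euclidean_space \<Rightarrow> real) \<Rightarrow> 'a \<Rightarrow> 'a set" where
  "subdiff h y = {s. \<forall>z. h z \<ge> h y + s \<bullet> (z - y)}"

text \<open>Fenchel conjugate; real-valued, hence meaningful only where the supremum is finite, which is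
  everywhere for the strongly convex models below.\<close>

definition conjugate :: "('a::euclidean_space \<Rightarrow> real) \<Rightarrow> 'a \<Rightarrow> real" where
  "conjugate h z = (SUP y. z \<bullet> y - h y)"

definition prox :: "real \<Rightarrow> ('a::euclidean_space \<Rightarrow> real) \<Rightarrow> 'a \<Rightarrow> 'a" where
  "prox a h z = (ARG_MIN (\<lambda>y. h y + (norm (y - z))\<^sup>2 / (2 * a)) y. True)"

text \<open>The \<^typ>\<open>'p\<close>-many singular values of a wide matrix, from the small Gram matrix.\<close>

definition singular_value :: "real^'d^'p \<Rightarrow> real \<Rightarrow> bool" where
  "singular_value B s \<longleftrightarrow> 0 \<le> s \<and>
     (\<exists>v. v \<noteq> 0 \<and> (B ** transpose B) *v v = s\<^sup>2 *\<^sub>R v)"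

definition smooth_retraction ::
  "'a::euclidean_space set \<Rightarrow> ('a \<Rightarrow> 'a \<Rightarrow> 'a) \<Rightarrow> bool" where
  "smooth_retraction M Rt \<longleftrightarrow>
     (\<forall>x\<in>M. \<forall>\<eta>\<in>tangent_space M x. Rt x \<eta> \<in> M) \<and>
     (\<exists>W g. open W \<and> tangent_bundle M \<subseteq> W \<and> smooth_on g W \<and>
        (\<forall>x\<in>M. \<forall>\<eta>\<in>tangent_space M x. g (x, \<eta>) = Rt x \<eta>)) \<and>
     (\<forall>x\<in>M. Rt x 0 = x) \<and>
     (\<forall>x\<in>M. (Rt x has_derivative (\<lambda>\<eta>. \<eta>)) (at 0 within tangent_space M x))"

section \<open>The problem and its constants\<close>

record ('d, 'p) setting =
  mfd :: "(real^'d) set"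
  num :: nat
  comp :: "nat \<Rightarrow> real^'d \<Rightarrow> real"
  reg :: "real^'d \<Rightarrow> real"
  nbhd :: "(real^'d) set"
  lip_f :: real
  bd_f :: real
  lip_R :: real
  Retr :: "real^'d \<Rightarrow> real^'d \<Rightarrow> real^'d"
  chart_ix :: "nat set"
  chartV :: "nat \<Rightarrow> (real^'d) set"
  chartU :: "nat \<Rightarrow> (real^'d) set"
  chart_fn :: "nat \<Rightarrow> real^'d \<Rightarrow> real^'p"
  chart_at :: "real^'d \<Rightarrow> nat"
  CB_lo :: real
  CB_hi :: real
  C_dist :: real
  delta :: real
  C_R :: real
  C_Q :: real
  L_R :: real
  L_Phi :: real
  L_F :: real
  delta_T :: real
  L_T :: real

definition fobj :: "('d::finite, 'p::finite) setting \<Rightarrow> real^'d \<Rightarrow> real" where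
  "fobj S x = (\<Sum>j=1..num S. comp S j x) / real (num S)"

definition Phi :: "('d::finite, 'p::finite) setting \<Rightarrow> real^'d \<Rightarrow> real" where
  "Phi S x = fobj S x + reg S x"

definition Tan :: "('d::finite, 'p::finite) setting \<Rightarrow> real^'d \<Rightarrow> (real^'d) set" where
  "Tan S x = tangent_space (mfd S) x"

definition proj_tan :: "('d::finite, 'p::finite) setting \<Rightarrow> real^'d \<Rightarrow> real^'d \<Rightarrow> real^'d" where
  "proj_tan S x v = closest_point (Tan S x) v"

definition Bmat :: "('d::finite, 'p::finite) setting \<Rightarrow> real^'d \<Rightarrow> real^'d^'p" where
  "Bmat S x = jacobian (chart_fn S (chart_at S x)) (at x)"

text \<open>Gradients of \<^term>\<open>h\<close> are Lipschitz along retraction steps and chains of them,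
  after projection onto the current tangent space.\<close>

definition transport_bounds ::
  "('d::finite, 'p::finite) setting \<Rightarrow> (real^'d \<Rightarrow> real) \<Rightarrow> bool" where
  "transport_bounds S h \<longleftrightarrow>
     (\<forall>x\<in>mfd S. \<forall>\<eta>\<in>Tan S x. norm \<eta> \<le> delta_T S \<longrightarrow>
        norm (rgrad (mfd S) h (Retr S x \<eta>)
              - proj_tan S (Retr S x \<eta>) (rgrad (mfd S) h x)) \<le> L_T S * norm \<eta>) \<and>
     (\<forall>i\<ge>1. \<forall>y \<zeta>.
        (\<forall>k<i. y k \<in> mfd S \<and> \<zeta> k \<in> Tan S (y k) \<and> norm (\<zeta> k) \<le> delta_T S \<and>
               y (Suc k) = Retr S (y k) (\<zeta> k)) \<longrightarrow>
        norm (rgrad (mfd S) h (y i) - proj_tan S (y i) (rgrad (mfd S) h (y 0)))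
          \<le> L_T S * (\<Sum>k<i. norm (\<zeta> k)))"

text \<open>\<open>F = \<close>\<^term>\<open>fobj S\<close> and \<open>R = \<close>\<^term>\<open>reg S\<close>; \<^term>\<open>C_dist S\<close> is the constant \<open>C\<^sub>0\<close> comparing
  the distance to a tangent space with \<open>\<parallel>B\<^sub>x v\<parallel>\<close>. The local defining functions make \<^term>\<open>mfd S\<close> an embedded submanifold of codimension
  \<^term>\<open>CARD('p)\<close>.\<close>

locale valid_setting =
  fixes S :: "('d::finite, 'p::finite) setting"
  assumes compact_mfd: "compact (mfd S)"
    and charts_finite: "finite (chart_ix S)"
    and charts_cover: "mfd S \<subseteq> (\<Union>i\<in>chart_ix S. chartV S i)"
    and charts_open: "i \<in> chart_ix S \<Longrightarrow>
      open (chartV S i) \<and> open (chartU S i) \<and> closure (chartV S i) \<subseteq> chartU S i"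
    and charts_smooth: "i \<in> chart_ix S \<Longrightarrow> smooth_on (chart_fn S i) (chartU S i)"
    and charts_define: "i \<in> chart_ix S \<Longrightarrow>
      mfd S \<inter> chartU S i = {x \<in> chartU S i. chart_fn S i x = 0}"
    and charts_rank: "i \<in> chart_ix S \<Longrightarrow> x \<in> chartU S i \<inter> mfd S \<Longrightarrow>
      rank (jacobian (chart_fn S i) (at x)) = CARD('p)"
    and chart_at: "x \<in> mfd S \<Longrightarrow> chart_at S x \<in> chart_ix S \<and> x \<in> chartV S (chart_at S x)"
    and CB_lo_pos: "CB_lo S > 0"
    and singular_values: "x \<in> mfd S \<Longrightarrow> singular_value (Bmat S x) s \<Longrightarrow> s \<in> {CB_lo S..CB_hi S}"
    and C_dist_pos: "C_dist S > 0"
    and C_dist: "x \<in> mfd S \<Longrightarrow> infdist v (Tan S x) \<le> C_dist S * norm (Bmat S x *v v)"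
    and num_pos: "num S \<ge> 1"
    and comp_C1: "j \<in> {1..num S} \<Longrightarrow>
      (\<forall>x. comp S j differentiable (at x)) \<and> continuous_on UNIV (gradient (comp S j))"
    and nbhd: "open (nbhd S)" "mfd S \<subseteq> nbhd S"
    and comp_lipschitz: "j \<in> {1..num S} \<Longrightarrow> (lip_f S)-lipschitz_on (nbhd S) (gradient (comp S j))"
    and bd_f_pos: "bd_f S > 0"
    and comp_bounded: "j \<in> {1..num S} \<Longrightarrow> x \<in> mfd S \<Longrightarrow> norm (gradient (comp S j) x) \<le> bd_f S"
    and reg_convex: "convex_on UNIV (reg S)"
    and reg_lipschitz: "(lip_R S)-lipschitz_on UNIV (reg S)"
    and retraction: "smooth_retraction (mfd S) (Retr S)"
    and consts_pos: "delta S > 0" "C_R S > 0" "C_Q S > 0" "L_R S > 0" "L_Phi S > 0" "L_F S > 0"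
      "delta_T S > 0" "L_T S > 0"
      \<comment> \<open>The radius is small enough that the Lipschitz neighborhood contains the tangent tubes.\<close>
    and delta_nbhd: "x \<in> mfd S \<Longrightarrow> \<eta> \<in> Tan S x \<Longrightarrow> norm \<eta> \<le> delta S \<Longrightarrow> x + \<eta> \<in> nbhd S"
    and retr_bounds: "x \<in> mfd S \<Longrightarrow> \<eta> \<in> Tan S x \<Longrightarrow> norm \<eta> \<le> delta S \<Longrightarrow>
      norm (Retr S x \<eta> - x) \<le> C_R S * norm \<eta> \<and>
      norm (Retr S x \<eta> - x - \<eta>) \<le> C_Q S * (norm \<eta>)\<^sup>2 \<and>
      \<bar>reg S (Retr S x \<eta>) - reg S (x + \<eta>)\<bar> \<le> L_R S * (norm \<eta>)\<^sup>2 \<and>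
      \<bar>Phi S (Retr S x \<eta>) - Phi S (x + \<eta>)\<bar> \<le> L_Phi S * (norm \<eta>)\<^sup>2 \<and>
      fobj S (Retr S x \<eta>) - fobj S x - rgrad (mfd S) (fobj S) x \<bullet> \<eta>
        \<le> L_F S / 2 * (norm \<eta>)\<^sup>2"
    and transport_comp: "j \<in> {1..num S} \<Longrightarrow> transport_bounds S (comp S j)"
    and transport_fobj: "transport_bounds S (fobj S)"

text \<open>Here \<^term>\<open>step\<close> is the stepsize, \<^term>\<open>step_max\<close> its upper bound, and
  \<^term>\<open>relax_min\<close>, \<^term>\<open>tol_max\<close>, \<^term>\<open>mom_max\<close> bound the relaxation, inner tolerance and
  momentum parameters; \<^term>\<open>clip\<close> is the factor \<open>c\<^sub>f\<close> in \<open>M\<^sub>u = c\<^sub>f M\<^sub>f\<close>.\<close>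

record 'd params =
  start :: "real^'d"
  step :: real
  step_max :: real
  relax_min :: real
  tol_max :: real
  mom_max :: real
  clip :: real

definition M_u :: "('d::finite, 'p::finite) setting \<Rightarrow> 'd params \<Rightarrow> real" where
  "M_u S A = clip A * bd_f S"

locale valid_params =
  fixes S :: "('d::finite, 'p::finite) setting" and A :: "'d params"
  assumes start: "start A \<in> mfd S"
    and step: "0 < step A" "step A \<le> step_max A"
    and relax_min: "0 < relax_min A" "relax_min A \<le> 1"
    and tol_max: "0 \<le> tol_max A"
    and mom_max: "0 \<le> mom_max A" "mom_max A < 1"
    and clip: "1 \<le> clip A"

definition C_alpha :: "('d::finite, 'p::finite) setting \<Rightarrow> 'd params \<Rightarrow> real" where
  "C_alpha S A =
     ((sqrt (lip_R S * C_dist S * tol_max A + (M_u S A + lip_R S) * min (delta S) (delta_T S))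
       - sqrt (lip_R S * C_dist S * tol_max A)) / (M_u S A + lip_R S))\<^sup>2"

section \<open>Proximal model, dual, criticality measure\<close>

definition model ::
  "('d::finite, 'p::finite) setting \<Rightarrow> 'd params \<Rightarrow> real^'d \<Rightarrow> real^'d \<Rightarrow> real^'d \<Rightarrow> real" where
  "model S A x m \<eta> = m \<bullet> \<eta> + (norm \<eta>)\<^sup>2 / (2 * step A) + reg S (x + \<eta>)"

definition dual ::
  "('d::finite, 'p::finite) setting \<Rightarrow> 'd params \<Rightarrow> real^'d \<Rightarrow> real^'d \<Rightarrow> real^'p \<Rightarrow> real" where
  "dual S A x m l = conjugate (model S A x m) (- (transpose (Bmat S x) *v l))"

definition exact_step ::
  "('d::finite, 'p::finite) setting \<Rightarrow> 'd params \<Rightarrow> real^'d \<Rightarrow> real^'d \<Rightarrow> real^'d" where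
  "exact_step S A x m = (ARG_MIN (model S A x m) \<eta>. \<eta> \<in> Tan S x)"

definition criticality ::
  "('d::finite, 'p::finite) setting \<Rightarrow> real^'d \<Rightarrow> real^'d \<Rightarrow> real" where
  "criticality S x \<eta> = sqrt ((infdist 0 {gradient (fobj S) (x + \<eta>) + s + v | s v.
      s \<in> subdiff (reg S) (x + \<eta>) \<and> v \<in> normal_space (mfd S) x})\<^sup>2 + (norm \<eta>)\<^sup>2)"

section \<open>The stochastic algorithm\<close>

text \<open>All processes live on \<^term>\<open>prb\<close>. A batch is a finite sequence of indices, so sampling with
  and without replacement are both covered; \<^term>\<open>est\<close> is the internal state of the estimator (reference
  points, stored gradients, ...), with values in the measurable space \<^term>\<open>est_space\<close>.\<close>

record ('w, 's, 'd, 'p) run =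
  prb :: "'w measure"
  est_space :: "'s measure"
  est :: "nat \<Rightarrow> 'w \<Rightarrow> 's"
  batch :: "nat \<Rightarrow> 'w \<Rightarrow> nat list"
  xit :: "nat \<Rightarrow> 'w \<Rightarrow> real^'d"
  uit :: "nat \<Rightarrow> 'w \<Rightarrow> real^'d"
  uhat :: "nat \<Rightarrow> 'w \<Rightarrow> real^'d"
  mbar :: "nat \<Rightarrow> 'w \<Rightarrow> real^'d"
  mit :: "nat \<Rightarrow> 'w \<Rightarrow> real^'d"
  lam :: "nat \<Rightarrow> 'w \<Rightarrow> real^'p"
  wit :: "nat \<Rightarrow> 'w \<Rightarrow> real^'d"
  eta :: "nat \<Rightarrow> 'w \<Rightarrow> real^'d"
  relax :: "nat \<Rightarrow> 'w \<Rightarrow> real"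
  tol :: "nat \<Rightarrow> 'w \<Rightarrow> real"
  mom :: "nat \<Rightarrow> 'w \<Rightarrow> real"
  pot :: "nat \<Rightarrow> 'w \<Rightarrow> real"

definition rv_events :: "'w measure \<Rightarrow> ('w \<Rightarrow> 'a) \<Rightarrow> 'a measure \<Rightarrow> 'w set set" where
  "rv_events P Y N = {Y -` C \<inter> space P | C. C \<in> sets N}"

text \<open>Natural filtration: \<^term>\<open>hist X k\<close> is the history before the \<^term>\<open>k\<close>-th batch is
  sampled. Batches are sampled from the outer iteration 1 on.\<close>

definition hist :: "('w, 's, 'd::finite, 'p::finite) run \<Rightarrow> nat \<Rightarrow> 'w measure" where
  "hist X k = sigma (space (prb X))
     ((\<Union>j\<in>{..k}. rv_events (prb X) (xit X j) borel \<union> rv_events (prb X) (mbar X j) borel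
          \<union> rv_events (prb X) (est X j) (est_space X)) \<union>
      (\<Union>j\<in>{1..<k}. rv_events (prb X) (batch X j) (count_space UNIV)) \<union>
      (\<Union>j\<in>{..<k}. rv_events (prb X) (uit X j) borel \<union> rv_events (prb X) (lam X j) borel
          \<union> rv_events (prb X) (wit X j) borel \<union> rv_events (prb X) (eta X j) borel))"

definition hist_batch :: "('w, 's, 'd::finite, 'p::finite) run \<Rightarrow> nat \<Rightarrow> 'w measure" where
  "hist_batch X k = sigma (space (prb X))
     (sets (hist X k) \<union> rv_events (prb X) (batch X k) (count_space UNIV))"

definition dual_at :: "('d::finite, 'p::finite) setting \<Rightarrow> 'd params \<Rightarrow> ('w, 's, 'd, 'p) run
    \<Rightarrow> nat \<Rightarrow> 'w \<Rightarrow> real^'p \<Rightarrow> real" where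
  "dual_at S A X k \<omega> = dual S A (xit X k \<omega>) (mit X k \<omega>)"

text \<open>Everything in the algorithm except the tolerance requirement on \<^term>\<open>lam\<close>. That a concrete
  inner routine meets the tolerance is thus not part of the hypotheses on a run.\<close>

locale irpmvr_steps =
  fixes S :: "('d::finite, 'p::finite) setting" and A :: "'d params"
    and X :: "('w, 's, 'd, 'p) run"
  assumes prob: "prob_space (prb X)"
    and random_variables:
      "est X k \<in> measurable (prb X) (est_space X)"
      "batch X k \<in> measurable (prb X) (count_space UNIV)"
      "xit X k \<in> borel_measurable (prb X)"
      "uit X k \<in> borel_measurable (prb X)"
      "mbar X k \<in> borel_measurable (prb X)"
      "lam X k \<in> borel_measurable (prb X)"
      "wit X k \<in> borel_measurable (prb X)"
      "eta X k \<in> borel_measurable (prb X)"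
    and params_adapted:
      "relax X k \<in> borel_measurable (hist X k)"
      "tol X k \<in> borel_measurable (hist X k)"
      "mom X k \<in> borel_measurable (hist X k)"
    and params_range: "\<omega> \<in> space (prb X) \<Longrightarrow>
      relax X k \<omega> \<in> {relax_min A..1} \<and> tol X k \<omega> \<in> {0..tol_max A} \<and> mom X k \<omega> \<in> {0..mom_max A}"
    and init: "\<omega> \<in> space (prb X) \<Longrightarrow> xit X 0 \<omega> = start A"
      "\<omega> \<in> space (prb X) \<Longrightarrow> uit X 0 \<omega> = rgrad (mfd S) (fobj S) (start A)"
      "\<omega> \<in> space (prb X) \<Longrightarrow> uhat X 0 \<omega> = rgrad (mfd S) (fobj S) (start A)"
      "\<omega> \<in> space (prb X) \<Longrightarrow> mbar X 0 \<omega> = rgrad (mfd S) (fobj S) (start A)"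
    and sample: "k \<noteq> 0 \<Longrightarrow> \<omega> \<in> space (prb X) \<Longrightarrow> set (batch X k \<omega>) \<subseteq> {1..num S}"
    and estimator_from_batch: "k \<noteq> 0 \<Longrightarrow> uit X k \<in> borel_measurable (hist_batch X k)"
    and estimator_tangent: "k \<noteq> 0 \<Longrightarrow> \<omega> \<in> space (prb X) \<Longrightarrow> uit X k \<omega> \<in> Tan S (xit X k \<omega>)"
    and clipped: "k \<noteq> 0 \<Longrightarrow> \<omega> \<in> space (prb X) \<Longrightarrow>
      uhat X k \<omega> = closest_point (cball 0 (M_u S A)) (uit X k \<omega>)"
    and momentum: "\<omega> \<in> space (prb X) \<Longrightarrow>
      mit X k \<omega> = mom X k \<omega> *\<^sub>R mbar X k \<omega> + (1 - mom X k \<omega>) *\<^sub>R uhat X k \<omega>"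
    and primal_point: "\<omega> \<in> space (prb X) \<Longrightarrow>
      wit X k \<omega> = prox (step A) (reg S) (xit X k \<omega> -
        step A *\<^sub>R (mit X k \<omega> + transpose (Bmat S (xit X k \<omega>)) *v lam X k \<omega>)) - xit X k \<omega>"
    and tangent_step: "\<omega> \<in> space (prb X) \<Longrightarrow> eta X k \<omega> = proj_tan S (xit X k \<omega>) (wit X k \<omega>)"
    and retract: "\<omega> \<in> space (prb X) \<Longrightarrow>
      xit X (Suc k) \<omega> = Retr S (xit X k \<omega>) (relax X k \<omega> *\<^sub>R eta X k \<omega>)"
    and transport: "\<omega> \<in> space (prb X) \<Longrightarrow>
      mbar X (Suc k) \<omega> = proj_tan S (xit X (Suc k) \<omega>) (mit X k \<omega>)"

definition inner_accuracy :: "('d::finite, 'p::finite) setting \<Rightarrow> 'd params \<Rightarrow>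
    ('w, 's, 'd, 'p) run \<Rightarrow> bool" where
  "inner_accuracy S A X \<longleftrightarrow> (\<forall>k. \<forall>\<omega>\<in>space (prb X).
     norm (gradient (dual_at S A X k \<omega>) (lam X k \<omega>)) \<le> tol X k \<omega>)"

definition irpmvr :: "('d::finite, 'p::finite) setting \<Rightarrow> 'd params \<Rightarrow>
    ('w, 's, 'd, 'p) run \<Rightarrow> bool" where
  "irpmvr S A X \<longleftrightarrow> irpmvr_steps S A X \<and> inner_accuracy S A X"

definition theta :: "('d::finite, 'p::finite) setting \<Rightarrow> 'd params \<Rightarrow> ('w, 's, 'd, 'p) run
    \<Rightarrow> nat \<Rightarrow> 'w \<Rightarrow> real" where
  "theta S A X k \<omega> = criticality S (xit X k \<omega>) (exact_step S A (xit X k \<omega>) (mit X k \<omega>))"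

definition err :: "('d::finite, 'p::finite) setting \<Rightarrow> ('w, 's, 'd, 'p) run
    \<Rightarrow> nat \<Rightarrow> 'w \<Rightarrow> real^'d" where
  "err S X k \<omega> = mit X k \<omega> - rgrad (mfd S) (fobj S) (xit X k \<omega>)"

text \<open>Conditional expectation of a nonnegative random variable, possibly infinite: integrability
  of the potentials is assumed at index 0 only.\<close>

definition cexp :: "('w, 's, 'd::finite, 'p::finite) run \<Rightarrow> nat \<Rightarrow> ('w \<Rightarrow> real) \<Rightarrow> 'w \<Rightarrow> ereal" where
  "cexp X k Y \<omega> = enn2ereal (nn_cond_exp (prb X) (hist X k) (\<lambda>\<omega>. ennreal (Y \<omega>)) \<omega>)"

definition error_dissipation :: "('d::finite, 'p::finite) setting \<Rightarrow> real \<Rightarrow> real \<Rightarrow> real \<Rightarrow>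
    ('w, 's, 'd, 'p) run \<Rightarrow> bool" where
  "error_dissipation S c_e \<mu> \<nu> X \<longleftrightarrow>
     (\<forall>k. pot X k \<in> borel_measurable (hist X k)) \<and>
     (\<forall>k. \<forall>\<omega>\<in>space (prb X). 0 \<le> pot X k \<omega>) \<and>
     integrable (prb X) (pot X 0) \<and>
     (\<forall>k. AE \<omega> in prb X.
        cexp X k (\<lambda>\<omega>. (norm (err S X k \<omega>))\<^sup>2) \<omega> + ereal \<mu> * ereal (pot X k \<omega>)
        \<le> ereal c_e * (ereal (pot X k \<omega>) - cexp X k (pot X (Suc k)) \<omega>)
          + ereal \<nu> * cexp X k (\<lambda>\<omega>. (norm (eta X k \<omega>))\<^sup>2) \<omega>)"

definition tolerance_rule :: "'d::finite params \<Rightarrow> real \<Rightarrow> real \<Rightarrow> nat \<Rightarrow>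
    ('w, 's, 'd, 'p::finite) run \<Rightarrow> bool" where
  "tolerance_rule A \<kappa> \<theta> K X \<longleftrightarrow> (\<forall>k. \<forall>\<omega>\<in>space (prb X). tol X k \<omega> =
     min (tol_max A) (max (\<kappa> * (norm (if k = 0 then 0 else eta X (k - 1) \<omega>))\<^sup>2)
                          (if k < K then \<theta> else 0)))"

section \<open>Inner routines\<close>

text \<open>A routine receives the gradient oracle of the dual and the tolerance. Its \<^term>\<open>j\<close>-th
  checkpoint consists of a candidate point and the number of inner (accelerated gradient)
  iterations spent so far; it returns the first candidate that meets the tolerance.\<close>

type_synonym 'p routine =
  "(real^'p \<Rightarrow> real^'p) \<Rightarrow> real \<Rightarrow> nat \<Rightarrow> (real^'p) \<times> nat"

definition meets :: "'p::finite routine \<Rightarrow> (real^'p \<Rightarrow> real^'p) \<Rightarrow> real \<Rightarrow> nat \<Rightarrow> bool" where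
  "meets rt g \<Delta> j \<longleftrightarrow> norm (g (fst (rt g \<Delta> j))) \<le> \<Delta>"

definition inner_iterations ::
  "'p::finite routine \<Rightarrow> (real^'p \<Rightarrow> real^'p) \<Rightarrow> real \<Rightarrow> enat" where
  "inner_iterations rt g \<Delta> = (if \<exists>j. meets rt g \<Delta> j
     then enat (snd (rt g \<Delta> (LEAST j. meets rt g \<Delta> j))) else \<infinity>)"

definition uses_routine :: "('d::finite, 'p::finite) setting \<Rightarrow> 'd params \<Rightarrow> 'p routine \<Rightarrow>
    ('w, 's, 'd, 'p) run \<Rightarrow> bool" where
  "uses_routine S A rt X \<longleftrightarrow> (\<forall>k. \<forall>\<omega>\<in>space (prb X).
     let g = gradient (dual_at S A X k \<omega>); \<Delta> = tol X k \<omega>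
     in (\<exists>j. meets rt g \<Delta> j) \<longrightarrow> lam X k \<omega> = fst (rt g \<Delta> (LEAST j. meets rt g \<Delta> j)))"

definition total_inner :: "('d::finite, 'p::finite) setting \<Rightarrow> 'd params \<Rightarrow> 'p routine \<Rightarrow>
    ('w, 's, 'd, 'p) run \<Rightarrow> nat \<Rightarrow> 'w \<Rightarrow> enat" where
  "total_inner S A rt X K \<omega> =
     (\<Sum>k<K. inner_iterations rt (gradient (dual_at S A X k \<omega>)) (tol X k \<omega>))"

text \<open>Accelerated gradient method for an \<^term>\<open>L\<close>-smooth convex function with gradient
  \<^term>\<open>g\<close>; the state is (iterate, extrapolated point, momentum scalar).\<close>

primrec fista :: "('a::euclidean_space \<Rightarrow> 'a) \<Rightarrow> real \<Rightarrow> 'a \<Rightarrow> nat \<Rightarrow> 'a \<times> 'a \<times> real" where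
  "fista g L z 0 = (z, z, 1)"
| "fista g L z (Suc j) =
     (let (l, y, t) = fista g L z j;
          l' = y - (1 / L) *\<^sub>R g y;
          t' = (1 + sqrt (1 + 4 * t\<^sup>2)) / 2
      in (l', l' + ((t - 1) / t') *\<^sub>R (l' - l), t'))"

text \<open>Fast gradient method for an \<^term>\<open>L\<close>-smooth, \<^term>\<open>\<mu>\<close>-strongly convex function.\<close>

primrec fgm :: "('a::euclidean_space \<Rightarrow> 'a) \<Rightarrow> real \<Rightarrow> real \<Rightarrow> 'a \<Rightarrow> nat \<Rightarrow> 'a \<times> 'a" where
  "fgm g L \<mu> z 0 = (z, z)"
| "fgm g L \<mu> z (Suc j) =
     (let (l, y) = fgm g L \<mu> z j;
          l' = y - (1 / L) *\<^sub>R g y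
      in (l', l' + ((sqrt L - sqrt \<mu>) / (sqrt L + sqrt \<mu>)) *\<^sub>R (l' - l)))"

text \<open>Accumulative regularization (Lan, Ouyang, Zhang). Stage \<^term>\<open>s\<close> minimizes the function plus
  \<open>(\<sigma>\<^sub>s/2) \<parallel>\<cdot> - c\<^sub>s\<parallel>\<^sup>2\<close> with \<open>\<sigma>\<^sub>s = 4\<^bsup>s-1\<^esup> \<sigma>\<^sub>1\<close>, warm-started at the previous
  stage's output, where the center \<open>c\<^sub>s\<close> moves towards that output with weight
  \<open>1 - \<sigma>\<^bsub>s-1\<^esub>/\<sigma>\<^sub>s\<close> (\<open>\<sigma>\<^sub>0 = 0\<close>). The stage length
  \<open>\<lceil>8 sqrt (2 c\<^sub>A (L + \<sigma>\<^sub>s) / \<sigma>\<^sub>s)\<rceil>\<close>, with \<open>c\<^sub>A = 2\<close> from the rate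
  \<open>2 (L + \<sigma>\<^sub>s) / j\<^sup>2\<close> of the accelerated gradient method, contracts the distance to the
  stage's minimizer by the factor 8.\<close>

definition ar_sigma :: "real \<Rightarrow> nat \<Rightarrow> real" where
  "ar_sigma \<sigma>1 s = (if s = 0 then 0 else 4 ^ (s - 1) * \<sigma>1)"

definition ar_length :: "real \<Rightarrow> real \<Rightarrow> nat \<Rightarrow> nat" where
  "ar_length L \<sigma>1 s =
     nat \<lceil>16 * sqrt ((L + ar_sigma \<sigma>1 s) / ar_sigma \<sigma>1 s)\<rceil>"

primrec ar :: "('a::euclidean_space \<Rightarrow> 'a) \<Rightarrow> real \<Rightarrow> real \<Rightarrow> 'a \<Rightarrow> nat \<Rightarrow> 'a \<times> 'a" where
  "ar g L \<sigma>1 z 0 = (z, z)"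
| "ar g L \<sigma>1 z (Suc s) =
     (let (l, c) = ar g L \<sigma>1 z s;
          \<sigma> = ar_sigma \<sigma>1 (Suc s);
          \<theta> = 1 - ar_sigma \<sigma>1 s / \<sigma>;
          c' = (1 - \<theta>) *\<^sub>R c + \<theta> *\<^sub>R l
      in (fst (fista (\<lambda>y. g y + \<sigma> *\<^sub>R (y - c')) (L + \<sigma>) l (ar_length L \<sigma>1 (Suc s))), c'))"

definition dual_lip :: "('d::finite, 'p::finite) setting \<Rightarrow> 'd params \<Rightarrow> real" where
  "dual_lip S A = step A * (CB_hi S)\<^sup>2"

text \<open>A priori bound on the norm of some dual minimizer.\<close>

definition dual_radius :: "('d::finite, 'p::finite) setting \<Rightarrow> 'd params \<Rightarrow> real" where
  "dual_radius S A = 2 * (M_u S A + lip_R S) / CB_lo S"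

definition routine_FISTA :: "('d::finite, 'p::finite) setting \<Rightarrow> 'd params \<Rightarrow> 'p routine" where
  "routine_FISTA S A g \<Delta> j = (fst (fista g (dual_lip S A) 0 j), j)"

text \<open>Regularization \<open>\<delta> = \<rho> \<Delta>\<close>.\<close>

definition routine_NFG ::
  "('d::finite, 'p::finite) setting \<Rightarrow> 'd params \<Rightarrow> real \<Rightarrow> 'p routine" where
  "routine_NFG S A \<rho> g \<Delta> j =
     (fst (fgm (\<lambda>y. g y + (\<rho> * \<Delta>) *\<^sub>R y) (dual_lip S A + \<rho> * \<Delta>) (\<rho> * \<Delta>) 0 j), j)"

text \<open>First-stage regularization \<open>\<sigma>\<^sub>1 = \<rho> \<Delta>\<close>; candidates are the stage outputs.\<close>

definition routine_AR ::
  "('d::finite, 'p::finite) setting \<Rightarrow> 'd params \<Rightarrow> real \<Rightarrow> 'p routine" where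
  "routine_AR S A \<rho> g \<Delta> s = (fst (ar g (dual_lip S A) (\<rho> * \<Delta>) 0 s),
     \<Sum>i=1..s. ar_length (dual_lip S A) (\<rho> * \<Delta>) i)"

end

theory Submission
  imports Defs
begin

text \<open>
  If \<open>w\<close> is the primal point belonging to an approximate dual solution, the size of the dual
  gradient is \<open>\<parallel>B\<^sub>x w\<parallel>\<close>, so the normal component of \<open>w\<close> has length at most \<open>C\<^sub>0 \<Delta>\<close>. Since the search
  direction \<open>m\<close> is tangent, this component enters the proximal model through \<open>R\<close> only, and the
  projected step is optimal for the model up to \<open>2 \<ell>\<^sub>R C\<^sub>0 \<Delta>\<close>. This yields a one-step decrease of \<open>\<Phi>\<close>
  by multiples of \<open>\<parallel>\<eta>\<parallel>\<^sup>2\<close> and of the squared length of the exact step, up to the squared estimator error and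
  the tolerance. In expectation the error-dissipation condition telescopes, and both the accumulated
  error and the adaptive part \<open>\<kappa> \<parallel>\<eta>\<parallel>\<^sup>2\<close> of the tolerance are absorbed by the decrease.

  For the inner iterations, the dual is convex and \<open>\<alpha> C\<^sub>B\<^sup>2\<close>-smooth with a minimizer in a fixed ball.
  Accelerated gradient with the smoothness inequality \<open>\<parallel>\<nabla>G\<parallel>\<^sup>2 \<le> 2 L (G - min G)\<close> needs \<open>O(1/\<Delta>)\<close>
  iterations; regularization with weight proportional to \<open>\<Delta>\<close>, in one or in several stages, improves
  the exponent to \<open>1/2\<close>, up to a logarithm in the case of one stage. All tolerances are at least a multiple of \<open>\<epsilon>\<^sup>2\<close>, and there are
  \<open>O(\<epsilon>\<^sup>-\<^sup>2)\<close> outer iterations.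
\<close>

section \<open>Accelerated gradient methods\<close>

text \<open>Young's inequality with weight \<open>\<tau>\<close> separates the estimator error from
  the step. It costs \<open>relax_min A * \<tau> / 2\<close> directly and, once the error is traded
  for steps at rate \<open>\<nu>\<close>, another \<open>\<nu> / (2 * \<tau>)\<close>. The
  prescribed \<open>\<tau>\<close> minimizes this sum, and the stepsize bound keeps the remaining
  coefficient \<open>a_eta\<close> positive. \<open>C_comp\<close> rescales the decrease until it
  pays for both terms of the criticality bound: the exact step through \<open>a_etahat\<close>,
  twice the squared error through \<open>a_eta\<close>.

  Three obstacles shape the rest. Tangent vectors are velocities of curves, so linear algebra with
  \<open>Bmat\<close> becomes available only after tangent spaces are identified with kernels of
  chart derivatives. The chart selected at a point may jump, so continuity of the tangent
  projection, which makes the error a random variable, has to be proved across charts. Potentials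
  after the initial one could a priori have infinite expectation, so dissipation is integrated in
  \<open>ennreal\<close> before the return to reals.\<close>

lemma continuous_coercive_attains_min:
  fixes f :: "'a::euclidean_space \<Rightarrow> real"
  assumes "continuous_on UNIV f" "closed T" "T \<noteq> {}" "c > 0"
    and coercive: "\<And>y. f y \<ge> a - b * norm y + c * (norm y)\<^sup>2"
  shows "\<exists>z\<in>T. \<forall>y\<in>T. f z \<le> f y"
proof -
  obtain y0 where y0: "y0 \<in> T" using assms by auto
  \<comment> \<open>Outside this ball \<open>c * norm y\<close> exceeds the sum of the three
    absolute values, and \<open>norm y > 1\<close> then lets the quadratic term beat the linear term
    and both constants at once.\<close>
  define r where "r = max (norm y0) (max 1 ((\<bar>b\<bar> + \<bar>f y0\<bar> + \<bar>a\<bar>) / c + 1))"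
  have out: "f y > f y0" if "norm y > r" for y
  proof -
    have r1: "norm y > 1" "norm y > (\<bar>b\<bar> + \<bar>f y0\<bar> + \<bar>a\<bar>) / c"
      using that unfolding r_def by (auto simp: max_def split: if_splits)
    have "c * norm y > \<bar>b\<bar> + \<bar>f y0\<bar> + \<bar>a\<bar>"
      using r1(2) assms(4) by (simp add: field_simps)
    hence "c * norm y * norm y > (\<bar>b\<bar> + \<bar>f y0\<bar> + \<bar>a\<bar>) * norm y"
      using r1(1) by (intro mult_strict_right_mono) auto
    moreover have "b * norm y \<le> \<bar>b\<bar> * norm y" by (simp add: mult_right_mono)
    moreover have "(\<bar>f y0\<bar> + \<bar>a\<bar>) * 1 \<le> (\<bar>f y0\<bar> + \<bar>a\<bar>) * norm y"
      using r1(1) by (intro mult_left_mono) auto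
    ultimately show ?thesis using coercive[of y] by (simp add: power2_eq_square algebra_simps)
  qed
  have "compact (T \<inter> cball 0 r)" using assms by (intro closed_Int_compact) auto
  moreover have "T \<inter> cball 0 r \<noteq> {}" using y0 unfolding r_def by auto
  moreover have "continuous_on (T \<inter> cball 0 r) f" using assms(1) continuous_on_subset by blast
  ultimately obtain z where z: "z \<in> T \<inter> cball 0 r" "\<forall>y\<in>T \<inter> cball 0 r. f z \<le> f y"
    using continuous_attains_inf by blast
  have "f z \<le> f y" if "y \<in> T" for y
  proof (cases "norm y \<le> r")
    case True thus ?thesis using z that by auto
  next
    case False
    have "f z \<le> f y0" using z(2) y0 unfolding r_def by auto
    thus ?thesis using out[of y] False by auto
  qed
  thus ?thesis using z by auto
qed

lemma norm_sq_diff_scaleR: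
  fixes a v :: "'a::real_inner"
  shows "(norm (a - c *\<^sub>R v))\<^sup>2 = (norm a)\<^sup>2 - 2 * c * (v \<bullet> a) + c\<^sup>2 * (norm v)\<^sup>2"
  unfolding power2_norm_eq_inner
  by (simp add: inner_diff_left inner_diff_right inner_commute algebra_simps power2_eq_square)

lemma norm_sq_convex_comb:
  fixes a b :: "'a::real_inner"
  shows "(norm (u *\<^sub>R a + (1 - u) *\<^sub>R b))\<^sup>2
    = u * (norm a)\<^sup>2 + (1 - u) * (norm b)\<^sup>2 - u * (1 - u) * (norm (a - b))\<^sup>2"
  unfolding power2_norm_eq_inner
  by (simp add: inner_add_left inner_add_right inner_diff_left inner_diff_right inner_commute algebra_simps)

text \<open>Only two quadratic bounds are asked of the field \<open>g\<close>; \<open>gderiv\<close>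
  recovers that it is the gradient. Such bounds are what comparing minimizers of proximal models
  delivers for the dual. The dual itself has \<open>\<mu> = 0\<close>, its regularizations have
  \<open>\<mu> > 0\<close>.\<close>

locale smooth_convex =
  fixes f :: "'a::euclidean_space \<Rightarrow> real" and g :: "'a \<Rightarrow> 'a" and L \<mu> :: real
  assumes lower: "f x + g x \<bullet> (y - x) + \<mu> / 2 * (norm (y - x))\<^sup>2 \<le> f y"
    and upper: "f y \<le> f x + g x \<bullet> (y - x) + L / 2 * (norm (y - x))\<^sup>2"
    and L_pos: "L > 0" and mu_nonneg: "\<mu> \<ge> 0"
begin

lemma continuous: "continuous_on UNIV f"
proof -
  have "isCont f x" for x
  proof -
    have 1: "((\<lambda>y. f x + g x \<bullet> (y - x) + \<mu> / 2 * (norm (y - x))\<^sup>2) \<longlongrightarrow> f x) (at x)"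
      by (auto intro!: tendsto_eq_intros)
    have 2: "((\<lambda>y. f x + g x \<bullet> (y - x) + L / 2 * (norm (y - x))\<^sup>2) \<longlongrightarrow> f x) (at x)"
      by (auto intro!: tendsto_eq_intros)
    show ?thesis unfolding isCont_def
      by (rule tendsto_sandwich[OF _ _ 1 2]) (intro always_eventually allI lower upper)+
  qed
  thus ?thesis by (simp add: continuous_on_eq_continuous_at)
qed

lemma gderiv: "GDERIV f x :> g x"
proof -
  have "((\<lambda>y. (f y - f x - (y - x) \<bullet> g x) /\<^sub>R norm (y - x)) \<longlongrightarrow> 0) (at x)"
  proof (rule Lim_null_comparison)
    show "\<forall>\<^sub>F y in at x. norm ((f y - f x - (y - x) \<bullet> g x) /\<^sub>R norm (y - x))
        \<le> L / 2 * norm (y - x)"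
      unfolding eventually_at_filter
    proof (intro always_eventually allI impI)
      fix y assume "y \<noteq> x"
      have "0 \<le> \<mu> / 2 * (norm (y - x))\<^sup>2" using mu_nonneg by simp
      hence "0 \<le> f y - f x - (y - x) \<bullet> g x" using lower[of x y] by (simp add: inner_commute)
      moreover have "f y - f x - (y - x) \<bullet> g x \<le> L / 2 * (norm (y - x))\<^sup>2"
        using upper[of y x] by (simp add: inner_commute)
      ultimately show "norm ((f y - f x - (y - x) \<bullet> g x) /\<^sub>R norm (y - x)) \<le> L / 2 * norm (y - x)"
        using \<open>y \<noteq> x\<close> by (simp add: field_simps power2_eq_square)
    qed
    show "((\<lambda>y. L / 2 * norm (y - x)) \<longlongrightarrow> 0) (at x)" by (auto intro!: tendsto_eq_intros)
  qed
  thus ?thesis unfolding gderiv_def has_derivative_within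
    by (simp add: bounded_linear_inner_left divide_inverse mult.commute diff_diff_eq)
qed

text \<open>Descent of a gradient step at \<open>y\<close> combined with the lower bound at
  \<open>y\<close>, the comparison point \<open>x\<close> being free. The accelerated methods take
  for \<open>x\<close> the previous iterate, the minimizer, or \<open>y\<close> itself.\<close>

lemma gradient_step:
  "f (y - (1 / L) *\<^sub>R g y) \<le> f x + g y \<bullet> (y - x) - \<mu> / 2 * (norm (x - y))\<^sup>2 - (norm (g y))\<^sup>2 / (2 * L)"
proof -
  have "f (y - (1 / L) *\<^sub>R g y) \<le> f y - (norm (g y))\<^sup>2 / (2 * L)"
    using upper[of "y - (1 / L) *\<^sub>R g y" y] L_pos
    by (simp add: power2_norm_eq_inner field_simps power2_eq_square dot_square_norm)
  thus ?thesis using lower[of y x] by (simp add: inner_diff_right)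
qed

text \<open>A gradient step from \<open>x\<close> cannot get below the minimum. This turns bounds on
  function values into bounds on the gradient, the quantity that the tolerance measures.\<close>

lemma norm_gradient_le:
  assumes "\<And>y. f z \<le> f y"
  shows "(norm (g x))\<^sup>2 \<le> 2 * L * (f x - f z)"
proof -
  have "f z \<le> f x - (norm (g x))\<^sup>2 / (2 * L)"
    using gradient_step[of x x] assms[of "x - (1 / L) *\<^sub>R g x"] by simp
  thus ?thesis using L_pos by (simp add: field_simps)
qed

lemma minimizer_gradient: "(\<And>y. f z \<le> f y) \<Longrightarrow> g z = 0"
  using norm_gradient_le[of z z] by simp

lemma minimizer_growth: "(\<And>y. f z \<le> f y) \<Longrightarrow> f z + \<mu> / 2 * (norm (y - z))\<^sup>2 \<le> f y"
  using lower[of z y] minimizer_gradient[of z] by simp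

lemma minimizer_exists:
  assumes "\<mu> > 0" shows "\<exists>z. \<forall>y. f z \<le> f y"
proof -
  have "f y \<ge> f 0 - norm (g 0) * norm y + \<mu> / 2 * (norm y)\<^sup>2" for y
    using lower[of 0 y] Cauchy_Schwarz_ineq2[of "g 0" y] by simp
  thus ?thesis
    using continuous_coercive_attains_min[OF continuous closed_UNIV, of "\<mu>/2" "f 0" "norm (g 0)"] assms
    by auto
qed

text \<open>A quadratic equals its second-order expansion, so \<open>\<sigma>\<close> is added to
  both constants without loss.\<close>

lemma regularize:
  assumes "\<sigma> \<ge> 0"
  shows "smooth_convex (\<lambda>y. f y + \<sigma> / 2 * (norm (y - c))\<^sup>2) (\<lambda>y. g y + \<sigma> *\<^sub>R (y - c)) (L + \<sigma>) (\<mu> + \<sigma>)"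
proof
  fix x y
  have eq: "\<sigma> / 2 * (norm (y - c))\<^sup>2 =
      \<sigma> / 2 * (norm (x - c))\<^sup>2 + (\<sigma> *\<^sub>R (x - c)) \<bullet> (y - x) + \<sigma> / 2 * (norm (y - x))\<^sup>2"
    by (simp add: power2_norm_eq_inner inner_simps inner_commute algebra_simps)
  show "f x + \<sigma> / 2 * (norm (x - c))\<^sup>2 + (g x + \<sigma> *\<^sub>R (x - c)) \<bullet> (y - x) + (\<mu> + \<sigma>) / 2 * (norm (y - x))\<^sup>2
      \<le> f y + \<sigma> / 2 * (norm (y - c))\<^sup>2"
    using lower[of x y] unfolding eq by (simp add: inner_add_left algebra_simps add_divide_distrib)
  show "f y + \<sigma> / 2 * (norm (y - c))\<^sup>2 \<le>
      f x + \<sigma> / 2 * (norm (x - c))\<^sup>2 + (g x + \<sigma> *\<^sub>R (x - c)) \<bullet> (y - x) + (L + \<sigma>) / 2 * (norm (y - x))\<^sup>2"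
    using upper[of y x] unfolding eq by (simp add: inner_add_left algebra_simps add_divide_distrib)
qed (use L_pos mu_nonneg assms in auto)

text \<open>Standard potential of the accelerated method. Weight \<open>t - 1\<close> on the
  comparison with the old iterate and weight 1 on the comparison with \<open>z\<close>, all
  multiplied by \<open>t\<close>, produce the linear term \<open>t * (g y \<bullet> a)\<close>,
  which the change of the squared distance consumes. Since \<open>t = 1\<close> at the start, the
  function gap has initial weight zero and only the initial distance enters the bound.\<close>

lemma fista_invariant:
  assumes min: "\<And>y. f z \<le> f y"
  shows "case fista g L x0 j of (l, y, t) \<Rightarrow> t \<ge> (real j + 2) / 2 \<and>
    (t\<^sup>2 - t) * (f l - f z) + L / 2 * (norm (t *\<^sub>R y - (t - 1) *\<^sub>R l - z))\<^sup>2 \<le> L / 2 * (norm (x0 - z))\<^sup>2"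
proof (induction j)
  case (Suc j)
  obtain l y t where st: "fista g L x0 j = (l, y, t)" by (metis prod_cases3)
  define l' where "l' = y - (1 / L) *\<^sub>R g y"
  define t' where "t' = (1 + sqrt (1 + 4 * t\<^sup>2)) / 2"
  define y' where "y' = l' + ((t - 1) / t') *\<^sub>R (l' - l)"
  define a where "a = t *\<^sub>R y - (t - 1) *\<^sub>R l - z"
  from Suc st have t: "t \<ge> (real j + 2) / 2"
    and IH: "(t\<^sup>2 - t) * (f l - f z) + L / 2 * (norm a)\<^sup>2 \<le> L / 2 * (norm (x0 - z))\<^sup>2"
    by (auto simp: a_def)
  have t1: "t \<ge> 1" using t by simp
  have "sqrt (1 + 4 * t\<^sup>2) \<ge> sqrt ((2 * t)\<^sup>2)" by (intro real_sqrt_le_mono) (simp add: power2_eq_square)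
  hence sq: "sqrt (1 + 4 * t\<^sup>2) \<ge> 2 * t" using t1 by (simp only: real_sqrt_abs)
  hence t': "t' \<ge> (real (Suc j) + 2) / 2" "t' > 0" using t t1 unfolding t'_def by (auto simp: field_simps)
  have sqsq: "(sqrt (1 + 4 * t\<^sup>2))\<^sup>2 = 1 + 4 * t\<^sup>2" by simp
  \<comment> \<open>The momentum scalar is the positive root of this quadratic equation: the next
    potential weighs the gap exactly as much as the current step has earned.\<close>
  have tt: "t'\<^sup>2 - t' = t\<^sup>2" unfolding t'_def using sqsq by (simp add: power2_eq_square field_simps)
  have "t' *\<^sub>R y' = t' *\<^sub>R l' + (t - 1) *\<^sub>R (l' - l)"
    unfolding y'_def using t'(2) by (simp add: scaleR_add_right)
  hence "t' *\<^sub>R y' - (t' - 1) *\<^sub>R l' = t *\<^sub>R l' - (t - 1) *\<^sub>R l" by (simp add: algebra_simps)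
  hence ty: "t' *\<^sub>R y' - (t' - 1) *\<^sub>R l' - z = a - (t / L) *\<^sub>R g y"
    unfolding a_def by (simp add: l'_def scaleR_diff_right)
  have i1: "f l' \<le> f l + g y \<bullet> (y - l) - (norm (g y))\<^sup>2 / (2 * L)"
    and i2: "f l' \<le> f z + g y \<bullet> (y - z) - (norm (g y))\<^sup>2 / (2 * L)"
    using gradient_step[of y l] gradient_step[of y z] mu_nonneg unfolding l'_def
    by (smt (verit) mult_nonneg_nonneg divide_nonneg_pos zero_le_power2)+
  define N where "N = (norm (g y))\<^sup>2 / (2 * L)"
  have "(t - 1) * f l' \<le> (t - 1) * (f l + g y \<bullet> (y - l) - N)"
    using i1[folded N_def] t1 by (intro mult_left_mono) auto
  hence "t * (f l' - f z) - (t - 1) * (f l - f z) \<le> g y \<bullet> a - t * N"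
    using i2[folded N_def] unfolding a_def by (simp add: inner_simps algebra_simps)
  hence "t * (t * (f l' - f z) - (t - 1) * (f l - f z)) \<le> t * (g y \<bullet> a - t * N)"
    using t1 by (intro mult_left_mono) auto
  moreover have "L / 2 * (norm (a - (t / L) *\<^sub>R g y))\<^sup>2
      = L / 2 * (norm a)\<^sup>2 - t * (g y \<bullet> a) + t * (t * N)"
    unfolding N_def norm_sq_diff_scaleR using L_pos by (simp add: field_simps power2_eq_square)
  ultimately have "t\<^sup>2 * (f l' - f z) + L / 2 * (norm (a - (t / L) *\<^sub>R g y))\<^sup>2
      \<le> (t\<^sup>2 - t) * (f l - f z) + L / 2 * (norm a)\<^sup>2"
    by (simp add: algebra_simps power2_eq_square)
  hence "(t'\<^sup>2 - t') * (f l' - f z) + L / 2 * (norm (t' *\<^sub>R y' - (t' - 1) *\<^sub>R l' - z))\<^sup>2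
      \<le> L / 2 * (norm (x0 - z))\<^sup>2" using IH unfolding ty tt by linarith
  moreover have "fista g L x0 (Suc j) = (l', y', t')"
    by (simp add: st Let_def l'_def y'_def t'_def)
  ultimately show ?case using t'(1) by simp
qed simp

lemma fista_gap:
  assumes min: "\<And>y. f z \<le> f y"
  shows "(real j)\<^sup>2 * (f (fst (fista g L x0 j)) - f z) \<le> 2 * L * (norm (x0 - z))\<^sup>2"
proof -
  obtain l y t where st: "fista g L x0 j = (l, y, t)" by (metis prod_cases3)
  have t: "t \<ge> (real j + 2) / 2"
    and I: "(t\<^sup>2 - t) * (f l - f z) + L / 2 * (norm (t *\<^sub>R y - (t - 1) *\<^sub>R l - z))\<^sup>2 \<le> L / 2 * (norm (x0 - z))\<^sup>2"
    using fista_invariant[OF min, where j = j and ?x0.0 = x0] st by auto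
  have "(real j / 2) * ((real j) / 2) \<le> t * (t - 1)" using t by (intro mult_mono) auto
  hence "(real j)\<^sup>2 / 4 \<le> t\<^sup>2 - t" by (simp add: power2_eq_square algebra_simps)
  hence "(real j)\<^sup>2 / 4 * (f l - f z) \<le> (t\<^sup>2 - t) * (f l - f z)"
    using min[of l] by (intro mult_right_mono) auto
  also have "\<dots> \<le> L / 2 * (norm (x0 - z))\<^sup>2"
  proof -
    have "0 \<le> L / 2 * (norm (t *\<^sub>R y - (t - 1) *\<^sub>R l - z))\<^sup>2" using L_pos by simp
    thus ?thesis using I by linarith
  qed
  finally show ?thesis by (simp add: st mult.commute mult.left_commute)
qed

text \<open>The vector \<open>(1 / q) *\<^sub>R ((1 + q) *\<^sub>R y - l)\<close> is the auxiliary
  iterate \<open>v\<close> of Nesterov's three-sequence scheme, recovered from the two stored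
  points: \<open>y\<close> is the average of \<open>l\<close> and \<open>v\<close> with weights
  proportional to 1 and \<open>q\<close>. Weighing the lower bounds at \<open>l\<close> and
  \<open>z\<close> by \<open>1 - q\<close> and \<open>q\<close> contracts the potential by
  \<open>1 - q\<close>.\<close>

lemma fgm_invariant:
  assumes min: "\<And>y. f z \<le> f y" and mu: "0 < \<mu>" "\<mu> \<le> L" and q: "q = sqrt (\<mu> / L)"
  shows "case fgm g L \<mu> x0 j of (l, y) \<Rightarrow>
    f l - f z + \<mu> / 2 * (norm ((1 / q) *\<^sub>R ((1 + q) *\<^sub>R y - l) - z))\<^sup>2
      \<le> (1 - q) ^ j * (f x0 - f z + \<mu> / 2 * (norm (x0 - z))\<^sup>2)"
proof (induction j)
  case 0
  have "q > 0" using mu q by simp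
  hence "(1 / q) *\<^sub>R ((1 + q) *\<^sub>R x0 - x0) = x0" by (simp add: algebra_simps)
  thus ?case by simp
next
  case (Suc j)
  obtain l y where st: "fgm g L \<mu> x0 j = (l, y)" by fastforce
  have q0: "0 < q" "q \<le> 1" using mu q by auto
  have q2: "q\<^sup>2 = \<mu> / L" using q mu by simp
  hence Leq: "L = \<mu> / q\<^sup>2" using mu q0 L_pos by (simp add: field_simps)
  define v where "v = (1 / q) *\<^sub>R ((1 + q) *\<^sub>R y - l)"
  define l' where "l' = y - (1 / L) *\<^sub>R g y"
  define y' where "y' = l' + ((sqrt L - sqrt \<mu>) / (sqrt L + sqrt \<mu>)) *\<^sub>R (l' - l)"
  define p where "p = (1 - q) *\<^sub>R v + q *\<^sub>R y - z"
  have step: "fgm g L \<mu> x0 (Suc j) = (l', y')" by (simp add: st Let_def l'_def y'_def)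
  have IH: "f l - f z + \<mu> / 2 * (norm (v - z))\<^sup>2 \<le> (1 - q) ^ j * (f x0 - f z + \<mu> / 2 * (norm (x0 - z))\<^sup>2)"
    using Suc st by (simp add: v_def)
  have sm: "sqrt \<mu> = q * sqrt L" using q L_pos mu by (simp add: real_sqrt_divide)
  have sL: "sqrt L > 0" using L_pos by simp
  have "(sqrt L - sqrt \<mu>) / (sqrt L + sqrt \<mu>) = (sqrt L * (1 - q)) / (sqrt L * (1 + q))"
    unfolding sm by (simp add: algebra_simps)
  hence beta: "(sqrt L - sqrt \<mu>) / (sqrt L + sqrt \<mu>) = (1 - q) / (1 + q)" using sL by simp
  have qv: "q *\<^sub>R v = (1 + q) *\<^sub>R y - l" unfolding v_def using q0 by simp
  have "(1 + q) *\<^sub>R y' = (1 + q) *\<^sub>R l' + (1 - q) *\<^sub>R (l' - l)"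
    unfolding y'_def beta using q0 by (simp add: scaleR_add_right)
  hence "(1 + q) *\<^sub>R y' - l' = l' - (1 - q) *\<^sub>R l" by (simp add: algebra_simps)
  also have "\<dots> = q *\<^sub>R (p + z - (q / \<mu>) *\<^sub>R g y)"
  proof -
    have "q *\<^sub>R (p + z) = (1 - q) *\<^sub>R (q *\<^sub>R v) + q\<^sup>2 *\<^sub>R y"
      unfolding p_def by (simp add: algebra_simps power2_eq_square)
    also have "\<dots> = y - (1 - q) *\<^sub>R l" unfolding qv by (simp add: algebra_simps power2_eq_square)
    finally have e1: "q *\<^sub>R (p + z) = y - (1 - q) *\<^sub>R l" .
    have e2: "q *\<^sub>R ((q / \<mu>) *\<^sub>R g y) = (1 / L) *\<^sub>R g y"
      unfolding Leq using q0 mu by (auto simp: power2_eq_square)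
    show ?thesis unfolding l'_def scaleR_diff_right e1 e2 by (simp add: algebra_simps)
  qed
  finally have v': "(1 / q) *\<^sub>R ((1 + q) *\<^sub>R y' - l') - z = p - (q / \<mu>) *\<^sub>R g y" using q0 by simp
  have i0: "f l' \<le> f y - (norm (g y))\<^sup>2 / (2 * L)"
    using gradient_step[of y y] unfolding l'_def by simp
  have "f y + g y \<bullet> (l - y) \<le> f l"
    using lower[of y l] mu by (smt (verit) mult_nonneg_nonneg divide_nonneg_pos zero_le_power2)
  hence i1: "(1 - q) * (f y + g y \<bullet> (l - y)) \<le> (1 - q) * f l" using q0 by (intro mult_left_mono) auto
  have i2: "q * (f y + g y \<bullet> (z - y) + \<mu> / 2 * (norm (z - y))\<^sup>2) \<le> q * f z"
    using lower[of y z] q0 by (intro mult_left_mono) auto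
  have pv: "p = q *\<^sub>R (y - z) + (1 - q) *\<^sub>R (v - z)" unfolding p_def by (simp add: algebra_simps)
  have "(norm p)\<^sup>2 = (1 - q) * (norm (v - z))\<^sup>2 + q * (norm (y - z))\<^sup>2 - q * (1 - q) * (norm ((y - z) - (v - z)))\<^sup>2"
    unfolding pv norm_sq_convex_comb by simp
  also have "\<dots> \<le> (1 - q) * (norm (v - z))\<^sup>2 + q * (norm (y - z))\<^sup>2"
    using q0 by simp
  finally have np: "\<mu> / 2 * (norm p)\<^sup>2 \<le> \<mu> / 2 * ((1 - q) * (norm (v - z))\<^sup>2 + q * (norm (z - y))\<^sup>2)"
    using mu by (intro mult_left_mono) (auto simp: norm_minus_commute)
  \<comment> \<open>With \<open>L = \<mu> / q\<^sup>2\<close> the decrease of the gradient step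
    equals the quadratic term created by moving \<open>p\<close> along the gradient, so the two
    cancel.\<close>
  have gl: "(norm (g y))\<^sup>2 / (2 * L) = \<mu> / 2 * ((q / \<mu>)\<^sup>2 * (norm (g y))\<^sup>2)"
    unfolding Leq using mu q0 by (simp add: field_simps power2_eq_square)
  have nn: "\<mu> / 2 * (norm (p - (q / \<mu>) *\<^sub>R g y))\<^sup>2 =
      \<mu> / 2 * (norm p)\<^sup>2 - q * (g y \<bullet> p) + \<mu> / 2 * ((q / \<mu>)\<^sup>2 * (norm (g y))\<^sup>2)"
    unfolding norm_sq_diff_scaleR using mu by (simp add: field_simps power2_eq_square)
  \<comment> \<open>All linear terms add up to zero; this is where \<open>y\<close> has to lie
    between \<open>l\<close> and \<open>v\<close> in the right proportion.\<close>
  have "q *\<^sub>R p + (1 - q) *\<^sub>R (l - y) + q *\<^sub>R (z - y) = (1 - q) *\<^sub>R (q *\<^sub>R v) + q\<^sup>2 *\<^sub>R y - q *\<^sub>R y + (1 - q) *\<^sub>R (l - y)"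
    unfolding p_def by (simp add: algebra_simps power2_eq_square)
  also have "\<dots> = 0" unfolding qv by (simp add: algebra_simps power2_eq_square)
  finally have "g y \<bullet> (q *\<^sub>R p + (1 - q) *\<^sub>R (l - y) + q *\<^sub>R (z - y)) = 0" by simp
  hence lin: "q * (g y \<bullet> p) + (1 - q) * (g y \<bullet> (l - y)) + q * (g y \<bullet> (z - y)) = 0"
    by (simp add: inner_add_right)
  have "f l' - f z + \<mu> / 2 * (norm (p - (q / \<mu>) *\<^sub>R g y))\<^sup>2
      \<le> (1 - q) * (f l - f z + \<mu> / 2 * (norm (v - z))\<^sup>2)"
    using i0 i1 i2 np lin unfolding nn gl by (simp add: algebra_simps diff_divide_distrib)
  also have "\<dots> \<le> (1 - q) * ((1 - q) ^ j * (f x0 - f z + \<mu> / 2 * (norm (x0 - z))\<^sup>2))"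
    using IH q0 by (intro mult_left_mono) auto
  finally show ?case unfolding step by (simp add: v')
qed

lemma fgm_gap:
  assumes min: "\<And>y. f z \<le> f y" and mu: "0 < \<mu>" "\<mu> \<le> L"
  shows "f (fst (fgm g L \<mu> x0 j)) - f z
    \<le> exp (- sqrt (\<mu> / L) * real j) * (f x0 - f z + \<mu> / 2 * (norm (x0 - z))\<^sup>2)"
proof -
  define q where "q = sqrt (\<mu> / L)"
  have q0: "0 \<le> q" "q \<le> 1" using mu q_def by auto
  obtain l y where st: "fgm g L \<mu> x0 j = (l, y)" by fastforce
  have "(1 - q) ^ j \<le> exp (- q) ^ j"
    using q0 exp_ge_add_one_self[of "- q"] by (intro power_mono) auto
  also have "\<dots> = exp (- q * real j)" by (simp add: exp_of_nat_mult[symmetric] mult.commute)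
  finally have e: "(1 - q) ^ j \<le> exp (- q * real j)" .
  have "f l - f z \<le> f l - f z + \<mu> / 2 * (norm ((1 / q) *\<^sub>R ((1 + q) *\<^sub>R y - l) - z))\<^sup>2"
    using mu by simp
  also have "\<dots> \<le> (1 - q) ^ j * (f x0 - f z + \<mu> / 2 * (norm (x0 - z))\<^sup>2)"
    using fgm_invariant[OF min mu q_def, where j = j and ?x0.0 = x0] st by simp
  also have "\<dots> \<le> exp (- q * real j) * (f x0 - f z + \<mu> / 2 * (norm (x0 - z))\<^sup>2)"
    using e min[of x0] mu by (intro mult_right_mono) auto
  finally show ?thesis by (simp add: st q_def)
qed


text \<open>The center \<open>c'\<close> is placed so that, up to a constant, the new regularizer is
  the old one plus a proximal term at the current output \<open>l\<close>. Hence the new minimizer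
  \<open>b\<close> is no farther from \<open>l\<close> than the old minimizer \<open>a\<close>, and
  the prescribed stage length shrinks that distance eightfold.\<close>

lemma ar_stage:
  assumes a: "\<And>y. f a + \<sigma> / 2 * (norm (a - c))\<^sup>2 \<le> f y + \<sigma> / 2 * (norm (y - c))\<^sup>2"
    and \<sigma>: "0 \<le> \<sigma>" "\<sigma> < \<sigma>'"
    and c': "c' = (\<sigma> / \<sigma>') *\<^sub>R c + (1 - \<sigma> / \<sigma>') *\<^sub>R l"
    and N: "real N \<ge> 16 * sqrt ((L + \<sigma>') / \<sigma>')"
    and l': "l' = fst (fista (\<lambda>y. g y + \<sigma>' *\<^sub>R (y - c')) (L + \<sigma>') l N)"
  obtains b where "\<And>y. f b + \<sigma>' / 2 * (norm (b - c'))\<^sup>2 \<le> f y + \<sigma>' / 2 * (norm (y - c'))\<^sup>2"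
    "norm (b - l) \<le> norm (l - a)" "norm (l' - b) \<le> norm (l - a) / 8"
    "norm (g l' + \<sigma>' *\<^sub>R (l' - c')) \<le> (L + \<sigma>') * (norm (l - a) / 8)"
proof -
  interpret R: smooth_convex "\<lambda>y. f y + \<sigma>' / 2 * (norm (y - c'))\<^sup>2" "\<lambda>y. g y + \<sigma>' *\<^sub>R (y - c')"
      "L + \<sigma>'" "\<mu> + \<sigma>'"
    using regularize \<sigma> by auto
  obtain b where b: "\<And>y. f b + \<sigma>' / 2 * (norm (b - c'))\<^sup>2 \<le> f y + \<sigma>' / 2 * (norm (y - c'))\<^sup>2"
    using R.minimizer_exists mu_nonneg \<sigma> by auto
  define \<theta> where "\<theta> = \<sigma> / \<sigma>'"
  have split: "\<sigma>' / 2 * (norm (y - c'))\<^sup>2 = \<sigma> / 2 * (norm (y - c))\<^sup>2 + (\<sigma>' - \<sigma>) / 2 * (norm (y - l))\<^sup>2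
      - \<sigma>' / 2 * (\<theta> * (1 - \<theta>) * (norm (c - l))\<^sup>2)" for y
  proof -
    have "y - c' = \<theta> *\<^sub>R (y - c) + (1 - \<theta>) *\<^sub>R (y - l)"
      unfolding c' \<theta>_def by (simp add: algebra_simps)
    hence "(norm (y - c'))\<^sup>2 = \<theta> * (norm (y - c))\<^sup>2 + (1 - \<theta>) * (norm (y - l))\<^sup>2
        - \<theta> * (1 - \<theta>) * (norm ((y - c) - (y - l)))\<^sup>2"
      by (simp only: norm_sq_convex_comb)
    note eq = this
    have e: "\<sigma>' * \<theta> = \<sigma>" "\<sigma>' * (1 - \<theta>) = \<sigma>' - \<sigma>"
      unfolding \<theta>_def using \<sigma> by (auto simp: field_simps)
    have "\<sigma>' * (norm (y - c'))\<^sup>2 = \<sigma>' * \<theta> * (norm (y - c))\<^sup>2 + \<sigma>' * (1 - \<theta>) * (norm (y - l))\<^sup>2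
        - \<sigma>' * (\<theta> * (1 - \<theta>) * (norm (c - l))\<^sup>2)"
      unfolding eq by (simp add: norm_minus_commute algebra_simps)
    thus ?thesis unfolding e by (simp add: field_simps)
  qed
  have bl: "norm (b - l) \<le> norm (l - a)"
  proof -
    \<comment> \<open>Add the optimality of \<open>b\<close> tested at \<open>a\<close> to that of
      \<open>a\<close> tested at \<open>b\<close>: only the proximal term at \<open>l\<close>
      survives.\<close>
    have "(\<sigma>' - \<sigma>) / 2 * (norm (b - l))\<^sup>2 \<le> (\<sigma>' - \<sigma>) / 2 * (norm (a - l))\<^sup>2"
      using b[of a] a[of b] unfolding split by linarith
    hence "(norm (b - l))\<^sup>2 \<le> (norm (a - l))\<^sup>2" using \<sigma> by simp
    thus ?thesis by (metis norm_minus_commute norm_ge_zero power2_le_imp_le)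
  qed
  define gap where "gap = f l' + \<sigma>' / 2 * (norm (l' - c'))\<^sup>2 - (f b + \<sigma>' / 2 * (norm (b - c'))\<^sup>2)"
  have gap0: "gap \<ge> 0" unfolding gap_def using b[of l'] by simp
  have "(real N)\<^sup>2 * gap \<le> 2 * (L + \<sigma>') * (norm (l - b))\<^sup>2"
    using R.fista_gap[OF b, of N l] unfolding gap_def l' by simp
  \<comment> \<open>Against the rate \<open>2 * (L + \<sigma>') / N\<^sup>2\<close> the factor 256
    leaves a gap of \<open>\<sigma>' / 128\<close> times the squared distance; strong convexity
    turns this into 1/64, the square of 1/8.\<close>
  moreover have "256 * ((L + \<sigma>') / \<sigma>') \<le> (real N)\<^sup>2"
  proof -
    have "(16 * sqrt ((L + \<sigma>') / \<sigma>'))\<^sup>2 \<le> (real N)\<^sup>2"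
      using N \<sigma> L_pos by (intro power_mono) auto
    moreover have "(16 * sqrt ((L + \<sigma>') / \<sigma>'))\<^sup>2 = 256 * ((L + \<sigma>') / \<sigma>')"
      using \<sigma> L_pos by (simp add: power_mult_distrib)
    ultimately show ?thesis by simp
  qed
  ultimately have "256 * ((L + \<sigma>') / \<sigma>') * gap \<le> 2 * (L + \<sigma>') * (norm (l - b))\<^sup>2"
    using gap0 by (meson mult_right_mono order_trans)
  hence "(L + \<sigma>') * (256 / \<sigma>' * gap) \<le> (L + \<sigma>') * (2 * (norm (l - b))\<^sup>2)"
    by (simp add: algebra_simps)
  hence "256 / \<sigma>' * gap \<le> 2 * (norm (l - b))\<^sup>2"
    by (rule mult_left_le_imp_le) (use \<sigma> L_pos in simp)
  hence "gap \<le> \<sigma>' / 128 * (norm (l - b))\<^sup>2" using \<sigma> by (simp add: field_simps)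
  also have "\<dots> \<le> \<sigma>' / 128 * (norm (l - a))\<^sup>2"
    using bl \<sigma> by (intro mult_left_mono power_mono) (auto simp: norm_minus_commute)
  finally have gap: "gap \<le> \<sigma>' / 128 * (norm (l - a))\<^sup>2" .
  have "\<sigma>' / 2 * (norm (l' - b))\<^sup>2 \<le> (\<mu> + \<sigma>') / 2 * (norm (l' - b))\<^sup>2"
    using mu_nonneg by (intro mult_right_mono) auto
  also have "\<dots> \<le> gap" unfolding gap_def using R.minimizer_growth[OF b, of l'] by simp
  finally have "\<sigma>' * (norm (l' - b))\<^sup>2 \<le> \<sigma>' * (norm (l - a) / 8)\<^sup>2"
    using gap by (simp add: power_divide)
  hence "norm (l' - b) \<le> norm (l - a) / 8"
    using \<sigma> by - (rule power2_le_imp_le, auto)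
  moreover have "(norm (g l' + \<sigma>' *\<^sub>R (l' - c')))\<^sup>2 \<le> ((L + \<sigma>') * (norm (l - a) / 8))\<^sup>2"
  proof -
    have "(norm (g l' + \<sigma>' *\<^sub>R (l' - c')))\<^sup>2 \<le> 2 * (L + \<sigma>') * gap"
      unfolding gap_def using R.norm_gradient_le[OF b, of l'] by simp
    also have "\<dots> \<le> 2 * (L + \<sigma>') * ((L + \<sigma>') / 128 * (norm (l - a))\<^sup>2)"
    proof -
      have "\<sigma>' / 128 * (norm (l - a))\<^sup>2 \<le> (L + \<sigma>') / 128 * (norm (l - a))\<^sup>2"
        using L_pos by (intro mult_right_mono) auto
      thus ?thesis using gap \<sigma> L_pos by (intro mult_left_mono) auto
    qed
    also have "\<dots> = ((L + \<sigma>') * (norm (l - a) / 8))\<^sup>2" by (simp add: power2_eq_square)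
    finally show ?thesis .
  qed
  hence "norm (g l' + \<sigma>' *\<^sub>R (l' - c')) \<le> (L + \<sigma>') * (norm (l - a) / 8)"
    using \<sigma> L_pos by - (rule power2_le_imp_le, auto)
  ultimately show ?thesis using that b bl by blast
qed

text \<open>What must stay bounded is the accumulated regularization gradient
  \<open>ar_sigma \<sigma>1 s *\<^sub>R (l - c)\<close>, the difference between the gradients of the
  stage objective and of \<open>f\<close>. Weights grow by 4 while distances shrink by 8, so its
  increments form a geometric series of ratio 1/2. The factor 9/8 per stage is the full distance
  from the old output to \<open>b\<close> plus an eighth of it from \<open>b\<close> to the new
  output.\<close>

lemma ar_invariant:
  assumes min: "\<And>y. f z \<le> f y" and D: "norm (x0 - z) \<le> D" and \<sigma>1: "\<sigma>1 > 0"
  shows "\<exists>a. (\<forall>y. f a + ar_sigma \<sigma>1 s / 2 * (norm (a - snd (ar g L \<sigma>1 x0 s)))\<^sup>2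
        \<le> f y + ar_sigma \<sigma>1 s / 2 * (norm (y - snd (ar g L \<sigma>1 x0 s)))\<^sup>2) \<and>
      norm (fst (ar g L \<sigma>1 x0 s) - a) \<le> D / 8 ^ s \<and>
      norm (ar_sigma \<sigma>1 s *\<^sub>R (fst (ar g L \<sigma>1 x0 s) - snd (ar g L \<sigma>1 x0 s))) \<le> 9 / 4 * \<sigma>1 * D * (1 - 1 / 2 ^ s) \<and>
      (s > 0 \<longrightarrow> norm (g (fst (ar g L \<sigma>1 x0 s)) +
           ar_sigma \<sigma>1 s *\<^sub>R (fst (ar g L \<sigma>1 x0 s) - snd (ar g L \<sigma>1 x0 s))) \<le> (L + ar_sigma \<sigma>1 s) * (D / 8 ^ s))"
proof (induction s)
  case 0
  show ?case using min D by (auto intro!: exI[of _ z] simp: ar_sigma_def)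
next
  case (Suc s)
  obtain l c where st: "ar g L \<sigma>1 x0 s = (l, c)" by fastforce
  define \<sigma> where "\<sigma> = ar_sigma \<sigma>1 s"
  define \<sigma>' where "\<sigma>' = ar_sigma \<sigma>1 (Suc s)"
  define c' where "c' = (\<sigma> / \<sigma>') *\<^sub>R c + (1 - \<sigma> / \<sigma>') *\<^sub>R l"
  define N where "N = ar_length L \<sigma>1 (Suc s)"
  define l' where "l' = fst (fista (\<lambda>y. g y + \<sigma>' *\<^sub>R (y - c')) (L + \<sigma>') l N)"
  have st': "ar g L \<sigma>1 x0 (Suc s) = (l', c')"
    by (simp add: st Let_def l'_def c'_def N_def \<sigma>_def \<sigma>'_def)
  have \<sigma>'v: "\<sigma>' = 4 ^ s * \<sigma>1" by (simp add: \<sigma>'_def ar_sigma_def)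
  have \<sigma>: "0 \<le> \<sigma>" "\<sigma> < \<sigma>'" using \<sigma>1 unfolding \<sigma>_def \<sigma>'v ar_sigma_def by (cases s; simp)+
  from Suc obtain a where a: "\<And>y. f a + \<sigma> / 2 * (norm (a - c))\<^sup>2 \<le> f y + \<sigma> / 2 * (norm (y - c))\<^sup>2"
    and la: "norm (l - a) \<le> D / 8 ^ s"
    and r: "norm (\<sigma> *\<^sub>R (l - c)) \<le> 9 / 4 * \<sigma>1 * D * (1 - 1 / 2 ^ s)"
    unfolding st \<sigma>_def[symmetric] fst_conv snd_conv by blast
  have N: "real N \<ge> 16 * sqrt ((L + \<sigma>') / \<sigma>')"
    unfolding N_def ar_length_def \<sigma>'_def by linarith
  obtain b where b: "\<And>y. f b + \<sigma>' / 2 * (norm (b - c'))\<^sup>2 \<le> f y + \<sigma>' / 2 * (norm (y - c'))\<^sup>2"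
    and bl: "norm (b - l) \<le> norm (l - a)" and lb: "norm (l' - b) \<le> norm (l - a) / 8"
    and gl: "norm (g l' + \<sigma>' *\<^sub>R (l' - c')) \<le> (L + \<sigma>') * (norm (l - a) / 8)"
    using ar_stage[OF a \<sigma> c'_def N l'_def] by blast
  have la8: "norm (l - a) / 8 \<le> D / 8 ^ Suc s" using la by simp
  have "norm (l' - l) \<le> norm (l' - b) + norm (b - l)"
    using norm_triangle_ineq[of "l' - b" "b - l"] by simp
  also have "\<dots> \<le> 9 / 8 * (D / 8 ^ s)" using bl lb la by simp
  finally have ll: "norm (l' - l) \<le> 9 / 8 * (D / 8 ^ s)" .
  \<comment> \<open>Recentering carries the old contribution over exactly and adds only the movement
    of the output.\<close>
  have "\<sigma>' *\<^sub>R (l' - c') = \<sigma> *\<^sub>R (l - c) + \<sigma>' *\<^sub>R (l' - l)"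
  proof -
    have "\<sigma>' *\<^sub>R c' = \<sigma> *\<^sub>R c + (\<sigma>' - \<sigma>) *\<^sub>R l"
      unfolding c'_def using \<sigma> by (simp add: scaleR_add_right right_diff_distrib)
    thus ?thesis by (simp add: algebra_simps)
  qed
  hence "norm (\<sigma>' *\<^sub>R (l' - c')) \<le> norm (\<sigma> *\<^sub>R (l - c)) + \<sigma>' * norm (l' - l)"
    using norm_triangle_ineq[of "\<sigma> *\<^sub>R (l - c)" "\<sigma>' *\<^sub>R (l' - l)"] \<sigma> by simp
  also have "\<sigma>' * norm (l' - l) \<le> \<sigma>' * (9 / 8 * (D / 8 ^ s))" using ll \<sigma> by (intro mult_left_mono) auto
  also have "\<dots> = 9 / 8 * \<sigma>1 * D * (4 ^ s / 8 ^ s)" unfolding \<sigma>'v by simp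
  also have "(4::real) ^ s / 8 ^ s = 1 / 2 ^ s" by (simp add: power_divide[symmetric] power_one_over[symmetric])
  also have "norm (\<sigma> *\<^sub>R (l - c)) + 9 / 8 * \<sigma>1 * D * (1 / 2 ^ s) \<le>
      9 / 4 * \<sigma>1 * D * (1 - 1 / 2 ^ Suc s)" using r by (simp add: algebra_simps)
  finally have r': "norm (\<sigma>' *\<^sub>R (l' - c')) \<le> 9 / 4 * \<sigma>1 * D * (1 - 1 / 2 ^ Suc s)" by simp
  have gl': "norm (g l' + \<sigma>' *\<^sub>R (l' - c')) \<le> (L + \<sigma>') * (D / 8 ^ Suc s)"
    using gl la8 \<sigma> L_pos by (meson mult_left_mono add_nonneg_nonneg less_imp_le order_trans)
  show ?case unfolding st' \<sigma>'_def[symmetric] fst_conv snd_conv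
    using b lb la8 r' gl' by (intro exI[of _ b]) auto
qed

text \<open>The gradient of \<open>f\<close> is that of the stage objective minus the accumulated
  regularization gradient. The number of stages makes the first small, the choice of
  \<open>\<rho>\<close> the second.\<close>

lemma ar_accuracy:
  assumes min: "\<And>y. f z \<le> f y" and D: "norm (x0 - z) \<le> D"
    and \<rho>: "\<rho> > 0" "5 * \<rho> * D \<le> 1" and \<Delta>: "\<Delta> > 0" and s: "s > 0" "2 * L * D \<le> \<Delta> * 8 ^ s"
  shows "norm (g (fst (ar g L (\<rho> * \<Delta>) x0 s))) \<le> \<Delta>"
proof -
  obtain l c where st: "ar g L (\<rho> * \<Delta>) x0 s = (l, c)" by fastforce
  define \<sigma> where "\<sigma> = ar_sigma (\<rho> * \<Delta>) s"
  have D0: "D \<ge> 0" using D norm_ge_zero order_trans by blast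
  have r: "norm (\<sigma> *\<^sub>R (l - c)) \<le> 9 / 4 * (\<rho> * \<Delta>) * D * (1 - 1 / 2 ^ s)"
    and h: "norm (g l + \<sigma> *\<^sub>R (l - c)) \<le> (L + \<sigma>) * (D / 8 ^ s)"
    using ar_invariant[OF min D, of "\<rho> * \<Delta>" s] \<rho> \<Delta> s unfolding st \<sigma>_def by auto
  have "norm (g l) \<le> norm (g l + \<sigma> *\<^sub>R (l - c)) + norm (\<sigma> *\<^sub>R (l - c))"
    using norm_triangle_ineq4[of "g l + \<sigma> *\<^sub>R (l - c)" "\<sigma> *\<^sub>R (l - c)"] by simp
  also have "\<dots> \<le> (L + \<sigma>) * (D / 8 ^ s) + 9 / 4 * (\<rho> * \<Delta>) * D * (1 - 1 / 2 ^ s)" using r h by linarith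
  also have "\<dots> \<le> \<Delta> / 2 + \<Delta> / 2"
  proof -
    have 1: "L * (D / 8 ^ s) \<le> \<Delta> / 2" using s by (simp add: field_simps)
    have "\<sigma> * (D / 8 ^ s) = (\<rho> * \<Delta>) * D / 4 * (4 ^ s / 8 ^ s)"
      using s by (simp add: \<sigma>_def ar_sigma_def power_eq_if)
    also have "(4::real) ^ s / 8 ^ s = 1 / 2 ^ s" by (simp add: power_divide[symmetric] power_one_over[symmetric])
    finally have 2: "\<sigma> * (D / 8 ^ s) = (\<rho> * \<Delta>) * D / 4 * (1 / 2 ^ s)" .
    have pD: "0 \<le> \<rho> * \<Delta> * D" using \<rho> \<Delta> D0 by simp
    define x P where "x = 1 / (2::real) ^ s" and "P = \<rho> * \<Delta> * D"
    \<comment> \<open>The share of \<open>\<sigma>\<close> in the smoothness constant is absorbed by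
      what the geometric sum lacks to its limit. The remaining
      \<open>9 / 4 * (\<rho> * \<Delta> * D)\<close> is at most 9/20 of
      \<open>\<Delta>\<close>.\<close>
    have "(\<rho> * \<Delta>) * D / 4 * (1 / 2 ^ s) + 9 / 4 * (\<rho> * \<Delta>) * D * (1 - 1 / 2 ^ s)
        = P / 4 * x + 9 / 4 * P * (1 - x)" by (simp add: x_def P_def)
    also have "\<dots> = 9 / 4 * P - 2 * P * x" by (simp add: field_simps)
    also have "\<dots> = 9 / 4 * (\<rho> * \<Delta> * D) - 2 * (\<rho> * \<Delta> * D) * (1 / 2 ^ s)" by (simp add: x_def P_def)
    also have "\<dots> \<le> 9 / 4 * (\<rho> * \<Delta> * D)" using pD by simp
    also have "\<dots> \<le> \<Delta> / 2"
    proof -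
      have "\<Delta> * (5 * \<rho> * D) \<le> \<Delta> * 1" using \<rho>(2) \<Delta> by (intro mult_left_mono) auto
      hence "5 * (\<rho> * \<Delta> * D) \<le> \<Delta>" by (simp add: algebra_simps)
      thus ?thesis using \<Delta> by linarith
    qed
    finally show ?thesis using 1 2 unfolding distrib_right by linarith
  qed
  finally show ?thesis by (simp add: st)
qed

end

text \<open>Quadrupled weights halve \<open>sqrt (L / \<sigma>)\<close> from stage to stage, so this
  part sums to twice its first term. The 17 per stage is 16 from the summand 1 in the quotient
  \<open>1 + L / \<sigma>\<close>, plus one for rounding up.\<close>

lemma ar_length_sum:
  assumes L: "L > 0" and \<sigma>: "\<sigma>1 > 0"
  shows "real (\<Sum>i=1..s. ar_length L \<sigma>1 i) \<le> 17 * real s + 32 * sqrt (L / \<sigma>1) * (1 - 1 / 2 ^ s)"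
proof (induction s)
  case (Suc s)
  have p: "4 ^ s * \<sigma>1 > 0" using \<sigma> by simp
  have "sqrt ((L + 4 ^ s * \<sigma>1) / (4 ^ s * \<sigma>1)) = sqrt (1 + L / \<sigma>1 / 4 ^ s)"
    using \<sigma> by (simp add: field_simps)
  also have "\<dots> \<le> 1 + sqrt (L / \<sigma>1 / 4 ^ s)" using sqrt_add_le_add_sqrt[of 1 "L / \<sigma>1 / 4 ^ s"] L \<sigma> by simp
  also have "sqrt (L / \<sigma>1 / 4 ^ s) = sqrt (L / \<sigma>1) / 2 ^ s"
  proof -
    have "sqrt (4 ^ s) = (2::real) ^ s" by (simp add: real_sqrt_power)
    thus ?thesis by (simp only: real_sqrt_divide)
  qed
  finally have "real (ar_length L \<sigma>1 (Suc s)) \<le> 17 + 16 * (sqrt (L / \<sigma>1) / 2 ^ s)"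
    using real_sqrt_ge_zero[of "(L + 4 ^ s * \<sigma>1) / (4 ^ s * \<sigma>1)"] L \<sigma>
    unfolding ar_length_def ar_sigma_def by simp linarith
  moreover define u where "u = sqrt (L / \<sigma>1) / 2 ^ s"
  ultimately have "real (ar_length L \<sigma>1 (Suc s)) \<le> 17 + 16 * u" by simp
  moreover have "real (\<Sum>i=1..s. ar_length L \<sigma>1 i) \<le> 17 * real s + 32 * sqrt (L / \<sigma>1) - 32 * u"
    using Suc by (simp add: u_def algebra_simps)
  moreover have "32 * sqrt (L / \<sigma>1) * (1 - 1 / 2 ^ Suc s) = 32 * sqrt (L / \<sigma>1) - 16 * u"
    by (simp add: u_def algebra_simps)
  ultimately show ?case by simp
qed simp

section \<open>Iteration counts for a prescribed gradient norm\<close>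

context smooth_convex
begin

lemma fista_complexity:
  assumes min: "\<And>y. f z \<le> f y" and D: "norm z \<le> D" and \<Delta>: "\<Delta> > 0"
  shows "\<exists>j. norm (g (fst (fista g L 0 j))) \<le> \<Delta> \<and> real j \<le> 2 * L * D / \<Delta> + 1"
proof -
  have D0: "D \<ge> 0" using D norm_ge_zero order_trans by blast
  define j where "j = nat \<lceil>2 * L * D / \<Delta>\<rceil>"
  have j: "real j \<ge> 2 * L * D / \<Delta>" "real j \<le> 2 * L * D / \<Delta> + 1"
    using D0 L_pos \<Delta> unfolding j_def by (auto simp: of_nat_ceiling)
  define x where "x = fst (fista g L 0 j)"
  have "norm (g x) \<le> \<Delta>"
  \<comment> \<open>No iteration is scheduled only if \<open>D = 0\<close>, when the starting point
    is already the minimizer.\<close>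
  proof (cases "j = 0")
    case True
    hence "2 * L * D / \<Delta> \<le> 0" using j by simp
    hence "D = 0" using D0 L_pos \<Delta> by (simp add: divide_le_0_iff mult_le_0_iff)
    hence "z = 0" using D by simp
    thus ?thesis using minimizer_gradient[OF min] \<Delta> True by (simp add: x_def)
  next
    case False
    have "(real j * norm (g x))\<^sup>2 = (real j)\<^sup>2 * (norm (g x))\<^sup>2" by (simp add: power_mult_distrib)
    also have "\<dots> \<le> (real j)\<^sup>2 * (2 * L * (f x - f z))"
      using norm_gradient_le[OF min, of x] by (intro mult_left_mono) auto
    also have "\<dots> = 2 * L * ((real j)\<^sup>2 * (f x - f z))" by simp
    also have "\<dots> \<le> 2 * L * (2 * L * (norm z)\<^sup>2)"
      using fista_gap[OF min, of j 0] L_pos unfolding x_def by (intro mult_left_mono) auto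
    also have "\<dots> = (2 * L * norm z)\<^sup>2" by (simp add: power2_eq_square)
    finally have "real j * norm (g x) \<le> 2 * L * norm z" using L_pos by - (rule power2_le_imp_le, auto)
    also have "\<dots> \<le> 2 * L * D" using D L_pos by simp
    also have "\<dots> \<le> real j * \<Delta>" using j(1) \<Delta> by (simp add: field_simps)
    finally show ?thesis using False by simp
  qed
  thus ?thesis using j unfolding x_def by auto
qed

lemma ar_complexity:
  assumes min: "\<And>y. f z \<le> f y" and D: "norm z \<le> D" and \<Delta>: "\<Delta> > 0"
    and \<rho>: "\<rho> > 0" "5 * \<rho> * D \<le> 1"
  shows "\<exists>s. norm (g (fst (ar g L (\<rho> * \<Delta>) 0 s))) \<le> \<Delta> \<and>
     real (\<Sum>i=1..s. ar_length L (\<rho> * \<Delta>) i) \<le> 34 + (17 * sqrt (2 * L * D) + 32 * sqrt (L / \<rho>)) / sqrt \<Delta>"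
proof -
  have D0: "D \<ge> 0" using D norm_ge_zero order_trans by blast
  define X where "X = 2 * L * D / \<Delta>"
  have X: "X \<ge> 0" unfolding X_def using D0 L_pos \<Delta> by simp
  \<comment> \<open>Logarithmically many stages would reach the factor \<open>8 ^ s\<close>, but
    \<open>sqrt X\<close> stages fit the budget: each adds a constant, and the stage lengths already
    cost a multiple of \<open>1 / sqrt \<Delta>\<close>. The successor provides the positive count
    that \<open>ar_accuracy\<close> asks for.\<close>
  define s where "s = Suc (nat \<lceil>sqrt X\<rceil>)"
  have s: "real s \<ge> sqrt X" "real s \<le> sqrt X + 2" "s > 0"
  proof -
    have "real (nat \<lceil>sqrt X\<rceil>) \<ge> sqrt X" by (rule real_nat_ceiling_ge)
    moreover have "real (nat \<lceil>sqrt X\<rceil>) \<le> sqrt X + 1"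
      using real_sqrt_ge_zero[OF X] by linarith
    ultimately show "real s \<ge> sqrt X" "real s \<le> sqrt X + 2" "s > 0" unfolding s_def by auto
  qed
  have "X \<le> (real s)\<^sup>2" by (rule sqrt_le_D[OF s(1)])
  also have "\<dots> \<le> (2 ^ s)\<^sup>2" using of_nat_less_two_power[of s, where 'a = real] by (intro power_mono) auto
  also have "(2 ^ s)\<^sup>2 = (4::real) ^ s" by (simp add: power2_eq_square flip: power_mult_distrib)
  also have "\<dots> \<le> 8 ^ s" by (intro power_mono) auto
  finally have "2 * L * D \<le> \<Delta> * 8 ^ s" unfolding X_def using \<Delta> by (simp add: field_simps)
  hence acc: "norm (g (fst (ar g L (\<rho> * \<Delta>) 0 s))) \<le> \<Delta>"
    using ar_accuracy[OF min, of 0 D \<rho> \<Delta> s] D \<rho> \<Delta> s by simp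
  have "real (\<Sum>i=1..s. ar_length L (\<rho> * \<Delta>) i) \<le> 17 * real s + 32 * sqrt (L / (\<rho> * \<Delta>)) * (1 - 1 / 2 ^ s)"
    by (rule ar_length_sum) (use L_pos \<rho> \<Delta> in auto)
  also have "\<dots> \<le> 17 * (sqrt X + 2) + 32 * sqrt (L / (\<rho> * \<Delta>)) * 1"
    using s(2) L_pos \<rho> \<Delta> by (intro add_mono mult_left_mono) auto
  also have "sqrt X = sqrt (2 * L * D) / sqrt \<Delta>" unfolding X_def by (simp add: real_sqrt_divide)
  also have "sqrt (L / (\<rho> * \<Delta>)) = sqrt (L / \<rho>) / sqrt \<Delta>" by (simp add: real_sqrt_divide real_sqrt_mult)
  finally show ?thesis using acc by (intro exI[of _ s]) (simp add: add_divide_distrib)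
qed

text \<open>The tolerance is split as \<open>w + \<delta> * D\<close> with
  \<open>w = (1 - \<rho> * D) * \<Delta>\<close>. The second part covers the regularization gradient
  at the regularized minimizer \<open>b\<close>; half of \<open>w\<close> each covers the gradient
  of the regularized function at \<open>x\<close> and the displacement
  \<open>\<delta> *\<^sub>R (x - b)\<close>. \<open>L1\<close> dominates
  \<open>L + 2 * \<delta>\<close> for all admissible tolerances.\<close>

lemma fgm_complexity:
  assumes min: "\<And>y. f z \<le> f y" and D: "norm z \<le> D" "D > 0" and \<Delta>: "0 < \<Delta>" "\<Delta> \<le> \<Delta>max"
    and \<rho>: "\<rho> > 0" "\<rho> * D < 1" and L1: "L1 = L + 2 * \<rho> * \<Delta>max"
  shows "\<exists>j. norm (g (fst (fgm (\<lambda>y. g y + (\<rho> * \<Delta>) *\<^sub>R y) (L + \<rho> * \<Delta>) (\<rho> * \<Delta>) 0 j))) \<le> \<Delta> \<and>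
     real j \<le> sqrt (L1 / (\<rho> * \<Delta>)) * max 0 (ln ((2 * L1 * D / ((1 - \<rho> * D) * \<Delta>))\<^sup>2)) + 1"
proof -
  define \<delta> where "\<delta> = \<rho> * \<Delta>"
  have \<delta>: "\<delta> > 0" unfolding \<delta>_def using \<rho> \<Delta> by simp
  have "\<delta> \<le> \<rho> * \<Delta>max" unfolding \<delta>_def using \<rho> \<Delta> by simp
  hence L1le: "L + 2 * \<delta> \<le> L1" unfolding L1 by simp
  have L1pos: "L1 > 0" using L1le L_pos \<delta> by linarith
  interpret R: smooth_convex "\<lambda>y. f y + \<delta> / 2 * (norm y)\<^sup>2" "\<lambda>y. g y + \<delta> *\<^sub>R y" "L + \<delta>" "\<mu> + \<delta>"
    using regularize[of \<delta> 0] \<delta> by simp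
  \<comment> \<open>The method is run with the strong-convexity parameter \<open>\<delta>\<close>,
    so the same function is interpreted once more with this possibly smaller modulus.\<close>
  interpret R': smooth_convex "\<lambda>y. f y + \<delta> / 2 * (norm y)\<^sup>2" "\<lambda>y. g y + \<delta> *\<^sub>R y" "L + \<delta>" "\<delta>"
  proof
    fix x y :: 'a
    have "\<delta> / 2 * (norm (y - x))\<^sup>2 \<le> (\<mu> + \<delta>) / 2 * (norm (y - x))\<^sup>2"
      using mu_nonneg by (intro mult_right_mono) auto
    thus "f x + \<delta> / 2 * (norm x)\<^sup>2 + (g x + \<delta> *\<^sub>R x) \<bullet> (y - x) + \<delta> / 2 * (norm (y - x))\<^sup>2
        \<le> f y + \<delta> / 2 * (norm y)\<^sup>2" using R.lower[of x y] by linarith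
  qed (use R.upper L_pos \<delta> in auto)
  obtain b where b: "\<And>y. f b + \<delta> / 2 * (norm b)\<^sup>2 \<le> f y + \<delta> / 2 * (norm y)\<^sup>2"
    using R'.minimizer_exists \<delta> by auto
  have "\<delta> / 2 * (norm b)\<^sup>2 \<le> \<delta> / 2 * (norm z)\<^sup>2" using b[of z] min[of b] by linarith
  hence "(norm b)\<^sup>2 \<le> (norm z)\<^sup>2" using \<delta> by simp
  hence "norm b \<le> norm z" by (rule power2_le_imp_le) simp
  hence bD: "norm b \<le> D" using D by simp
  define M where "M = max 0 (ln ((2 * L1 * D / ((1 - \<rho> * D) * \<Delta>))\<^sup>2))"
  define j where "j = nat \<lceil>sqrt (L1 / \<delta>) * M\<rceil>"
  have M0: "M \<ge> 0" by (simp add: M_def)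
  have jj: "real j \<ge> sqrt (L1 / \<delta>) * M" "real j \<le> sqrt (L1 / \<delta>) * M + 1"
    using M0 L1pos \<delta> unfolding j_def by (auto simp: of_nat_ceiling)
  define x where "x = fst (fgm (\<lambda>y. g y + \<delta> *\<^sub>R y) (L + \<delta>) \<delta> 0 j)"
  define gap where "gap = f x + \<delta> / 2 * (norm x)\<^sup>2 - (f b + \<delta> / 2 * (norm b)\<^sup>2)"
  have gap0: "gap \<ge> 0" unfolding gap_def using b by simp
  have V0: "f 0 + \<delta> / 2 * (norm (0::'a))\<^sup>2 - (f b + \<delta> / 2 * (norm b)\<^sup>2) \<le> (L + \<delta>) / 2 * D\<^sup>2"
  proof -
    have "f 0 + \<delta> / 2 * (norm (0::'a))\<^sup>2 - (f b + \<delta> / 2 * (norm b)\<^sup>2) \<le> (L + \<delta>) / 2 * (norm b)\<^sup>2"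
      using R'.upper[of 0 b] R'.minimizer_gradient[OF b] by simp
    also have "\<dots> \<le> (L + \<delta>) / 2 * D\<^sup>2" using bD L_pos \<delta> by (intro mult_left_mono power_mono) auto
    finally show ?thesis .
  qed
  have "\<delta> / 2 * (norm (0 - b))\<^sup>2 \<le> \<delta> / 2 * D\<^sup>2" using bD \<delta> by (intro mult_left_mono power_mono) auto
  hence V: "f 0 + \<delta> / 2 * (norm (0::'a))\<^sup>2 - (f b + \<delta> / 2 * (norm b)\<^sup>2) + \<delta> / 2 * (norm (0 - b))\<^sup>2 \<le> L1 / 2 * D\<^sup>2"
  proof -
    have "(L + \<delta>) / 2 * D\<^sup>2 + \<delta> / 2 * D\<^sup>2 = (L + 2 * \<delta>) / 2 * D\<^sup>2" by (simp add: algebra_simps add_divide_distrib)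
    also have "\<dots> \<le> L1 / 2 * D\<^sup>2" using L1le by (intro mult_right_mono) auto
    finally show ?thesis using V0 \<open>\<delta> / 2 * (norm (0 - b))\<^sup>2 \<le> \<delta> / 2 * D\<^sup>2\<close> by linarith
  qed
  have "sqrt (\<delta> / L1) * real j \<le> sqrt (\<delta> / (L + \<delta>)) * real j"
    using L1le L_pos \<delta> by (intro mult_right_mono real_sqrt_le_mono divide_left_mono) auto
  moreover have "M \<le> sqrt (\<delta> / L1) * real j"
  proof -
    have "sqrt (\<delta> / L1) * (sqrt (L1 / \<delta>) * M) \<le> sqrt (\<delta> / L1) * real j"
      using jj(1) L1pos \<delta> by (intro mult_left_mono) auto
    moreover have "sqrt (\<delta> / L1) * sqrt (L1 / \<delta>) = 1"
      using L1pos \<delta> by (simp add: real_sqrt_mult[symmetric])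
    ultimately show ?thesis by (simp add: mult.assoc[symmetric])
  qed
  ultimately have eM: "exp (- sqrt (\<delta> / (L + \<delta>)) * real j) \<le> exp (- M)" by simp
  have "gap \<le> exp (- sqrt (\<delta> / (L + \<delta>)) * real j) * (L1 / 2 * D\<^sup>2)"
  proof -
    have "gap \<le> exp (- sqrt (\<delta> / (L + \<delta>)) * real j) *
       (f 0 + \<delta> / 2 * (norm (0::'a))\<^sup>2 - (f b + \<delta> / 2 * (norm b)\<^sup>2) + \<delta> / 2 * (norm (0 - b))\<^sup>2)"
      using R'.fgm_gap[OF b, where j = j and ?x0.0 = 0] \<delta> L_pos unfolding gap_def x_def by simp
    also have "\<dots> \<le> exp (- sqrt (\<delta> / (L + \<delta>)) * real j) * (L1 / 2 * D\<^sup>2)"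
      using V by (intro mult_left_mono) auto
    finally show ?thesis .
  qed
  also have "\<dots> \<le> exp (- M) * (L1 / 2 * D\<^sup>2)" using eM L1pos by (intro mult_right_mono) auto
  finally have gap: "gap \<le> exp (- M) * (L1 / 2 * D\<^sup>2)" .
  define w where "w = (1 - \<rho> * D) * \<Delta>"
  have w: "w > 0" unfolding w_def using \<rho> \<Delta> by simp
  have "exp (- M) \<le> (w / (2 * L1 * D))\<^sup>2"
  proof -
    have p: "(2 * L1 * D / w)\<^sup>2 > 0" using L1pos D w by simp
    have "exp (- M) \<le> exp (- ln ((2 * L1 * D / w)\<^sup>2))" unfolding M_def w_def by simp
    also have "\<dots> = (w / (2 * L1 * D))\<^sup>2" using p by (simp add: exp_minus power_divide)
    finally show ?thesis .
  qed
  hence "gap \<le> (w / (2 * L1 * D))\<^sup>2 * (L1 / 2 * D\<^sup>2)"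
    using gap L1pos by (meson mult_right_mono order_trans zero_le_power2 mult_nonneg_nonneg less_imp_le half_gt_zero)
  also have "\<dots> = w\<^sup>2 / (8 * L1)" using L1pos D by (simp add: field_simps power2_eq_square)
  finally have gapw: "8 * L1 * gap \<le> w\<^sup>2" using L1pos by (simp add: field_simps)
  \<comment> \<open>One bound on the gap serves both halves: \<open>2 * (L + \<delta>) * gap\<close>
    for the gradient and \<open>2 * \<delta> * gap\<close> for the displacement are each at most
    \<open>w\<^sup>2 / 4\<close>.\<close>
  have LL: "(L + \<delta>) * gap \<le> L1 * gap" "\<delta> * gap \<le> L1 * gap"
    using L1le L_pos \<delta> gap0 by (auto intro!: mult_right_mono)
  have "(norm (g x + \<delta> *\<^sub>R x))\<^sup>2 \<le> 2 * (L + \<delta>) * gap"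
    unfolding gap_def using R'.norm_gradient_le[OF b] by simp
  hence "(norm (g x + \<delta> *\<^sub>R x))\<^sup>2 \<le> (w / 2)\<^sup>2"
    using LL gapw power_divide[of w 2 2] unfolding mult.assoc by simp
  hence n1: "norm (g x + \<delta> *\<^sub>R x) \<le> w / 2" using w by - (rule power2_le_imp_le, auto)
  have "\<delta> / 2 * (norm (x - b))\<^sup>2 \<le> gap" using R'.minimizer_growth[OF b, of x] unfolding gap_def by simp
  hence "\<delta> * (\<delta> * (norm (x - b))\<^sup>2) \<le> \<delta> * (2 * gap)" using \<delta> by (intro mult_left_mono) auto
  moreover have "(norm (\<delta> *\<^sub>R (x - b)))\<^sup>2 = \<delta> * (\<delta> * (norm (x - b))\<^sup>2)"
    unfolding norm_scaleR power_mult_distrib power2_abs by (simp only: power2_eq_square mult.assoc)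
  moreover have "\<delta> * (2 * gap) \<le> w\<^sup>2 / 4" using LL gapw by linarith
  ultimately have "(norm (\<delta> *\<^sub>R (x - b)))\<^sup>2 \<le> (w / 2)\<^sup>2" by (simp add: power_divide)
  hence n2: "norm (\<delta> *\<^sub>R (x - b)) \<le> w / 2" using w by - (rule power2_le_imp_le, auto)
  have n3: "norm (\<delta> *\<^sub>R b) \<le> \<delta> * D" using bD \<delta> by simp
  have "norm (g x) = norm ((g x + \<delta> *\<^sub>R x) - \<delta> *\<^sub>R (x - b) - \<delta> *\<^sub>R b)"
    by (simp add: scaleR_diff_right)
  also have "\<dots> \<le> norm (g x + \<delta> *\<^sub>R x) + norm (\<delta> *\<^sub>R (x - b)) + norm (\<delta> *\<^sub>R b)"
    using norm_triangle_ineq4[of "(g x + \<delta> *\<^sub>R x) - \<delta> *\<^sub>R (x - b)" "\<delta> *\<^sub>R b"]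
      norm_triangle_ineq4[of "g x + \<delta> *\<^sub>R x" "\<delta> *\<^sub>R (x - b)"] by linarith
  also have "\<dots> \<le> w + \<delta> * D" using n1 n2 n3 by linarith
  also have "\<dots> = \<Delta>" unfolding w_def \<delta>_def by (simp add: algebra_simps)
  finally have "norm (g x) \<le> \<Delta>" .
  thus ?thesis using jj(2) unfolding x_def \<delta>_def M_def by (intro exI[of _ j]) simp
qed

end

section \<open>Geometry of the manifold\<close>

lemma
  fixes T :: "'a::euclidean_space set"
  assumes "subspace T"
  shows closest_point_subspace_in: "closest_point T v \<in> T"
    and closest_point_subspace_orthogonal: "t \<in> T \<Longrightarrow> (v - closest_point T v) \<bullet> t = 0"
proof -
  have cl: "closed T" "convex T" "T \<noteq> {}"
    using assms subspace_0[OF assms] by (auto simp: closed_subspace subspace_imp_convex)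
  show in_T: "closest_point T v \<in> T" by (rule closest_point_in_set[OF cl(1,3)])
  assume t: "t \<in> T"
  have "(v - closest_point T v) \<bullet> s \<le> 0" if "s \<in> T" for s
    using closest_point_dot[OF cl(2,1) subspace_add[OF assms in_T that], of v] by simp
  from this[OF t] this[OF subspace_neg[OF assms t]]
  show "(v - closest_point T v) \<bullet> t = 0" by (simp add: inner_minus_right)
qed

lemma closest_point_subspace_eqI:
  fixes T :: "'a::euclidean_space set"
  assumes T: "subspace T" and "w \<in> T" "\<And>t. t \<in> T \<Longrightarrow> (v - w) \<bullet> t = 0"
  shows "closest_point T v = w"
proof -
  let ?p = "closest_point T v"
  have d: "?p - w \<in> T" by (rule subspace_diff[OF T closest_point_subspace_in[OF T] assms(2)])
  have "(?p - w) \<bullet> (?p - w) = (v - w) \<bullet> (?p - w) - (v - ?p) \<bullet> (?p - w)" by (simp add: inner_diff_left)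
  also have "\<dots> = 0" using assms(3)[OF d] closest_point_subspace_orthogonal[OF T d, of v] by simp
  finally show ?thesis by simp
qed

lemma closest_point_subspace_diff:
  fixes T :: "'a::euclidean_space set"
  assumes T: "subspace T"
  shows "closest_point T (u - v) = closest_point T u - closest_point T v"
proof (rule closest_point_subspace_eqI[OF T])
  show "closest_point T u - closest_point T v \<in> T"
    by (intro subspace_diff[OF T] closest_point_subspace_in[OF T])
  fix t assume "t \<in> T"
  then show "(u - v - (closest_point T u - closest_point T v)) \<bullet> t = 0"
    using closest_point_subspace_orthogonal[OF T, of t u] closest_point_subspace_orthogonal[OF T, of t v]
    by (simp add: inner_diff_left)
qed

lemma norm_closest_point_subspace_pythagoras:
  fixes T :: "'a::euclidean_space set"
  assumes T: "subspace T"
  shows "(norm v)\<^sup>2 = (norm (closest_point T v))\<^sup>2 + (norm (v - closest_point T v))\<^sup>2"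
  using closest_point_subspace_orthogonal[OF T closest_point_subspace_in[OF T], of v]
  unfolding power2_norm_eq_inner by (simp add: inner_diff_left inner_diff_right inner_commute)

lemma norm_closest_point_subspace_le:
  fixes T :: "'a::euclidean_space set"
  assumes T: "subspace T"
  shows "norm (closest_point T v) \<le> norm v" "norm (v - closest_point T v) \<le> norm v"
  using norm_closest_point_subspace_pythagoras[OF T, of v]
  by (auto intro!: power2_le_imp_le[OF _ norm_ge_zero])

lemma infdist_subspace:
  fixes T :: "'a::euclidean_space set"
  assumes T: "subspace T"
  shows "infdist v T = norm (v - closest_point T v)"
proof -
  have cl: "closed T" "T \<noteq> {}" using T subspace_0[OF T] by (auto simp: closed_subspace)
  have "infdist v T = setdist {v} T" by (simp add: infdist_eq_setdist)
  also have "\<dots> = dist v (closest_point T v)" by (rule setdist_closest_point[OF cl])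
  finally show ?thesis by (simp add: dist_norm)
qed

text \<open>Write \<open>v\<close> as \<open>?PS v + u\<close> with \<open>u\<close> orthogonal to
  \<open>S\<close>. The first summand lies in \<open>S\<close>, hence near \<open>T\<close>. The
  projection \<open>p\<close> of \<open>u\<close> onto \<open>T\<close> lies near \<open>S\<close>,
  to which \<open>u\<close> is orthogonal, so \<open>p \<bullet> u\<close>, the squared norm of
  \<open>p\<close>, is small. Each one-sided gap is used once.\<close>

lemma closest_point_subspace_gap:
  fixes S T :: "'a::euclidean_space set"
  assumes S: "subspace S" and T: "subspace T" and e: "e \<ge> 0"
    and ST: "\<And>t. t \<in> S \<Longrightarrow> infdist t T \<le> e * norm t"
    and TS: "\<And>t. t \<in> T \<Longrightarrow> infdist t S \<le> e * norm t"
  shows "norm (closest_point S v - closest_point T v) \<le> 2 * e * norm v"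
proof -
  let ?PS = "closest_point S" and ?PT = "closest_point T"
  define u where "u = v - ?PS v"
  define p where "p = ?PT u"
  have pT: "p \<in> T" unfolding p_def by (rule closest_point_subspace_in[OF T])
  have "norm p * norm p = p \<bullet> u"
    using closest_point_subspace_orthogonal[OF T pT, of u] unfolding p_def
    by (simp add: inner_diff_left inner_diff_right inner_commute power2_norm_eq_inner power2_eq_square[symmetric])
  also have "\<dots> = (p - ?PS p) \<bullet> u"
    using closest_point_subspace_orthogonal[OF S closest_point_subspace_in[OF S, of p], of v]
    unfolding u_def by (simp add: inner_diff_left inner_diff_right inner_commute)
  also have "\<dots> \<le> norm (p - ?PS p) * norm u" by (rule norm_cauchy_schwarz)
  also have "\<dots> \<le> (e * norm p) * norm v"
    using TS[OF pT] infdist_subspace[OF S, of p] norm_closest_point_subspace_le(2)[OF S, of v] e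
    unfolding u_def by (intro mult_mono) auto
  finally have "norm p * norm p \<le> norm p * (e * norm v)" by (simp add: algebra_simps)
  hence pn: "norm p \<le> e * norm v"
    using e by (cases "norm p = 0") (auto simp: mult_le_cancel_left_pos)
  have "?PS v - ?PT v = (?PS v - ?PT (?PS v)) - p"
    unfolding p_def u_def closest_point_subspace_diff[OF T] by simp
  hence "norm (?PS v - ?PT v) \<le> norm (?PS v - ?PT (?PS v)) + norm p"
    by (metis norm_triangle_ineq4)
  also have "norm (?PS v - ?PT (?PS v)) \<le> e * norm v"
    using ST[OF closest_point_subspace_in[OF S, of v]] infdist_subspace[OF T, of "?PS v"]
      mult_left_mono[OF norm_closest_point_subspace_le(1)[OF S, of v] e] by simp
  finally show ?thesis using pn by simp
qed

text \<open>\<open>Ck_on\<close> speaks of one direction at a time. In finite dimension this amounts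
  to continuity in operator norm, the form in which derivatives at nearby points are
  compared.\<close>

lemma continuous_on_Blinfun_frechet:
  fixes h :: "'a::euclidean_space \<Rightarrow> 'b::euclidean_space"
  assumes "\<And>x. x \<in> U \<Longrightarrow> h differentiable (at x)"
    and "\<And>v. continuous_on U (\<lambda>x. frechet_derivative h (at x) v)"
  shows "continuous_on U (\<lambda>x. Blinfun (frechet_derivative h (at x)))"
proof (rule continuous_on_blinfun_componentwise)
  fix i :: 'a
  have "continuous_on U (\<lambda>x. blinfun_apply (Blinfun (frechet_derivative h (at x))) i)
      = continuous_on U (\<lambda>x. frechet_derivative h (at x) i)"
    by (intro continuous_on_cong refl)
      (metis assms(1) bounded_linear_Blinfun_apply frechet_derivative_works has_derivative_bounded_linear)
  thus "continuous_on U (\<lambda>x. blinfun_apply (Blinfun (frechet_derivative h (at x))) i)"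
    using assms(2) by simp
qed

text \<open>The inverse function theorem is applied to \<open>y \<mapsto> (y - x) + E (\<psi> y - B (y - x))\<close> with \<open>B\<close> the
  derivative of \<open>\<psi>\<close> at \<open>x\<close> and \<open>E\<close> a linear right inverse of \<open>B\<close>: composed with \<open>B\<close> it is \<open>\<psi>\<close>, so
  its local inverse maps the kernel of \<open>B\<close> into the zero set of \<open>\<psi>\<close>.\<close>

lemma kernel_subset_tangent_space:
  fixes \<psi> :: "'a::euclidean_space \<Rightarrow> 'b::euclidean_space"
  assumes U: "open U" and diff: "\<And>x. x \<in> U \<Longrightarrow> \<psi> differentiable (at x)"
    and cont: "\<And>v. continuous_on U (\<lambda>x. frechet_derivative \<psi> (at x) v)"
    and M: "{y \<in> U. \<psi> y = 0} \<subseteq> M" and x: "x \<in> U" "\<psi> x = 0"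
    and surj: "surj (frechet_derivative \<psi> (at x))"
    and v: "frechet_derivative \<psi> (at x) v = 0"
  shows "v \<in> tangent_space M x"
proof -
  define B where "B = frechet_derivative \<psi> (at x)"
  have der: "(\<psi> has_derivative frechet_derivative \<psi> (at y)) (at y)" if "y \<in> U" for y
    using diff[OF that] frechet_derivative_works by blast
  have linB: "linear B" unfolding B_def using diff[OF x(1)] by (rule linear_frechet_derivative)
  obtain E where E: "linear E" "B \<circ> E = id"
    using linear_surjective_right_inverse[OF linB] surj unfolding B_def by blast
  have BE: "B (E w) = w" for w using E(2) by (metis comp_apply id_apply)
  define H where "H y = (y - x) + E (\<psi> y - B (y - x))" for y
  define H' where "H' y = Blinfun (\<lambda>h. h + E (frechet_derivative \<psi> (at y) h - B h))" for y
  have bl: "bounded_linear B" "bounded_linear E" using linB E(1) by (simp_all add: linear_conv_bounded_linear)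
  have blH: "bounded_linear (\<lambda>h. h + E (frechet_derivative \<psi> (at y) h - B h))" if "y \<in> U" for y
    using der[OF that, THEN has_derivative_bounded_linear] bl
    by (intro bounded_linear_add bounded_linear_ident bounded_linear_compose[OF bl(2)] bounded_linear_sub) auto
  have H'app: "blinfun_apply (H' y) = (\<lambda>h. h + E (frechet_derivative \<psi> (at y) h - B h))" if "y \<in> U" for y
    unfolding H'_def by (rule bounded_linear_Blinfun_apply[OF blH[OF that]])
  have derH: "(H has_derivative blinfun_apply (H' y)) (at y)" if "y \<in> U" for y
  proof -
    have "((\<lambda>y. (y - x) + E (\<psi> y - B (y - x))) has_derivative
        (\<lambda>h. (h - 0) + E (frechet_derivative \<psi> (at y) h - B (h - 0)))) (at y)"
      by (intro has_derivative_add has_derivative_diff has_derivative_ident has_derivative_const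
          bounded_linear.has_derivative[OF bl(2)] bounded_linear.has_derivative[OF bl(1)] der that)
    thus ?thesis unfolding H'app[OF that] H_def[abs_def] by simp
  qed
  have contH': "continuous_on U H'"
  proof (rule continuous_on_blinfun_componentwise)
    fix i :: 'a
    have "continuous_on U (\<lambda>y. i + E (frechet_derivative \<psi> (at y) i - B i))"
      by (intro continuous_intros bounded_linear.continuous_on[OF bl(2)] cont)
    thus "continuous_on U (\<lambda>y. blinfun_apply (H' y) i)"
      by (rule continuous_on_eq) (simp add: H'app)
  qed
  have H'x: "H' x = id_blinfun"
    by (rule blinfun_eqI) (simp add: H'app x(1) B_def[symmetric] linear_0[OF E(1)])
  \<comment> \<open>On \<open>W\<close> the derivative of \<open>H\<close> is within 1/2 of the
    identity and shortens vectors by at most half; \<open>expand\<close> serves the continuity of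
    the velocity below.\<close>
  define W where "W = {y \<in> U. dist (H' y) id_blinfun < 1 / 2}"
  have "open W"
  proof -
    have "W = U \<inter> (\<lambda>y. H' y) -` ball id_blinfun (1 / 2)" unfolding W_def by (auto simp: dist_commute)
    thus ?thesis using continuous_open_preimage[OF contH' U] by simp
  qed
  have WU: "W \<subseteq> U" and xW: "x \<in> W" unfolding W_def using x H'x by auto
  have expand: "norm w \<le> 2 * norm (blinfun_apply (H' y) w)" if "y \<in> W" for y w
  proof -
    have "norm (blinfun_apply (H' y - id_blinfun) w) \<le> norm (H' y - id_blinfun) * norm w" by (rule norm_blinfun)
    also have "\<dots> \<le> 1 / 2 * norm w" using that unfolding W_def dist_norm by (intro mult_right_mono) auto
    finally have "norm (blinfun_apply (H' y) w - w) \<le> norm w / 2" by (simp add: blinfun.diff_left)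
    thus ?thesis using norm_triangle_ineq2[of w "blinfun_apply (H' y) w"] by (simp add: norm_minus_commute)
  qed
  have inv: "id_blinfun o\<^sub>L H' x = id_blinfun" by (rule blinfun_eqI) (simp add: H'x)
  obtain U' V G G' where IFT: "open U'" "U' \<subseteq> W" "x \<in> U'" "open V" "H x \<in> V" "homeomorphism U' V H G"
    "\<And>y. y \<in> V \<Longrightarrow> (G has_derivative (G' y)) (at y)"
    "\<And>y. y \<in> V \<Longrightarrow> G' y = Hilbert_Choice.inv (blinfun_apply (H' (G y)))"
    "\<And>y. y \<in> V \<Longrightarrow> bij (blinfun_apply (H' (G y)))"
    by (rule inverse_function_theorem[OF \<open>open W\<close> derH continuous_on_subset[OF contH' WU] xW inv]) (use WU in auto)
  have Hx: "H x = 0" unfolding H_def using x linear_0[OF linB] linear_0[OF E(1)] by simp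
  have GV: "G y \<in> U'" "H (G y) = y" if "y \<in> V" for y
    using IFT(6) that unfolding homeomorphism_def by auto
  have GH: "G 0 = x" using IFT(3,6) Hx unfolding homeomorphism_def by metis
  have G'eq: "blinfun_apply (H' (G y)) (G' y w) = w" if "y \<in> V" for y w
    using IFT(8,9)[OF that] by (simp add: bij_is_surj surj_f_inv_f)
  obtain r where r: "r > 0" "ball 0 r \<subseteq> V" using IFT(4,5) Hx open_contains_ball by metis
  \<comment> \<open>The added 1 keeps the quotient meaningful for \<open>v = 0\<close>.\<close>
  define \<rho> where "\<rho> = r / (norm v + 1)"
  have \<rho>: "\<rho> > 0" unfolding \<rho>_def using r by (simp add: add_nonneg_pos)
  have tV: "t *\<^sub>R v \<in> V" if "t \<in> {-\<rho><..<\<rho>}" for t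
  proof -
    have "\<bar>t\<bar> * norm v \<le> \<bar>t\<bar> * (norm v + 1)" by (intro mult_left_mono) auto
    also have "\<dots> < \<rho> * (norm v + 1)" using that by (intro mult_strict_right_mono) (auto simp: add_nonneg_pos)
    also have "\<dots> = r"
    proof -
      have "norm v + 1 \<noteq> 0" using norm_ge_zero[of v] by linarith
      thus ?thesis unfolding \<rho>_def by simp
    qed
    finally show ?thesis using r by auto
  qed
  define c where "c t = G (t *\<^sub>R v)" for t :: real
  have cder: "(c has_vector_derivative G' (t *\<^sub>R v) v) (at t)" if "t \<in> {-\<rho><..<\<rho>}" for t
  proof -
    have "((\<lambda>t. t *\<^sub>R v) has_vector_derivative v) (at t)"
      by (auto intro!: derivative_eq_intros)
    from vector_derivative_diff_chain_within[OF this, of G "G' (t *\<^sub>R v)"]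
      has_derivative_at_withinI[OF IFT(7)[OF tV[OF that]]]
    show ?thesis unfolding c_def[abs_def] by (simp add: o_def)
  qed
  have cM: "c ` {-\<rho><..<\<rho>} \<subseteq> M"
  proof clarify
    fix t assume t: "t \<in> {-\<rho><..<\<rho>}"
    have cU: "c t \<in> U" unfolding c_def using GV(1)[OF tV[OF t]] IFT(2) WU by auto
    have "\<psi> (c t) = B (H (c t))"
      unfolding H_def using linB BE by (simp add: linear_add)
    also have "\<dots> = t *\<^sub>R B v" unfolding c_def using GV(2)[OF tV[OF t]] linB by (simp add: linear_scale)
    finally show "c t \<in> M" using M cU v unfolding B_def by auto
  qed
  \<comment> \<open>\<open>G'\<close> is given pointwise as an inverse. The velocities at two times
    solve the linear equations with \<open>H' (c t)\<close> and \<open>H' (c s)\<close> for the same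
    right side \<open>v\<close>, so their difference is controlled by the change of
    \<open>H'\<close>, and \<open>expand\<close> removes the inverse.\<close>
  have "continuous_on {-\<rho><..<\<rho>} (\<lambda>t. G' (t *\<^sub>R v) v)"
    unfolding continuous_on_def
  proof
    fix s assume s: "s \<in> {-\<rho><..<\<rho>}"
    define w where "w t = G' (t *\<^sub>R v) v" for t
    have cc: "continuous_on {-\<rho><..<\<rho>} c"
      by (meson cder continuous_at_imp_continuous_on has_vector_derivative_continuous)
    have cU': "c ` {-\<rho><..<\<rho>} \<subseteq> U" "\<And>t. t \<in> {-\<rho><..<\<rho>} \<Longrightarrow> c t \<in> W"
      unfolding c_def using GV(1)[OF tV] subsetD[OF IFT(2)] subsetD[OF WU] by blast+
    have "continuous_on {-\<rho><..<\<rho>} (\<lambda>t. H' (c t))"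
      by (rule continuous_on_compose2[OF contH' cc cU'(1)])
    hence lim: "((\<lambda>t. H' (c t)) \<longlongrightarrow> H' (c s)) (at s within {-\<rho><..<\<rho>})"
      using s unfolding continuous_on_def by auto
    have "((\<lambda>t. w t - w s) \<longlongrightarrow> 0) (at s within {-\<rho><..<\<rho>})"
    proof (rule Lim_null_comparison)
      show "\<forall>\<^sub>F t in at s within {-\<rho><..<\<rho>}. norm (w t - w s) \<le> 2 * (norm (H' (c s) - H' (c t)) * norm (w s))"
        unfolding eventually_at_filter
      proof (intro always_eventually allI impI)
        fix t assume t: "t \<in> {-\<rho><..<\<rho>}"
        have "blinfun_apply (H' (c t)) (w t - w s) = blinfun_apply (H' (c s) - H' (c t)) (w s)"
          using G'eq[OF tV[OF t], of v] G'eq[OF tV[OF s], of v]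
          unfolding w_def c_def by (simp add: blinfun.diff_left blinfun.diff_right)
        thus "norm (w t - w s) \<le> 2 * (norm (H' (c s) - H' (c t)) * norm (w s))"
          using expand[OF cU'(2)[OF t], of "w t - w s"] norm_blinfun[of "H' (c s) - H' (c t)" "w s"] by simp
      qed
      have "((\<lambda>t. 2 * (norm (H' (c s) - H' (c t)) * norm (w s))) \<longlongrightarrow>
          2 * (norm (H' (c s) - H' (c s)) * norm (w s))) (at s within {-\<rho><..<\<rho>})"
        by (intro tendsto_intros lim)
      thus "((\<lambda>t. 2 * (norm (H' (c s) - H' (c t)) * norm (w s))) \<longlongrightarrow> 0) (at s within {-\<rho><..<\<rho>})" by simp
    qed
    thus "((\<lambda>t. G' (t *\<^sub>R v) v) \<longlongrightarrow> G' (s *\<^sub>R v) v) (at s within {-\<rho><..<\<rho>})"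
      unfolding w_def by (simp only: LIM_zero_iff)
  qed
  hence "c C1_differentiable_on {-\<rho><..<\<rho>}"
    unfolding C1_differentiable_on_def using cder
    by - (rule exI[of _ "\<lambda>t. G' (t *\<^sub>R v) v"], rule conjI, rule ballI)
  moreover have "(c has_vector_derivative v) (at 0)"
  proof -
    have "blinfun_apply (H' (G 0)) (G' 0 v) = v" using G'eq[of 0 v] IFT(5) Hx by simp
    hence "G' 0 v = v" using GH H'x by simp
    thus ?thesis using cder[of 0] \<rho> by simp
  qed
  moreover have "c 0 = x" unfolding c_def using GH by simp
  ultimately show ?thesis unfolding tangent_space_def using \<rho> cM by blast
qed

text \<open>For short times the curve stays in \<open>U\<close>, where \<open>\<psi>\<close>
  vanishes along it; differentiate at 0.\<close>

lemma tangent_space_subset_kernel: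
  fixes \<psi> :: "'a::euclidean_space \<Rightarrow> 'b::euclidean_space"
  assumes U: "open U" and diff: "\<psi> differentiable (at x)"
    and M: "M \<inter> U \<subseteq> {y. \<psi> y = 0}" and x: "x \<in> U" and v: "v \<in> tangent_space M x"
  shows "frechet_derivative \<psi> (at x) v = 0"
proof -
  obtain c r where c: "0 < r" "c ` {-r<..<r} \<subseteq> M" "c 0 = x" "(c has_vector_derivative v) (at (0::real))"
    using v unfolding tangent_space_def by auto
  have "(\<psi> has_derivative frechet_derivative \<psi> (at x)) (at (c 0))"
    using diff c(3) frechet_derivative_works by blast
  from vector_derivative_diff_chain_within[OF c(4) has_derivative_at_withinI[OF this]]
  have 1: "(\<psi> \<circ> c has_vector_derivative frechet_derivative \<psi> (at x) v) (at 0)" .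
  have "isCont c 0" using c(4) has_vector_derivative_continuous by blast
  hence "\<forall>\<^sub>F t in at 0. c t \<in> U"
    unfolding isCont_def using U x c(3) topological_tendstoD by metis
  hence "\<forall>\<^sub>F t in nhds 0. c t \<in> U" using x c(3) by (simp add: eventually_nhds_conv_at)
  moreover have "\<forall>\<^sub>F t in nhds (0::real). t \<in> {-r<..<r}"
    using c(1) by (intro eventually_nhds_in_open) auto
  ultimately have "\<forall>\<^sub>F t in nhds 0. (\<psi> \<circ> c) t = 0"
    by eventually_elim (use M c(2) in \<open>auto simp: image_subset_iff\<close>)
  moreover have "(\<psi> \<circ> c) 0 = 0" using M x c(1,2,3) by (auto simp: image_subset_iff)
  ultimately have "(\<psi> \<circ> c has_vector_derivative 0) (at 0) = ((\<lambda>_. 0 :: 'b) has_vector_derivative 0) (at (0::real))"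
    by - (rule has_vector_derivative_cong_ev, auto elim: eventually_mono)
  hence "(\<psi> \<circ> c has_vector_derivative 0) (at 0)" by simp
  thus ?thesis using 1 vector_derivative_unique_at by blast
qed

lemma eventually_at_within_in_open: "open U \<Longrightarrow> x \<in> U \<Longrightarrow> \<forall>\<^sub>F y in at x within T. y \<in> U"
  by (auto simp: eventually_at_topological)

section \<open>Tangent spaces and their dependence on the base point\<close>

context valid_setting
begin

lemma chart_derivative:
  assumes "i \<in> chart_ix S"
  shows "x \<in> chartU S i \<Longrightarrow> chart_fn S i differentiable (at x)"
    and "continuous_on (chartU S i) (\<lambda>x. frechet_derivative (chart_fn S i) (at x) v)"
proof -
  have "Ck_on (Suc 0) (chart_fn S i) (chartU S i)"
    using charts_smooth[OF assms] unfolding smooth_on_def by blast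
  thus "x \<in> chartU S i \<Longrightarrow> chart_fn S i differentiable (at x)"
    and "continuous_on (chartU S i) (\<lambda>x. frechet_derivative (chart_fn S i) (at x) v)" by auto
qed

lemma jacobian_chart:
  assumes "i \<in> chart_ix S" "x \<in> chartU S i"
  shows "jacobian (chart_fn S i) (at x) *v v = frechet_derivative (chart_fn S i) (at x) v"
  using chart_derivative(1)[OF assms] frechet_derivative_at unfolding jacobian_works by metis

text \<open>Available in every chart around \<open>x\<close>, not only the selected one: comparing
  the tangent spaces at two nearby points takes a single chart for both.\<close>

lemma Tan_eq_kernel:
  assumes i: "i \<in> chart_ix S" and x: "x \<in> mfd S" "x \<in> chartU S i"
  shows "Tan S x = {v. frechet_derivative (chart_fn S i) (at x) v = 0}"
proof (intro equalityI subsetI)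
  have op: "open (chartU S i)" using charts_open[OF i] by simp
  have M: "mfd S \<inter> chartU S i = {x \<in> chartU S i. chart_fn S i x = 0}" by (rule charts_define[OF i])
  {
    fix v assume "v \<in> Tan S x"
    hence "frechet_derivative (chart_fn S i) (at x) v = 0"
      unfolding Tan_def
      using tangent_space_subset_kernel[OF op chart_derivative(1)[OF i x(2)] _ x(2)] M by blast
    thus "v \<in> {v. frechet_derivative (chart_fn S i) (at x) v = 0}" by simp
  }
  {
    fix v assume v: "v \<in> {v. frechet_derivative (chart_fn S i) (at x) v = 0}"
    have "surj ((*v) (jacobian (chart_fn S i) (at x)))"
      using charts_rank[OF i, of x] x full_rank_surjective by blast
    hence "surj (frechet_derivative (chart_fn S i) (at x))"
      using jacobian_chart[OF i x(2)] by (simp add: surj_def)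
    thus "v \<in> Tan S x" unfolding Tan_def
      using kernel_subset_tangent_space[OF op chart_derivative(1)[OF i] chart_derivative(2)[OF i], of "mfd S" x v]
        M x v by blast
  }
qed

lemma chart_at_U: "x \<in> mfd S \<Longrightarrow> x \<in> chartU S (chart_at S x)"
  using chart_at[of x] charts_open[of "chart_at S x"] closure_subset by blast

lemma Bmat_eq: "x \<in> mfd S \<Longrightarrow> Bmat S x *v v = frechet_derivative (chart_fn S (chart_at S x)) (at x) v"
  unfolding Bmat_def using jacobian_chart chart_at chart_at_U by blast

lemma Tan_eq_Bmat: "x \<in> mfd S \<Longrightarrow> Tan S x = {v. Bmat S x *v v = 0}"
  using Tan_eq_kernel chart_at chart_at_U Bmat_eq by simp

lemma subspace_Tan: "x \<in> mfd S \<Longrightarrow> subspace (Tan S x)"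
  unfolding Tan_eq_Bmat
  by (rule subspaceI) (auto simp: matrix_vector_right_distrib matrix_vector_mult_scaleR)

text \<open>The constant \<open>C_dist\<close> refers to the chart selected at the base point, and
  this selection may jump as \<open>y\<close> approaches \<open>x\<close>. There are only finitely
  many charts, so it is enough to control each chart that can occur near \<open>x\<close>.\<close>

lemma eventually_Tan_gap:
  assumes x: "x \<in> mfd S" and e: "e > 0"
  shows "\<forall>\<^sub>F y in at x within mfd S. (\<forall>t\<in>Tan S x. infdist t (Tan S y) \<le> e * norm t) \<and>
     (\<forall>t\<in>Tan S y. infdist t (Tan S x) \<le> e * norm t)"
proof -
  define e' where "e' = e / C_dist S"
  have e': "e' > 0" unfolding e'_def using e C_dist_pos by simp
  let ?D = "\<lambda>i y. Blinfun (frechet_derivative (chart_fn S i) (at y))"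
  have Dapp: "blinfun_apply (?D i y) t = frechet_derivative (chart_fn S i) (at y) t"
    if "i \<in> chart_ix S" "y \<in> chartU S i" for i y t
    using chart_derivative(1)[OF that]
    by (metis bounded_linear_Blinfun_apply frechet_derivative_works has_derivative_bounded_linear)
  have near: "\<forall>\<^sub>F y in at x within mfd S. y \<in> chartU S i \<and> dist (?D i y) (?D i x) < e'"
    if i: "i \<in> chart_ix S" and xi: "x \<in> chartU S i" for i
  proof -
    have op: "open (chartU S i)" using charts_open[OF i] by simp
    have "continuous_on (chartU S i) (?D i)"
      by (rule continuous_on_Blinfun_frechet[OF chart_derivative[OF i]])
    hence "isCont (?D i) x" using op xi continuous_on_eq_continuous_at by blast
    hence "(?D i \<longlongrightarrow> ?D i x) (at x within mfd S)"
      unfolding isCont_def by (rule tendsto_mono[OF at_le, rotated]) simp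
    hence "\<forall>\<^sub>F y in at x within mfd S. dist (?D i y) (?D i x) < e'" using e' by (rule tendstoD)
    moreover have "\<forall>\<^sub>F y in at x within mfd S. y \<in> chartU S i"
      by (rule eventually_at_within_in_open[OF op xi])
    ultimately show ?thesis by eventually_elim simp
  qed
  \<comment> \<open>If \<open>x\<close> is in the closure of \<open>chartV S i\<close>, that chart
    is defined at \<open>x\<close> too, since the closure lies in \<open>chartU S i\<close>;
    otherwise points near \<open>x\<close> avoid \<open>chartV S i\<close>.\<close>
  have "\<forall>\<^sub>F y in at x within mfd S. y \<in> chartV S i \<longrightarrow> x \<in> chartU S i \<and> y \<in> chartU S i \<and> dist (?D i y) (?D i x) < e'"
    if i: "i \<in> chart_ix S" for i
  proof (cases "x \<in> closure (chartV S i)")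
    case True
    hence xi: "x \<in> chartU S i" using charts_open[OF i] by blast
    show ?thesis by (rule eventually_mono[OF near[OF i xi]]) (use xi in simp)
  next
    case False
    have "\<forall>\<^sub>F y in at x within mfd S. y \<in> - closure (chartV S i)"
      by (rule eventually_at_within_in_open) (use False in auto)
    thus ?thesis by (rule eventually_mono) (meson ComplD closure_subset subsetD)
  qed
  hence 1: "\<forall>\<^sub>F y in at x within mfd S. \<forall>i\<in>chart_ix S. y \<in> chartV S i \<longrightarrow>
      x \<in> chartU S i \<and> y \<in> chartU S i \<and> dist (?D i y) (?D i x) < e'"
    using charts_finite by (simp add: eventually_ball_finite)
  have 2: "\<forall>\<^sub>F y in at x within mfd S. y \<in> chartU S (chart_at S x) \<and>
      dist (?D (chart_at S x) y) (?D (chart_at S x) x) < e'"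
    using near[OF _ chart_at_U[OF x]] chart_at[OF x] by simp
  have 3: "\<forall>\<^sub>F y in at x within mfd S. y \<in> mfd S" by (simp add: eventually_at_filter)
  \<comment> \<open>\<open>t\<close> is in the kernel of the derivative at \<open>z\<close>, so
    \<open>Bmat S y *v t\<close> is the difference of two derivatives applied to \<open>t\<close>.
    The fact is used with \<open>x\<close> in either role, always in the chart selected at the point
    named \<open>y\<close>.\<close>
  have key: "infdist t (Tan S y) \<le> e * norm t"
    if y: "y \<in> mfd S" and z: "z \<in> mfd S" and t: "t \<in> Tan S z" and i: "i = chart_at S y"
      and U: "z \<in> chartU S i" and d: "dist (?D i y) (?D i z) < e'" for y z t i
  proof -
    have ii: "i \<in> chart_ix S" "y \<in> chartU S i" using chart_at[OF y] chart_at_U[OF y] i by auto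
    have z0: "blinfun_apply (?D i z) t = 0" using t Tan_eq_kernel[OF ii(1) z U] Dapp[OF ii(1) U] by simp
    have "infdist t (Tan S y) \<le> C_dist S * norm (Bmat S y *v t)" by (rule C_dist[OF y])
    also have "Bmat S y *v t = blinfun_apply (?D i y) t" using Bmat_eq[OF y] Dapp[OF ii] i by simp
    also have "\<dots> = blinfun_apply (?D i y - ?D i z) t" using z0 by (simp add: blinfun.diff_left)
    also have "C_dist S * norm \<dots> \<le> C_dist S * (e' * norm t)"
    proof (intro mult_left_mono)
      have "norm (blinfun_apply (?D i y - ?D i z) t) \<le> norm (?D i y - ?D i z) * norm t" by (rule norm_blinfun)
      also have "\<dots> \<le> e' * norm t" using d unfolding dist_norm by (intro mult_right_mono) auto
      finally show "norm (blinfun_apply (?D i y - ?D i z) t) \<le> e' * norm t" .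
    qed (use C_dist_pos in simp)
    also have "\<dots> = e * norm t" unfolding e'_def using C_dist_pos by simp
    finally show ?thesis .
  qed
  from 1 2 3 show ?thesis
  proof eventually_elim
    case (elim y)
    have cy: "chart_at S y \<in> chart_ix S" "y \<in> chartV S (chart_at S y)" using chart_at[OF elim(3)] by auto
    have "infdist t (Tan S y) \<le> e * norm t" if "t \<in> Tan S x" for t
      using key[OF elim(3) x that refl] elim(1)[rule_format, OF cy] by simp
    moreover have "infdist t (Tan S x) \<le> e * norm t" if "t \<in> Tan S y" for t
      using key[OF x elim(3) that refl] elim(2) by (simp add: dist_commute)
    ultimately show ?case by blast
  qed
qed

text \<open>Makes the Riemannian gradient continuous on the manifold, on which the measurability of
  the estimator error rests. The change is split into moving the projection at a fixed vector and
  moving the vector under a fixed projection.\<close>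

lemma continuous_on_proj_tan:
  assumes h: "continuous_on (mfd S) h"
  shows "continuous_on (mfd S) (\<lambda>x. proj_tan S x (h x))"
  unfolding continuous_on_def
proof
  fix x assume x: "x \<in> mfd S"
  let ?F = "at x within mfd S"
  have 3: "\<forall>\<^sub>F y in ?F. y \<in> mfd S" by (simp add: eventually_at_filter)
  have hx: "(h \<longlongrightarrow> h x) ?F" using h x by (simp add: continuous_on_def)
  have "((\<lambda>y. proj_tan S y (h x) - proj_tan S x (h x)) \<longlongrightarrow> 0) ?F"
  proof (rule tendstoI)
    fix r :: real assume r: "r > 0"
    define e where "e = r / (2 * (norm (h x) + 1))"
    have n: "norm (h x) + 1 > 0" by (simp add: add_nonneg_pos)
    have e: "e > 0" unfolding e_def using r n by simp
    show "\<forall>\<^sub>F y in ?F. dist (proj_tan S y (h x) - proj_tan S x (h x)) 0 < r"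
      using eventually_Tan_gap[OF x e] 3
    proof eventually_elim
      case (elim y)
      have "norm (proj_tan S y (h x) - proj_tan S x (h x)) \<le> 2 * e * norm (h x)"
        unfolding proj_tan_def
        by (rule closest_point_subspace_gap[OF subspace_Tan[OF elim(2)] subspace_Tan[OF x]]) (use elim e in auto)
      also have "\<dots> < 2 * e * (norm (h x) + 1)" using e by simp
      also have "\<dots> = r" unfolding e_def using n by (simp add: field_simps)
      finally show ?case by simp
    qed
  qed
  moreover have "((\<lambda>y. proj_tan S y (h y) - proj_tan S y (h x)) \<longlongrightarrow> 0) ?F"
  proof (rule Lim_null_comparison)
    show "\<forall>\<^sub>F y in ?F. norm (proj_tan S y (h y) - proj_tan S y (h x)) \<le> norm (h y - h x)"
      using 3
    proof eventually_elim
      case (elim y)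
      show ?case unfolding proj_tan_def closest_point_subspace_diff[OF subspace_Tan[OF elim], symmetric]
        by (rule norm_closest_point_subspace_le(1)[OF subspace_Tan[OF elim]])
    qed
    show "((\<lambda>y. norm (h y - h x)) \<longlongrightarrow> 0) ?F"
      using hx by (simp add: LIM_zero tendsto_norm_zero)
  qed
  ultimately have "((\<lambda>y. (proj_tan S y (h y) - proj_tan S y (h x)) + (proj_tan S y (h x) - proj_tan S x (h x))) \<longlongrightarrow> 0 + 0) ?F"
    by (rule tendsto_add[rotated])
  hence "((\<lambda>y. proj_tan S y (h y) - proj_tan S x (h x)) \<longlongrightarrow> 0) ?F" by simp
  thus "((\<lambda>x. proj_tan S x (h x)) \<longlongrightarrow> proj_tan S x (h x)) ?F" by (simp add: LIM_zero_iff)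
qed

end

section \<open>Gradients and singular values\<close>

lemma GDERIV_unique:
  assumes "GDERIV h x :> u" "GDERIV h x :> v"
  shows "u = v"
proof -
  have "(\<lambda>y. y \<bullet> u) = (\<lambda>y. y \<bullet> v)"
    using has_derivative_unique assms unfolding gderiv_def by blast
  hence "(u - v) \<bullet> u = (u - v) \<bullet> v" by meson
  thus ?thesis by (metis inner_diff_right inner_eq_zero_iff eq_iff_diff_eq_0)
qed

lemma gradient_eqI: "GDERIV h x :> v \<Longrightarrow> gradient h x = v"
  unfolding gradient_def by (rule the_equality) (auto dest: GDERIV_unique)

lemma GDERIV_gradient:
  fixes h :: "'a::euclidean_space \<Rightarrow> real"
  assumes "h differentiable (at x)"
  shows "GDERIV h x :> gradient h x"
proof -
  obtain h' where h': "(h has_derivative h') (at x)" using assms unfolding differentiable_def by blast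
  have lin: "linear h'" using h' has_derivative_linear by blast
  define v where "v = (\<Sum>b\<in>Basis. h' b *\<^sub>R b)"
  have "h' y = y \<bullet> v" for y
  proof -
    have "h' y = h' (\<Sum>b\<in>Basis. (y \<bullet> b) *\<^sub>R b)" by (simp add: euclidean_representation)
    also have "\<dots> = (\<Sum>b\<in>Basis. (y \<bullet> b) *\<^sub>R h' b)"
      using lin by (simp add: linear_sum linear_scale)
    also have "\<dots> = y \<bullet> v" unfolding v_def by (simp add: inner_sum_right mult.commute)
    finally show ?thesis .
  qed
  hence "h' = (\<lambda>y. y \<bullet> v)" by auto
  hence "GDERIV h x :> v" using h' unfolding gderiv_def by simp
  thus ?thesis using gradient_eqI by metis
qed

lemma (in smooth_convex) gradient_eq: "gradient f = g"
  using gradient_eqI[OF gderiv] by auto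

lemma inner_transpose_mult:
  fixes B :: "real^'d^'p"
  shows "(transpose B *v l) \<bullet> y = l \<bullet> (B *v y)"
  by (simp add: transpose_matrix_vector dot_lmul_matrix)

text \<open>A parabola through the origin that stays nonnegative has a horizontal tangent there. It
  yields the eigenvector equation from extremality.\<close>

lemma quadratic_nonneg_linear_part:
  fixes p c :: real
  assumes "\<And>t. 2 * t * p + t\<^sup>2 * c \<ge> 0"
  shows "p = 0"
proof (rule ccontr)
  assume "p \<noteq> 0"
  define k where "k = \<bar>c\<bar> + 1"
  have k: "k > 0" "c < 2 * k" unfolding k_def by auto
  have "2 * (- p / k) * p + (- p / k)\<^sup>2 * c = p\<^sup>2 / k\<^sup>2 * (c - 2 * k)"
    using k by (simp add: field_simps power2_eq_square)
  also have "\<dots> < 0" using k \<open>p \<noteq> 0\<close> by (intro mult_pos_neg) auto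
  finally show False using assms[of "- p / k"] by simp
qed

lemma norm_sq_add_scaleR:
  fixes a b :: "'a::real_inner"
  shows "(norm (a + t *\<^sub>R b))\<^sup>2 = (norm a)\<^sup>2 + 2 * t * (a \<bullet> b) + t\<^sup>2 * (norm b)\<^sup>2"
  using norm_sq_diff_scaleR[of a "- t" b] by (simp add: inner_commute)

text \<open>An extremal direction of \<open>\<parallel>B\<^sup>T l\<parallel>\<^sup>2\<close> on the unit sphere is an eigenvector of the Gram matrix.\<close>

lemma extremal_singular_value:
  fixes B :: "real^'d^'p"
  assumes v: "norm v = 1" and c: "c = 1 \<or> c = - 1"
    and ext: "\<And>l. c * (norm (transpose B *v l))\<^sup>2 \<ge> c * (norm (transpose B *v v))\<^sup>2 * (norm l)\<^sup>2"
  shows "singular_value B (norm (transpose B *v v))"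
proof -
  define \<mu> where "\<mu> = (norm (transpose B *v v))\<^sup>2"
  have "((B ** transpose B) *v v - \<mu> *\<^sub>R v) \<bullet> w = 0" for w
  proof -
    let ?p = "(transpose B *v v) \<bullet> (transpose B *v w) - \<mu> * (v \<bullet> w)"
    have "2 * t * (c * ?p) + t\<^sup>2 * (c * ((norm (transpose B *v w))\<^sup>2 - \<mu> * (norm w)\<^sup>2)) \<ge> 0" for t
    proof -
      have "(norm (transpose B *v (v + t *\<^sub>R w)))\<^sup>2 - \<mu> * (norm (v + t *\<^sub>R w))\<^sup>2
          = 2 * t * ?p + t\<^sup>2 * ((norm (transpose B *v w))\<^sup>2 - \<mu> * (norm w)\<^sup>2)"
      proof -
        have lin: "transpose B *v (v + t *\<^sub>R w) = transpose B *v v + t *\<^sub>R (transpose B *v w)"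
          by (simp only: matrix_vector_right_distrib matrix_vector_mult_scaleR)
        show ?thesis unfolding lin norm_sq_add_scaleR \<mu>_def using v by (simp add: algebra_simps)
      qed
      moreover have "0 \<le> c * ((norm (transpose B *v (v + t *\<^sub>R w)))\<^sup>2 - \<mu> * (norm (v + t *\<^sub>R w))\<^sup>2)"
        using ext[of "v + t *\<^sub>R w"] unfolding \<mu>_def by (simp add: algebra_simps)
      ultimately have "0 \<le> c * (2 * t * ?p + t\<^sup>2 * ((norm (transpose B *v w))\<^sup>2 - \<mu> * (norm w)\<^sup>2))"
        by (simp only:)
      thus ?thesis by (simp add: algebra_simps)
    qed
    hence "c * ?p = 0" by (rule quadratic_nonneg_linear_part)
    hence "?p = 0" using c by auto
    moreover have "((B ** transpose B) *v v) \<bullet> w = (transpose B *v v) \<bullet> (transpose B *v w)"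
      by (metis inner_commute inner_transpose_mult matrix_vector_mul_assoc)
    ultimately show ?thesis by (simp add: inner_diff_left)
  qed
  hence "(B ** transpose B) *v v = \<mu> *\<^sub>R v"
    by (metis inner_eq_zero_iff eq_iff_diff_eq_0)
  thus ?thesis unfolding singular_value_def \<mu>_def using v by (intro conjI exI[of _ v]) auto
qed

text \<open>The extreme values of \<open>norm (transpose B *v l)\<close> over the unit sphere exist
  by compactness and are singular values themselves, so they inherit the bounds; homogeneity extends
  these to all \<open>l\<close>.\<close>

lemma singular_value_bounds:
  fixes B :: "real^'d^'p"
  assumes sv: "\<And>s. singular_value B s \<Longrightarrow> s \<in> {lo..hi}" and lo: "lo > 0"
  shows "lo * norm l \<le> norm (transpose B *v l)" and "norm (transpose B *v l) \<le> hi * norm l"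
    and "hi > 0"
proof -
  let ?S = "sphere (0::real^'p) 1"
  have cont: "continuous_on ?S (\<lambda>l. norm (transpose B *v l))"
    by (intro continuous_intros linear_continuous_on)
  have ne: "?S \<noteq> {}" by simp
  have hom: "norm (transpose B *v l) = norm l * norm (transpose B *v (l /\<^sub>R norm l))" for l
    by (cases "l = 0") (simp_all add: matrix_vector_mult_scaleR)
  have unit: "l /\<^sub>R norm l \<in> ?S" if "l \<noteq> 0" for l using that by simp
  obtain v where v: "v \<in> ?S" "\<And>l. l \<in> ?S \<Longrightarrow> norm (transpose B *v v) \<le> norm (transpose B *v l)"
    using continuous_attains_inf[OF compact_sphere ne cont] by auto
  obtain u where u: "u \<in> ?S" "\<And>l. l \<in> ?S \<Longrightarrow> norm (transpose B *v l) \<le> norm (transpose B *v u)"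
    using continuous_attains_sup[OF compact_sphere ne cont] by auto
  have mn: "norm (transpose B *v v) * norm l \<le> norm (transpose B *v l)" for l
    using v(2)[OF unit, of l] hom[of l] mult_left_mono[OF _ norm_ge_zero[of l]]
    by (cases "l = 0") (auto simp: mult.commute)
  have mx: "norm (transpose B *v l) \<le> norm (transpose B *v u) * norm l" for l
    using u(2)[OF unit, of l] hom[of l] mult_left_mono[OF _ norm_ge_zero[of l]]
    by (cases "l = 0") (auto simp: mult.commute)
  have "singular_value B (norm (transpose B *v v))"
  proof (rule extremal_singular_value[where c = 1])
    show "1 * (norm (transpose B *v v))\<^sup>2 * (norm l)\<^sup>2 \<le> 1 * (norm (transpose B *v l))\<^sup>2" for l
      using power_mono[OF mn[of l], of 2] by (simp add: power_mult_distrib)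
  qed (use v in auto)
  from sv[OF this] have 1: "lo \<le> norm (transpose B *v v)" by simp
  have "singular_value B (norm (transpose B *v u))"
  proof (rule extremal_singular_value[where c = "-1"])
    show "- 1 * (norm (transpose B *v u))\<^sup>2 * (norm l)\<^sup>2 \<le> - 1 * (norm (transpose B *v l))\<^sup>2" for l
      using power_mono[OF mx[of l], of 2] by (simp add: power_mult_distrib)
  qed (use u in auto)
  from sv[OF this] have 2: "norm (transpose B *v u) \<le> hi" by simp
  show "lo * norm l \<le> norm (transpose B *v l)"
    using mn[of l] mult_right_mono[OF 1 norm_ge_zero[of l]] by linarith
  show "norm (transpose B *v l) \<le> hi * norm l"
    using mx[of l] mult_right_mono[OF 2 norm_ge_zero[of l]] by linarith
  show "hi > 0" using 1 2 lo v(2)[OF u(1)] by linarith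
qed

section \<open>The proximal model and its dual\<close>

locale irpmvr_problem = valid_setting S + valid_params S A
  for S :: "('d::finite, 'p::finite) setting" and A :: "'d params"
begin

lemma lip_R_nonneg: "lip_R S \<ge> 0"
  using reg_lipschitz lipschitz_on_nonneg by blast

lemma reg_diff_le: "reg S y - reg S z \<le> lip_R S * norm (y - z)"
  using lipschitz_onD[OF reg_lipschitz, of y z] by (simp add: dist_norm abs_le_iff)

lemma continuous_reg: "continuous_on UNIV (reg S)"
  using reg_lipschitz lipschitz_on_continuous_on by blast

text \<open>A multiplier only shifts the linear coefficient, so the model and all its Lagrangians
  belong to one family of functions.\<close>

lemma model_shift: "model S A x (m + b) y = model S A x m y + b \<bullet> y"
  unfolding model_def by (simp add: inner_add_left)

lemma continuous_model: "continuous_on UNIV (model S A x q)"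
  unfolding model_def
  by (intro continuous_intros continuous_on_compose2[OF continuous_reg]) (use step in auto)

lemma model_attains_min:
  assumes "closed T" "T \<noteq> {}"
  shows "\<exists>z\<in>T. \<forall>y\<in>T. model S A x q z \<le> model S A x q y"
proof (rule continuous_coercive_attains_min[OF continuous_model assms])
  show "1 / (2 * step A) > 0" using step by simp
  fix y
  have "reg S x - reg S (x + y) \<le> lip_R S * norm y" using reg_diff_le[of x "x + y"] by simp
  moreover have "- (norm q * norm y) \<le> q \<bullet> y" using Cauchy_Schwarz_ineq2[of q y] by linarith
  ultimately show "reg S x - (norm q + lip_R S) * norm y + 1 / (2 * step A) * (norm y)\<^sup>2 \<le> model S A x q y"
    unfolding model_def by (simp add: distrib_right)
qed

lemma model_strongly_convex:
  assumes "0 \<le> t" "t \<le> 1"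
  shows "model S A x q ((1 - t) *\<^sub>R z + t *\<^sub>R y)
    \<le> (1 - t) * model S A x q z + t * model S A x q y - t * (1 - t) * (norm (y - z))\<^sup>2 / (2 * step A)"
proof -
  have "x + ((1 - t) *\<^sub>R z + t *\<^sub>R y) = (1 - t) *\<^sub>R (x + z) + t *\<^sub>R (x + y)"
    by (simp add: algebra_simps)
  hence "reg S (x + ((1 - t) *\<^sub>R z + t *\<^sub>R y)) \<le> (1 - t) * reg S (x + z) + t * reg S (x + y)"
    using convex_onD[OF reg_convex assms, of "x + z" "x + y"] by simp
  moreover have "(norm ((1 - t) *\<^sub>R z + t *\<^sub>R y))\<^sup>2
      = (1 - t) * (norm z)\<^sup>2 + t * (norm y)\<^sup>2 - t * (1 - t) * (norm (y - z))\<^sup>2"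
    using norm_sq_convex_comb[of t y z] by (simp add: add.commute)
  hence "(norm ((1 - t) *\<^sub>R z + t *\<^sub>R y))\<^sup>2 / (2 * step A)
      = (1 - t) * ((norm z)\<^sup>2 / (2 * step A)) + t * ((norm y)\<^sup>2 / (2 * step A)) - t * (1 - t) * (norm (y - z))\<^sup>2 / (2 * step A)"
    by (simp add: add_divide_distrib diff_divide_distrib)
  ultimately show ?thesis unfolding model_def by (simp add: inner_add_right distrib_left)
qed

lemma model_min_growth:
  assumes T: "convex T" and z: "z \<in> T" "\<And>y. y \<in> T \<Longrightarrow> model S A x q z \<le> model S A x q y" and y: "y \<in> T"
  shows "model S A x q z + (norm (y - z))\<^sup>2 / (2 * step A) \<le> model S A x q y"
proof -
  have "(norm (y - z))\<^sup>2 / (2 * step A) \<le> model S A x q y - model S A x q z"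
  \<comment> \<open>Convexity along the segment gives the claim with the factor
    \<open>u = 1 - t\<close>. Having it for every \<open>u\<close> below 1 replaces the limit of
    \<open>t\<close> to 0.\<close>
  proof (rule field_le_mult_one_interval)
    fix u :: real assume u: "0 < u" "u < 1"
    define t where "t = 1 - u"
    have "(1 - t) *\<^sub>R z + t *\<^sub>R y \<in> T" using convexD_alt[OF T z(1) y, of t] u unfolding t_def by simp
    hence "model S A x q z \<le> (1 - t) * model S A x q z + t * model S A x q y - t * (1 - t) * (norm (y - z))\<^sup>2 / (2 * step A)"
      using z(2) model_strongly_convex[of t x q z y] u unfolding t_def by fastforce
    hence "t * (u * ((norm (y - z))\<^sup>2 / (2 * step A))) \<le> t * (model S A x q y - model S A x q z)"
      unfolding t_def by (simp add: algebra_simps)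
    thus "u * ((norm (y - z))\<^sup>2 / (2 * step A)) \<le> model S A x q y - model S A x q z"
      by (rule mult_left_le_imp_le) (use u in \<open>simp add: t_def\<close>)
  qed
  thus ?thesis by simp
qed

lemma model_min_norm:
  assumes T: "convex T" "0 \<in> T" and z: "z \<in> T" "\<And>y. y \<in> T \<Longrightarrow> model S A x q z \<le> model S A x q y"
  shows "model S A x q z + (norm z)\<^sup>2 / (2 * step A) \<le> reg S x"
    and "norm z \<le> step A * (norm q + lip_R S)"
proof -
  show 1: "model S A x q z + (norm z)\<^sup>2 / (2 * step A) \<le> reg S x"
    using model_min_growth[OF T(1) z T(2)] by (simp add: model_def)
  have "- (norm q * norm z) \<le> q \<bullet> z" using Cauchy_Schwarz_ineq2[of q z] by linarith
  moreover have "reg S x - reg S (x + z) \<le> lip_R S * norm z" using reg_diff_le[of x "x + z"] by simp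
  ultimately have "(norm z)\<^sup>2 / (2 * step A) + (norm z)\<^sup>2 / (2 * step A) \<le> (norm q + lip_R S) * norm z"
    using 1 unfolding model_def by (simp add: distrib_right)
  hence "norm z * norm z \<le> norm z * (step A * (norm q + lip_R S))"
    using step by (simp add: field_simps power2_eq_square)
  thus "norm z \<le> step A * (norm q + lip_R S)"
    using step lip_R_nonneg by (cases "norm z = 0") (auto simp: mult_le_cancel_left_pos)
qed

text \<open>The algorithm's \<open>w\<close> as a function of the combined coefficient
  \<open>q = m + transpose (Bmat S x) *v l\<close>. Completing the square identifies it as the
  minimizer of the model with linear coefficient \<open>q\<close>.\<close>

definition prox_step :: "real^'d \<Rightarrow> real^'d \<Rightarrow> real^'d" where
  "prox_step x q = prox (step A) (reg S) (x - step A *\<^sub>R q) - x"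

lemma prox_step_min: "model S A x q (prox_step x q) \<le> model S A x q y"
proof -
  let ?h = "\<lambda>y. reg S y + (norm (y - (x - step A *\<^sub>R q)))\<^sup>2 / (2 * step A)"
  have h: "?h y = model S A x q (y - x) + step A * (norm q)\<^sup>2 / 2" for y
  proof -
    have "(norm (y - (x - step A *\<^sub>R q)))\<^sup>2 = (norm ((y - x) - (- step A) *\<^sub>R q))\<^sup>2" by (simp add: algebra_simps)
    also have "\<dots> = (norm (y - x))\<^sup>2 + 2 * step A * (q \<bullet> (y - x)) + (step A)\<^sup>2 * (norm q)\<^sup>2"
      unfolding norm_sq_diff_scaleR by simp
    finally show ?thesis using step unfolding model_def by (simp add: field_simps power2_eq_square)
  qed
  obtain z where z: "\<And>y. model S A x q z \<le> model S A x q y"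
    using model_attains_min[of UNIV x q] by auto
  have "is_arg_min ?h (\<lambda>_. True) (x + z)"
    unfolding is_arg_min_def h using z by (auto simp: not_less)
  \<comment> \<open>\<open>prox\<close> is an arbitrary choice of a minimizer; the existence shown
    before makes the choice meaningful.\<close>
  hence "is_arg_min ?h (\<lambda>_. True) (prox (step A) (reg S) (x - step A *\<^sub>R q))"
    unfolding prox_def arg_min_def by (rule someI)
  hence "\<not> ?h (x + y) < ?h (prox (step A) (reg S) (x - step A *\<^sub>R q))"
    unfolding is_arg_min_def by blast
  hence "?h (prox (step A) (reg S) (x - step A *\<^sub>R q)) \<le> ?h (x + y)" by simp
  thus ?thesis unfolding h prox_step_def by simp
qed

lemma prox_step_growth:
  "model S A x q (prox_step x q) + (norm (y - prox_step x q))\<^sup>2 / (2 * step A) \<le> model S A x q y"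
  by (rule model_min_growth[of UNIV]) (auto simp: prox_step_min)

text \<open>Expanding the square in \<open>prox_step_growth\<close> cancels all quadratic terms and
  leaves the subgradient inequality at \<open>x + w\<close>. Testing it at the displacement
  \<open>w + s\<close> against the Lipschitz bound gives the norm.\<close>

lemma prox_step_subgradient:
  assumes w: "w = prox_step x q" and s: "s = - (q + (1 / step A) *\<^sub>R w)"
  shows "s \<in> subdiff (reg S) (x + w)" and "norm s \<le> lip_R S"
proof -
  have sub: "reg S (x + w) + s \<bullet> (y - w) \<le> reg S (x + y)" for y
  proof -
    have "(norm (y - w))\<^sup>2 / (2 * step A) = (norm y)\<^sup>2 / (2 * step A) - (norm w)\<^sup>2 / (2 * step A)
        - (1 / step A) * (w \<bullet> (y - w))"
      using step unfolding power2_norm_eq_inner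
      by (simp add: field_simps inner_diff_left inner_diff_right inner_commute)
    thus ?thesis using prox_step_growth[of x q y] unfolding w[symmetric] s model_def
      by (simp add: inner_add_left inner_diff_right inner_minus_left algebra_simps)
  qed
  thus "s \<in> subdiff (reg S) (x + w)"
    unfolding subdiff_def using sub[of "z - x" for z] by (auto simp: algebra_simps)
  have "s \<bullet> s \<le> lip_R S * norm s"
    using sub[of "w + s"] reg_diff_le[of "x + (w + s)" "x + w"] by simp
  hence "norm s * norm s \<le> norm s * lip_R S" by (simp add: dot_square_norm power2_eq_square mult.commute)
  thus "norm s \<le> lip_R S"
    using lip_R_nonneg by (cases "norm s = 0") (auto simp: mult_le_cancel_left_pos)
qed

section \<open>The dual function: smoothness, attainment, size of multipliers\<close>

lemma dual_eq:
  fixes l :: "real^'p" and x m :: "real^'d"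
  defines "q \<equiv> m + transpose (Bmat S x) *v l"
  shows "dual S A x m l = - model S A x q (prox_step x q)"
proof -
  have "(- (transpose (Bmat S x) *v l)) \<bullet> y - model S A x m y = - model S A x q y" for y
    unfolding q_def model_shift by simp
  hence "dual S A x m l = (SUP y. - model S A x q y)"
    unfolding dual_def conjugate_def by simp
  also have "\<dots> = - model S A x q (prox_step x q)"
    by (rule cSup_eq_maximum) (auto simp: prox_step_min)
  finally show ?thesis .
qed

lemma Bmat_bounds:
  assumes "x \<in> mfd S"
  shows "CB_lo S * norm l \<le> norm (transpose (Bmat S x) *v l)"
    and "norm (transpose (Bmat S x) *v l) \<le> CB_hi S * norm l"
    and "CB_hi S > 0"
  using singular_value_bounds[OF singular_values[OF assms] CB_lo_pos] by blast+

lemma dual_lip_pos: "dual_lip S A > 0"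
  unfolding dual_lip_def using step Bmat_bounds(3)[OF start] by simp

text \<open>Lower bound: the old minimizer \<open>w\<close> is a competitor in the new problem.
  Upper bound: strong convexity of the model at \<open>w\<close>, with
  \<open>b \<bullet> (w' - w)\<close> absorbed by Young's inequality of weight
  \<open>step A\<close>; \<open>CB_hi\<close> then bounds \<open>norm b\<close>.\<close>

lemma smooth_convex_dual:
  assumes x: "x \<in> mfd S"
  shows "smooth_convex (dual S A x m)
    (\<lambda>l. - (Bmat S x *v prox_step x (m + transpose (Bmat S x) *v l))) (dual_lip S A) 0"
proof
  fix l l' :: "real^'p"
  define b where "b = transpose (Bmat S x) *v (l' - l)"
  define q where "q = m + transpose (Bmat S x) *v l"
  define q' where "q' = m + transpose (Bmat S x) *v l'"
  define w where "w = prox_step x q"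
  define w' where "w' = prox_step x q'"
  have q': "q' = q + b" unfolding q_def q'_def b_def by (simp add: matrix_vector_mult_diff_distrib)
  have d: "dual S A x m l = - model S A x q w" "dual S A x m l' = - (model S A x q w' + b \<bullet> w')"
    using dual_eq[of x m l] dual_eq[of x m l'] model_shift[of x q b w']
    unfolding q_def[symmetric] q'_def[symmetric] w_def[symmetric] w'_def[symmetric] unfolding q' by auto
  have bw: "- (Bmat S x *v w) \<bullet> (l' - l) = - (b \<bullet> w)"
    unfolding b_def inner_transpose_mult by (simp add: inner_commute)
  have "model S A x q' w' \<le> model S A x q' w" unfolding w'_def by (rule prox_step_min)
  thus "dual S A x m l + (- (Bmat S x *v prox_step x (m + transpose (Bmat S x) *v l))) \<bullet> (l' - l)
      + 0 / 2 * (norm (l' - l))\<^sup>2 \<le> dual S A x m l'"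
    unfolding q_def[symmetric] w_def[symmetric] bw d q' model_shift by simp
  have "0 \<le> (norm ((w' - w) - (- step A) *\<^sub>R b))\<^sup>2" by simp
  hence "0 \<le> (norm (w' - w))\<^sup>2 + 2 * step A * (b \<bullet> (w' - w)) + (step A)\<^sup>2 * (norm b)\<^sup>2"
    unfolding norm_sq_diff_scaleR by simp
  hence "- (b \<bullet> (w' - w)) \<le> (norm (w' - w))\<^sup>2 / (2 * step A) + step A / 2 * (norm b)\<^sup>2"
    using step by (simp add: field_simps power2_eq_square)
  moreover have "model S A x q w + (norm (w' - w))\<^sup>2 / (2 * step A) \<le> model S A x q w'"
    unfolding w_def by (rule prox_step_growth)
  moreover have "step A / 2 * (norm b)\<^sup>2 \<le> dual_lip S A / 2 * (norm (l' - l))\<^sup>2"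
  proof -
    have "(norm b)\<^sup>2 \<le> (CB_hi S * norm (l' - l))\<^sup>2"
      unfolding b_def using Bmat_bounds(2)[OF x] by (intro power_mono) auto
    hence "step A / 2 * (norm b)\<^sup>2 \<le> step A / 2 * (CB_hi S * norm (l' - l))\<^sup>2"
      using step by (intro mult_left_mono) auto
    thus ?thesis unfolding dual_lip_def by (simp add: power_mult_distrib)
  qed
  ultimately show "dual S A x m l' \<le> dual S A x m l +
      (- (Bmat S x *v prox_step x (m + transpose (Bmat S x) *v l))) \<bullet> (l' - l) + dual_lip S A / 2 * (norm (l' - l))\<^sup>2"
    unfolding q_def[symmetric] w_def[symmetric] bw d by (simp add: inner_diff_right)
qed (use dual_lip_pos in auto)

lemma gradient_dual:
  assumes "x \<in> mfd S"
  shows "gradient (dual S A x m) = (\<lambda>l. - (Bmat S x *v prox_step x (m + transpose (Bmat S x) *v l)))"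
  by (rule smooth_convex.gradient_eq[OF smooth_convex_dual[OF assms]])

lemma dual_attains_min:
  assumes x: "x \<in> mfd S"
  shows "\<exists>l. \<forall>l'. dual S A x m l \<le> dual S A x m l'"
proof -
  let ?B = "transpose (Bmat S x)" and ?\<alpha> = "step A"
  have "\<exists>l\<in>UNIV. \<forall>l'\<in>UNIV. dual S A x m l \<le> dual S A x m l'"
  proof (rule continuous_coercive_attains_min[OF smooth_convex.continuous[OF smooth_convex_dual[OF x]]])
    show "step A * (CB_lo S)\<^sup>2 / 2 > 0" using step CB_lo_pos by simp
    fix l
    define b where "b = ?B *v l"
    define q where "q = m + b"
    \<comment> \<open>The trial displacement minimizes the linear and quadratic part of the model,
      so the dual grows like \<open>?\<alpha> / 2 * (norm q)\<^sup>2\<close>; the positive lower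
      bound \<open>CB_lo\<close> makes this coercive in \<open>l\<close>.\<close>
    have "model S A x q (prox_step x q) \<le> model S A x q (- ?\<alpha> *\<^sub>R q)" by (rule prox_step_min)
    also have "\<dots> = - ?\<alpha> / 2 * (norm q)\<^sup>2 + reg S (x - ?\<alpha> *\<^sub>R q)"
      unfolding model_def using step
      by (simp add: power_mult_distrib dot_square_norm field_simps power2_eq_square)
    also have "\<dots> \<le> - ?\<alpha> / 2 * (norm q)\<^sup>2 + reg S x + lip_R S * (?\<alpha> * norm q)"
      using reg_diff_le[of "x - ?\<alpha> *\<^sub>R q" x] step by simp
    finally have 1: "dual S A x m l \<ge> ?\<alpha> / 2 * (norm q)\<^sup>2 - reg S x - lip_R S * (?\<alpha> * norm q)"
      unfolding dual_eq b_def[symmetric] q_def[symmetric] by simp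
    have b: "CB_lo S * norm l \<le> norm b" "norm b \<le> CB_hi S * norm l"
      unfolding b_def using Bmat_bounds[OF x] by auto
    have "- (norm m * norm b) \<le> m \<bullet> b" using Cauchy_Schwarz_ineq2[of m b] by linarith
    moreover have "norm m * norm b \<le> norm m * (CB_hi S * norm l)" using b by (intro mult_left_mono) auto
    moreover have "(CB_lo S * norm l)\<^sup>2 \<le> (norm b)\<^sup>2" using b CB_lo_pos by (intro power_mono) auto
    moreover have "(norm q)\<^sup>2 = (norm m)\<^sup>2 + 2 * (m \<bullet> b) + (norm b)\<^sup>2"
      unfolding q_def power2_norm_eq_inner by (simp add: inner_add_left inner_add_right inner_commute)
    ultimately have "(CB_lo S * norm l)\<^sup>2 - 2 * (norm m * (CB_hi S * norm l)) \<le> (norm q)\<^sup>2"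
      using zero_le_power2[of "norm m"] by linarith
    hence 2: "?\<alpha> / 2 * ((CB_lo S * norm l)\<^sup>2 - 2 * (norm m * (CB_hi S * norm l))) \<le> ?\<alpha> / 2 * (norm q)\<^sup>2"
      using step by (intro mult_left_mono) auto
    have "norm q \<le> norm m + CB_hi S * norm l" unfolding q_def using norm_triangle_ineq[of m b] b by linarith
    hence 3: "lip_R S * (?\<alpha> * norm q) \<le> lip_R S * (?\<alpha> * (norm m + CB_hi S * norm l))"
      using step lip_R_nonneg by (intro mult_left_mono) auto
    show "(- reg S x - lip_R S * ?\<alpha> * norm m) - (?\<alpha> * norm m * CB_hi S + lip_R S * ?\<alpha> * CB_hi S) * norm l
        + ?\<alpha> * (CB_lo S)\<^sup>2 / 2 * (norm l)\<^sup>2 \<le> dual S A x m l"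
      using 1 2 3 by (simp add: algebra_simps power_mult_distrib)
  qed auto
  thus ?thesis by simp
qed

lemma Tan_facts:
  assumes "x \<in> mfd S"
  shows "closed (Tan S x)" "convex (Tan S x)" "0 \<in> Tan S x" "Tan S x \<noteq> {}"
  using subspace_Tan[OF assms] subspace_0[OF subspace_Tan[OF assms]]
  by (auto simp: closed_subspace subspace_imp_convex)

lemma exact_step:
  assumes x: "x \<in> mfd S"
  shows "exact_step S A x m \<in> Tan S x"
    and "y \<in> Tan S x \<Longrightarrow> model S A x m (exact_step S A x m) \<le> model S A x m y"
proof -
  obtain z where "z \<in> Tan S x" "\<And>y. y \<in> Tan S x \<Longrightarrow> model S A x m z \<le> model S A x m y"
    using model_attains_min Tan_facts[OF x] by meson
  hence "is_arg_min (model S A x m) (\<lambda>y. y \<in> Tan S x) z"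
    unfolding is_arg_min_def by (auto simp: not_less)
  hence *: "is_arg_min (model S A x m) (\<lambda>y. y \<in> Tan S x) (exact_step S A x m)"
    unfolding exact_step_def arg_min_def by (rule someI)
  show "exact_step S A x m \<in> Tan S x"
    and "y \<in> Tan S x \<Longrightarrow> model S A x m (exact_step S A x m) \<le> model S A x m y"
    using * unfolding is_arg_min_def by (auto simp: not_less)
qed

lemma transpose_Bmat_orthogonal:
  assumes "x \<in> mfd S" "y \<in> Tan S x"
  shows "(transpose (Bmat S x) *v l) \<bullet> y = 0"
  unfolding inner_transpose_mult using assms(2) Tan_eq_Bmat[OF assms(1)] by simp

text \<open>A vanishing dual gradient makes the prox step tangent. On tangent vectors the multiplier
  term is zero, so both problems have the same values there and strong convexity identifies their
  minimizers. Solving the optimality condition for \<open>b\<close> gives the bound: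
  \<open>s\<close> contributes \<open>lip_R S\<close>, the step \<open>norm m + lip_R S\<close>, and
  \<open>m\<close> itself \<open>norm m\<close>.\<close>

lemma dual_minimizer:
  assumes x: "x \<in> mfd S" and min: "\<And>l'. dual S A x m l \<le> dual S A x m l'"
  shows "prox_step x (m + transpose (Bmat S x) *v l) = exact_step S A x m"
    and "norm l \<le> 2 * (norm m + lip_R S) / CB_lo S"
proof -
  define b where "b = transpose (Bmat S x) *v l"
  define w where "w = prox_step x (m + b)"
  have "Bmat S x *v w = 0"
    using smooth_convex.minimizer_gradient[OF smooth_convex_dual[OF x] min] unfolding w_def b_def by simp
  hence wT: "w \<in> Tan S x" using Tan_eq_Bmat[OF x] by simp
  have b0: "b \<bullet> y = 0" if "y \<in> Tan S x" for y
    unfolding b_def by (rule transpose_Bmat_orthogonal[OF x that])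
  let ?e = "exact_step S A x m"
  have eT: "?e \<in> Tan S x" by (rule exact_step(1)[OF x])
  have "model S A x (m + b) w + (norm (?e - w))\<^sup>2 / (2 * step A) \<le> model S A x (m + b) ?e"
    unfolding w_def by (rule prox_step_growth)
  hence "(norm (?e - w))\<^sup>2 / (2 * step A) \<le> 0"
    using exact_step(2)[OF x wT, of m] b0[OF wT] b0[OF eT] unfolding model_shift by simp
  hence "(norm (?e - w))\<^sup>2 \<le> 0" using step by (simp add: divide_le_0_iff)
  hence we: "w = ?e" by simp
  thus "prox_step x (m + transpose (Bmat S x) *v l) = exact_step S A x m" unfolding w_def b_def .
  define s where "s = - ((m + b) + (1 / step A) *\<^sub>R w)"
  have ns: "norm s \<le> lip_R S" by (rule prox_step_subgradient(2)[OF w_def s_def])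
  have "norm w \<le> step A * (norm m + lip_R S)"
    unfolding we using model_min_norm(2)[OF Tan_facts(2,3)[OF x] exact_step[OF x]] by blast
  hence nw: "norm ((1 / step A) *\<^sub>R w) \<le> norm m + lip_R S" using step by (simp add: field_simps)
  have "b = - s - (1 / step A) *\<^sub>R w - m" unfolding s_def by simp
  hence "norm b \<le> norm s + norm ((1 / step A) *\<^sub>R w) + norm m"
    using norm_triangle_ineq4[of "- s - (1 / step A) *\<^sub>R w" m] norm_triangle_ineq4[of "- s" "(1 / step A) *\<^sub>R w"]
    by simp
  hence "norm b \<le> 2 * (norm m + lip_R S)" using ns nw by simp
  hence "CB_lo S * norm l \<le> 2 * (norm m + lip_R S)"
    using Bmat_bounds(1)[OF x, of l] unfolding b_def by simp
  thus "norm l \<le> 2 * (norm m + lip_R S) / CB_lo S" using CB_lo_pos by (simp add: field_simps)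
qed

lemma dual_minimizer_exists:
  assumes x: "x \<in> mfd S" and m: "norm m \<le> M_u S A"
  shows "\<exists>l. (\<forall>l'. dual S A x m l \<le> dual S A x m l') \<and> norm l \<le> dual_radius S A"
proof -
  obtain l where l: "\<And>l'. dual S A x m l \<le> dual S A x m l'" using dual_attains_min[OF x] by blast
  have "norm l \<le> 2 * (norm m + lip_R S) / CB_lo S" by (rule dual_minimizer(2)[OF x l])
  also have "\<dots> \<le> dual_radius S A"
    unfolding dual_radius_def using m CB_lo_pos by (intro divide_right_mono) auto
  finally show ?thesis using l by blast
qed

lemma M_u_ge: "M_u S A \<ge> bd_f S" "M_u S A > 0"
  using clip bd_f_pos mult_right_mono[of 1 "clip A" "bd_f S"] unfolding M_u_def by auto

lemma dual_radius_pos: "dual_radius S A > 0"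
  unfolding dual_radius_def using M_u_ge lip_R_nonneg CB_lo_pos by simp

text \<open>The normal component \<open>n\<close> of the primal point enters only through \<open>R\<close>: the multiplier term
  \<open>(B\<^sup>T l) \<bullet> n\<close> is eliminated with the optimality condition of the proximal step, which costs
  \<open>\<ell>\<^sub>R \<parallel>n\<parallel>\<close>.\<close>

lemma inexact_step:
  assumes x: "x \<in> mfd S" and m: "m \<in> Tan S x"
    and w: "w = prox_step x (m + transpose (Bmat S x) *v l)" and Bw: "norm (Bmat S x *v w) \<le> \<Delta>"
    and y: "y \<in> Tan S x"
  shows "model S A x m (proj_tan S x w) + (norm (y - proj_tan S x w))\<^sup>2 / (2 * step A)
    \<le> model S A x m y + 2 * lip_R S * C_dist S * \<Delta>"
proof -
  define b where "b = transpose (Bmat S x) *v l"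
  define e where "e = proj_tan S x w"
  define n where "n = w - e"
  have T: "subspace (Tan S x)" by (rule subspace_Tan[OF x])
  have eT: "e \<in> Tan S x" unfolding e_def proj_tan_def by (rule closest_point_subspace_in[OF T])
  have n0: "n \<bullet> t = 0" if "t \<in> Tan S x" for t
    unfolding n_def e_def proj_tan_def by (rule closest_point_subspace_orthogonal[OF T that])
  have b0: "b \<bullet> t = 0" if "t \<in> Tan S x" for t
    unfolding b_def by (rule transpose_Bmat_orthogonal[OF x that])
  have we: "w = e + n" by (simp add: n_def)
  have "norm n = infdist w (Tan S x)" unfolding n_def e_def proj_tan_def by (rule infdist_subspace[OF T, symmetric])
  also have "\<dots> \<le> C_dist S * norm (Bmat S x *v w)" by (rule C_dist[OF x])
  also have "\<dots> \<le> C_dist S * \<Delta>" using Bw C_dist_pos by (intro mult_left_mono) auto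
  finally have nn: "norm n \<le> C_dist S * \<Delta>" .
  define s where "s = - ((m + b) + (1 / step A) *\<^sub>R w)"
  have ns: "norm s \<le> lip_R S"
    by (rule prox_step_subgradient(2)[OF w[folded b_def] s_def])
  have "b = - s - (1 / step A) *\<^sub>R w - m" unfolding s_def by simp
  hence "b \<bullet> n = (- s - (1 / step A) *\<^sub>R w - m) \<bullet> n" by simp
  also have "\<dots> = - (s \<bullet> n) - (1 / step A) * (norm n)\<^sup>2"
  proof -
    have "m \<bullet> n = 0" "e \<bullet> n = 0" using n0[OF m] n0[OF eT] by (simp_all add: inner_commute)
    thus ?thesis unfolding we power2_norm_eq_inner by (simp add: inner_diff_left inner_add_left)
  qed
  finally have bn: "b \<bullet> n = - (s \<bullet> n) - (norm n)\<^sup>2 / step A" by simp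
  have sn: "s \<bullet> n \<le> lip_R S * norm n"
    using norm_cauchy_schwarz[of s n] mult_right_mono[OF ns norm_ge_zero[of n]] by linarith
  have "model S A x (m + b) w + (norm (y - w))\<^sup>2 / (2 * step A) \<le> model S A x (m + b) y"
    unfolding w b_def[symmetric] by (rule prox_step_growth)
  moreover have "model S A x (m + b) y = model S A x m y" unfolding model_shift using b0[OF y] by simp
  moreover have "model S A x (m + b) w
      = model S A x m e + (reg S (x + w) - reg S (x + e)) + b \<bullet> n + (norm n)\<^sup>2 / (2 * step A)"
  proof -
    have "(norm w)\<^sup>2 = (norm e)\<^sup>2 + (norm n)\<^sup>2" unfolding we power2_norm_eq_inner
      using n0[OF eT] by (simp add: inner_add_left inner_add_right inner_commute)
    moreover have "m \<bullet> w = m \<bullet> e" "b \<bullet> w = b \<bullet> n"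
      unfolding we using n0[OF m] b0[OF eT] by (auto simp: inner_add_right inner_commute)
    ultimately show ?thesis unfolding model_def by (simp add: inner_add_left add_divide_distrib)
  qed
  moreover have "(norm (y - w))\<^sup>2 = (norm (y - e))\<^sup>2 + (norm n)\<^sup>2"
  proof -
    have yw: "y - w = (y - e) - 1 *\<^sub>R n" by (simp add: we)
    have "n \<bullet> (y - e) = 0" using n0[OF subspace_diff[OF T y eT]] .
    thus ?thesis unfolding yw norm_sq_diff_scaleR by simp
  qed
  moreover have "reg S (x + e) - reg S (x + w) \<le> lip_R S * norm n"
    using reg_diff_le[of "x + e" "x + w"] by (simp add: n_def norm_minus_commute)
  moreover have "2 * (lip_R S * norm n) \<le> 2 * lip_R S * C_dist S * \<Delta>"
    using mult_left_mono[OF nn lip_R_nonneg] by simp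
  \<comment> \<open>The squared norm of \<open>n\<close> occurs with \<open>1 / (2 * step A)\<close>
    in the model and again in the growth term, and with \<open>- 1 / step A\<close> in
    \<open>b \<bullet> n\<close>, hence cancels. The two units of \<open>lip_R S * norm n\<close>
    come from \<open>s\<close> and from comparing \<open>reg S\<close> at \<open>x + w\<close> and
    \<open>x + e\<close>.\<close>
  ultimately have "model S A x m e + (norm (y - e))\<^sup>2 / (2 * step A) \<le> model S A x m y + 2 * lip_R S * C_dist S * \<Delta>"
    using bn sn by (simp add: add_divide_distrib)
  thus ?thesis unfolding e_def .
qed

end

section \<open>Descent and criticality in one step\<close>

context valid_setting
begin

lemma GDERIV_fobj: "GDERIV (fobj S) x :> (\<Sum>j=1..num S. gradient (comp S j) x) /\<^sub>R real (num S)"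
proof -
  have "GDERIV (comp S j) x :> gradient (comp S j) x" if "j \<in> {1..num S}" for j
    using comp_C1[OF that] by (intro GDERIV_gradient) auto
  hence "(comp S j has_derivative (\<lambda>h. h \<bullet> gradient (comp S j) x)) (at x)" if "j \<in> {1..num S}" for j
    using that unfolding gderiv_def by blast
  hence "((\<lambda>x. \<Sum>j=1..num S. comp S j x) has_derivative (\<lambda>h. \<Sum>j=1..num S. h \<bullet> gradient (comp S j) x)) (at x)"
    by (rule has_derivative_sum)
  hence "((\<lambda>x. inverse (real (num S)) * (\<Sum>j=1..num S. comp S j x)) has_derivative
      (\<lambda>h. inverse (real (num S)) * (\<Sum>j=1..num S. h \<bullet> gradient (comp S j) x))) (at x)"
    by (rule has_derivative_mult_right)
  moreover have "fobj S = (\<lambda>x. inverse (real (num S)) * (\<Sum>j=1..num S. comp S j x))"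
    unfolding fobj_def by (auto simp: divide_inverse mult.commute)
  ultimately show ?thesis unfolding gderiv_def by (simp add: inner_sum_right)
qed

lemma gradient_fobj: "gradient (fobj S) x = (\<Sum>j=1..num S. gradient (comp S j) x) /\<^sub>R real (num S)"
  by (rule gradient_eqI[OF GDERIV_fobj])

lemma continuous_gradient_fobj: "continuous_on UNIV (gradient (fobj S))"
proof -
  have "continuous_on UNIV (\<lambda>x. (\<Sum>j=1..num S. gradient (comp S j) x) /\<^sub>R real (num S))"
    by (intro continuous_intros) (use comp_C1 in auto)
  thus ?thesis unfolding gradient_fobj[abs_def] .
qed

lemma continuous_Phi: "continuous_on UNIV (Phi S)"
proof -
  have "continuous_on UNIV (fobj S)"
    using GDERIV_fobj unfolding gderiv_def
    by (meson continuous_at_imp_continuous_on has_derivative_continuous)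
  moreover have "continuous_on UNIV (reg S)"
    using reg_lipschitz lipschitz_on_continuous_on by blast
  ultimately show ?thesis unfolding Phi_def[abs_def] by (rule continuous_on_add)
qed

lemma Phi_ge_INF: "x \<in> mfd S \<Longrightarrow> (INF y\<in>mfd S. Phi S y) \<le> Phi S x"
  using compact_continuous_image[OF continuous_on_subset[OF continuous_Phi subset_UNIV] compact_mfd]
  by (intro cINF_lower bounded_imp_bdd_below compact_imp_bounded)

lemma norm_sum_average_le:
  fixes v :: "nat \<Rightarrow> 'v::real_normed_vector"
  assumes "\<And>j. j \<in> {1..num S} \<Longrightarrow> norm (v j) \<le> c"
  shows "norm ((\<Sum>j=1..num S. v j) /\<^sub>R real (num S)) \<le> c"
proof -
  have "norm (\<Sum>j=1..num S. v j) \<le> real (num S) * c"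
    using sum_norm_le[of "{1..num S}" v "\<lambda>_. c"] assms by simp
  thus ?thesis using num_pos by (simp add: field_simps)
qed

lemma norm_gradient_fobj_le: "x \<in> mfd S \<Longrightarrow> norm (gradient (fobj S) x) \<le> bd_f S"
  unfolding gradient_fobj by (rule norm_sum_average_le) (rule comp_bounded)

lemma gradient_fobj_lipschitz:
  assumes "x \<in> nbhd S" "y \<in> nbhd S"
  shows "norm (gradient (fobj S) x - gradient (fobj S) y) \<le> lip_f S * norm (x - y)"
proof -
  have "norm ((\<Sum>j=1..num S. gradient (comp S j) x - gradient (comp S j) y) /\<^sub>R real (num S)) \<le> lip_f S * norm (x - y)"
    by (rule norm_sum_average_le) (use lipschitz_onD[OF comp_lipschitz assms] in \<open>simp add: dist_norm\<close>)
  thus ?thesis unfolding gradient_fobj by (simp add: sum_subtractf scaleR_diff_right)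
qed

lemma rgrad_eq: "rgrad (mfd S) h x = proj_tan S x (gradient h x)"
  by (simp add: rgrad_def proj_tan_def Tan_def)

lemma proj_tan_in: "x \<in> mfd S \<Longrightarrow> proj_tan S x v \<in> Tan S x"
  unfolding proj_tan_def by (rule closest_point_subspace_in[OF subspace_Tan])

lemma norm_proj_tan_le: "x \<in> mfd S \<Longrightarrow> norm (proj_tan S x v) \<le> norm v"
  unfolding proj_tan_def by (rule norm_closest_point_subspace_le(1)[OF subspace_Tan])

lemma norm_rgrad_fobj_le: "x \<in> mfd S \<Longrightarrow> norm (rgrad (mfd S) (fobj S) x) \<le> bd_f S"
  unfolding rgrad_eq using norm_proj_tan_le norm_gradient_fobj_le order_trans by blast

lemma continuous_on_rgrad_fobj: "continuous_on (mfd S) (rgrad (mfd S) (fobj S))"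
  unfolding rgrad_eq
  by (rule continuous_on_proj_tan) (rule continuous_on_subset[OF continuous_gradient_fobj subset_UNIV])

lemma Retr_in: "x \<in> mfd S \<Longrightarrow> v \<in> Tan S x \<Longrightarrow> Retr S x v \<in> mfd S"
  using retraction unfolding smooth_retraction_def Tan_def by blast

end

section \<open>Step lengths, descent and criticality for a small stepsize\<close>

locale irpmvr_small_step = irpmvr_problem S A
  for S :: "('d::finite, 'p::finite) setting" and A :: "'d params" +
  assumes step_small: "step A < C_alpha S A"
begin

abbreviation total_bound :: real where "total_bound \<equiv> M_u S A + lip_R S"

lemma total_bound_pos: "total_bound > 0"
  using M_u_ge lip_R_nonneg by simp

text \<open>This inequality is what the definition of \<open>C\<^sub>\<alpha>\<close> solves for \<open>\<alpha>\<close>.\<close>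

lemma step_radius: "step A * total_bound + sqrt (4 * step A * (lip_R S * C_dist S * tol_max A)) \<le> delta S"
proof -
  define C where "C = lip_R S * C_dist S * tol_max A"
  define D where "D = min (delta S) (delta_T S)"
  \<comment> \<open>In \<open>a\<close> the claim follows from
    \<open>total_bound * a\<^sup>2 + 2 * a * sqrt C \<le> D\<close>, a quadratic inequality whose
    positive root is the base of the square in \<open>C_alpha\<close>.\<close>
  define a where "a = sqrt (step A)"
  have C: "C \<ge> 0" unfolding C_def using lip_R_nonneg C_dist_pos tol_max by simp
  have D: "D > 0" unfolding D_def using consts_pos by simp
  have a: "a \<ge> 0" "a\<^sup>2 = step A" unfolding a_def using step by auto
  have CD: "C \<le> C + total_bound * D" using total_bound_pos D by simp
  have ge: "sqrt (C + total_bound * D) - sqrt C \<ge> 0" using CD by simp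
  have "a \<le> (sqrt (C + total_bound * D) - sqrt C) / total_bound"
  proof (rule power2_le_imp_le)
    show "a\<^sup>2 \<le> ((sqrt (C + total_bound * D) - sqrt C) / total_bound)\<^sup>2"
      using step_small unfolding C_alpha_def a(2) C_def D_def by simp
    show "0 \<le> (sqrt (C + total_bound * D) - sqrt C) / total_bound"
      using ge total_bound_pos by simp
  qed
  hence "total_bound * a + sqrt C \<le> sqrt (C + total_bound * D)"
    using total_bound_pos by (simp add: field_simps)
  moreover have "0 \<le> total_bound * a + sqrt C" using total_bound_pos a C by simp
  ultimately have "(total_bound * a + sqrt C)\<^sup>2 \<le> (sqrt (C + total_bound * D))\<^sup>2"
    by (intro power_mono)
  hence "total_bound * (total_bound * a\<^sup>2 + 2 * (a * sqrt C)) \<le> total_bound * D"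
    using C CD by (simp add: power2_eq_square algebra_simps)
  hence "total_bound * a\<^sup>2 + 2 * (a * sqrt C) \<le> D"
    by (rule mult_left_le_imp_le) (rule total_bound_pos)
  moreover have "sqrt (4 * step A * C) = 2 * (a * sqrt C)" unfolding a_def by (simp add: real_sqrt_mult)
  ultimately show ?thesis unfolding a(2) C_def[symmetric] D_def by (simp add: mult.commute)
qed

lemma exact_step_norm:
  assumes x: "x \<in> mfd S" and m: "norm m \<le> M_u S A"
  shows "norm (exact_step S A x m) \<le> step A * total_bound"
proof -
  have "norm (exact_step S A x m) \<le> step A * (norm m + lip_R S)"
    using model_min_norm(2)[OF Tan_facts(2,3)[OF x] exact_step[OF x]] by blast
  also have "\<dots> \<le> step A * total_bound" using m step by simp
  finally show ?thesis .
qed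

lemma exact_step_delta:
  assumes "x \<in> mfd S" "norm m \<le> M_u S A"
  shows "norm (exact_step S A x m) \<le> delta S"
proof -
  have "sqrt (4 * step A * (lip_R S * C_dist S * tol_max A)) \<ge> 0"
    using step lip_R_nonneg C_dist_pos tol_max by simp
  thus ?thesis using exact_step_norm[OF assms] step_radius by linarith
qed

text \<open>The inexact step nearly minimizes the model and the exact step minimizes it strongly.
  Adding the two growth inequalities puts them within a distance of order
  \<open>sqrt (step A * \<Delta>)\<close>, for which \<open>step_radius\<close> has reserved
  room.\<close>

lemma inexact_step_delta:
  assumes x: "x \<in> mfd S" and m: "m \<in> Tan S x" "norm m \<le> M_u S A"
    and w: "w = prox_step x (m + transpose (Bmat S x) *v l)"
    and Bw: "norm (Bmat S x *v w) \<le> \<Delta>" and \<Delta>: "\<Delta> \<le> tol_max A"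
  shows "norm (proj_tan S x w) \<le> delta S"
proof -
  define e where "e = exact_step S A x m"
  define \<eta> where "\<eta> = proj_tan S x w"
  have eT: "e \<in> Tan S x" unfolding e_def by (rule exact_step(1)[OF x])
  have hT: "\<eta> \<in> Tan S x" unfolding \<eta>_def by (rule proj_tan_in[OF x])
  have "model S A x m \<eta> + (norm (e - \<eta>))\<^sup>2 / (2 * step A) \<le> model S A x m e + 2 * lip_R S * C_dist S * \<Delta>"
    unfolding \<eta>_def by (rule inexact_step[OF x m(1) w Bw eT])
  moreover have "model S A x m e + (norm (\<eta> - e))\<^sup>2 / (2 * step A) \<le> model S A x m \<eta>"
    unfolding e_def by (rule model_min_growth[OF Tan_facts(2)[OF x] exact_step[OF x] hT])
  moreover have "2 * lip_R S * C_dist S * \<Delta> \<le> 2 * lip_R S * C_dist S * tol_max A"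
    using \<Delta> lip_R_nonneg C_dist_pos by (intro mult_left_mono) auto
  ultimately have "(norm (\<eta> - e))\<^sup>2 / step A \<le> 2 * lip_R S * C_dist S * tol_max A"
    by (simp add: norm_minus_commute)
  hence "(norm (\<eta> - e))\<^sup>2 \<le> 4 * step A * (lip_R S * C_dist S * tol_max A)"
  proof -
    assume "(norm (\<eta> - e))\<^sup>2 / step A \<le> 2 * lip_R S * C_dist S * tol_max A"
    hence "(norm (\<eta> - e))\<^sup>2 \<le> 2 * (step A * (lip_R S * C_dist S * tol_max A))"
      using step by (simp add: field_simps)
    moreover have "0 \<le> step A * (lip_R S * C_dist S * tol_max A)"
      using step lip_R_nonneg C_dist_pos tol_max by simp
    ultimately show ?thesis by linarith
  qed
  hence "norm (\<eta> - e) \<le> sqrt (4 * step A * (lip_R S * C_dist S * tol_max A))"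
    by (rule real_le_rsqrt)
  moreover have "norm e \<le> step A * total_bound" unfolding e_def by (rule exact_step_norm[OF x m(2)])
  moreover have "norm \<eta> \<le> norm (\<eta> - e) + norm e" using norm_triangle_ineq[of "\<eta> - e" e] by simp
  ultimately show ?thesis using step_radius unfolding \<eta>_def by linarith
qed

text \<open>Retraction errors are quadratic in the step and \<open>reg S\<close> is convex along the
  segment. The model at the step is compared with its value at 0 by way of the exact step; this
  detour brings in the squared exact step, which the criticality bound needs.\<close>

lemma one_step_descent:
  assumes x: "x \<in> mfd S" and m: "m \<in> Tan S x" "norm m \<le> M_u S A"
    and w: "w = prox_step x (m + transpose (Bmat S x) *v l)"
    and Bw: "norm (Bmat S x *v w) \<le> \<Delta>" and \<Delta>: "0 \<le> \<Delta>" "\<Delta> \<le> tol_max A"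
    and \<eta>: "\<eta> = proj_tan S x w" and g: "relax_min A \<le> g" "g \<le> 1" and \<tau>: "\<tau> > 0"
    and \<sigma>: "\<sigma> = 1 / (2 * step A) - L_F S / 2 - L_R S" "\<sigma> - \<tau> / 2 \<ge> 0"
  shows "Phi S (Retr S x (g *\<^sub>R \<eta>)) \<le> Phi S x
    - relax_min A / (2 * step A) * (norm (exact_step S A x m))\<^sup>2
    - relax_min A * (\<sigma> - \<tau> / 2) * (norm \<eta>)\<^sup>2
    + (norm (m - rgrad (mfd S) (fobj S) x))\<^sup>2 / (2 * \<tau>) + 2 * lip_R S * C_dist S * \<Delta>"
proof -
  define e where "e = exact_step S A x m"
  define G where "G = rgrad (mfd S) (fobj S) x"
  define E where "E = m - G"
  define h where "h = norm \<eta>"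
  have g0: "0 < g" using g relax_min by linarith
  have T: "subspace (Tan S x)" by (rule subspace_Tan[OF x])
  have hT: "\<eta> \<in> Tan S x" unfolding \<eta> by (rule proj_tan_in[OF x])
  have gT: "g *\<^sub>R \<eta> \<in> Tan S x" by (rule subspace_scale[OF T hT])
  have hd: "h \<le> delta S" unfolding h_def \<eta> by (rule inexact_step_delta[OF x m w Bw \<Delta>(2)])
  have h0: "h \<ge> 0" by (simp add: h_def)
  have ngh: "norm (g *\<^sub>R \<eta>) = g * h" using g0 by (simp add: h_def)
  have "g * h \<le> 1 * h" using g h0 by (intro mult_right_mono) auto
  hence ghd: "norm (g *\<^sub>R \<eta>) \<le> delta S" using hd ngh by simp
  note rb = retr_bounds[OF x gT ghd]
  have F: "fobj S (Retr S x (g *\<^sub>R \<eta>)) \<le> fobj S x + g * (G \<bullet> \<eta>) + L_F S / 2 * (g * h)\<^sup>2"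
    using rb unfolding G_def[symmetric] ngh by simp
  have R: "reg S (Retr S x (g *\<^sub>R \<eta>)) \<le> reg S (x + g *\<^sub>R \<eta>) + L_R S * (g * h)\<^sup>2"
    using rb unfolding ngh by (simp add: abs_le_iff)
  have "reg S (x + g *\<^sub>R \<eta>) \<le> (1 - g) * reg S x + g * reg S (x + \<eta>)"
    using convex_onD[OF reg_convex, of g x "x + \<eta>"] g g0 by (simp add: algebra_simps)
  hence sum: "Phi S (Retr S x (g *\<^sub>R \<eta>)) \<le> Phi S x + g * (G \<bullet> \<eta> + reg S (x + \<eta>) - reg S x)
      + (L_F S / 2 + L_R S) * (g * h)\<^sup>2"
    using F R unfolding Phi_def by (simp add: algebra_simps)
  have "(g * h)\<^sup>2 = g * (g * h\<^sup>2)" by (simp add: power2_eq_square)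
  also have "\<dots> \<le> g * (1 * h\<^sup>2)" using g g0 by (intro mult_left_mono mult_right_mono) auto
  finally have "(L_F S / 2 + L_R S) * (g * h)\<^sup>2 \<le> (L_F S / 2 + L_R S) * (g * h\<^sup>2)"
    using consts_pos by (intro mult_left_mono) auto
  hence 1: "(L_F S / 2 + L_R S) * (g * h)\<^sup>2 \<le> g * ((L_F S / 2 + L_R S) * h\<^sup>2)" by (simp add: algebra_simps)
  have eT: "e \<in> Tan S x" unfolding e_def by (rule exact_step(1)[OF x])
  have "model S A x m \<eta> + (norm (e - \<eta>))\<^sup>2 / (2 * step A) \<le> model S A x m e + 2 * lip_R S * C_dist S * \<Delta>"
    unfolding \<eta> by (rule inexact_step[OF x m(1) w Bw eT])
  moreover have "0 \<le> (norm (e - \<eta>))\<^sup>2 / (2 * step A)" using step by simp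
  moreover have "model S A x m e + (norm e)\<^sup>2 / (2 * step A) \<le> reg S x"
    unfolding e_def using model_min_norm(1)[OF Tan_facts(2,3)[OF x] exact_step[OF x]] by blast
  ultimately have "m \<bullet> \<eta> + h\<^sup>2 / (2 * step A) + reg S (x + \<eta>) + (norm e)\<^sup>2 / (2 * step A)
      \<le> reg S x + 2 * lip_R S * C_dist S * \<Delta>"
    unfolding model_def h_def by linarith
  moreover have "m \<bullet> \<eta> = G \<bullet> \<eta> + E \<bullet> \<eta>" unfolding E_def by (simp add: inner_diff_left)
  moreover have "- (norm E * h) \<le> E \<bullet> \<eta>" unfolding h_def using Cauchy_Schwarz_ineq2[of E \<eta>] by linarith
  moreover have "norm E * h \<le> \<tau> / 2 * h\<^sup>2 + (norm E)\<^sup>2 / (2 * \<tau>)"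
  proof -
    have "0 \<le> (\<tau> * h - norm E)\<^sup>2 / (2 * \<tau>)" using \<tau> by simp
    also have "\<dots> = \<tau> / 2 * h\<^sup>2 + (norm E)\<^sup>2 / (2 * \<tau>) - norm E * h"
      using \<tau> by (simp add: power2_eq_square field_simps)
    finally show ?thesis by simp
  qed
  ultimately have "G \<bullet> \<eta> + reg S (x + \<eta>) - reg S x + (L_F S / 2 + L_R S) * h\<^sup>2
     \<le> - ((norm e)\<^sup>2 / (2 * step A)) - (\<sigma> - \<tau> / 2) * h\<^sup>2 + (norm E)\<^sup>2 / (2 * \<tau>) + 2 * lip_R S * C_dist S * \<Delta>"
    unfolding \<sigma>(1) by (simp add: algebra_simps)
  hence "g * (G \<bullet> \<eta> + reg S (x + \<eta>) - reg S x + (L_F S / 2 + L_R S) * h\<^sup>2)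
     \<le> g * (- ((norm e)\<^sup>2 / (2 * step A)) - (\<sigma> - \<tau> / 2) * h\<^sup>2 + (norm E)\<^sup>2 / (2 * \<tau>) + 2 * lip_R S * C_dist S * \<Delta>)"
    using g0 by (intro mult_left_mono) auto
  \<comment> \<open>Here \<open>g\<close> disappears: gains keep the factor
    \<open>relax_min A\<close>, a lower bound of \<open>g\<close>, and losses the factor 1, an upper
    bound.\<close>
  moreover have "relax_min A * ((norm e)\<^sup>2 / (2 * step A)) \<le> g * ((norm e)\<^sup>2 / (2 * step A))"
    using g step by (intro mult_right_mono) auto
  moreover have "relax_min A * ((\<sigma> - \<tau> / 2) * h\<^sup>2) \<le> g * ((\<sigma> - \<tau> / 2) * h\<^sup>2)"
    using g \<sigma>(2) by (intro mult_right_mono) auto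
  moreover have "g * ((norm E)\<^sup>2 / (2 * \<tau>)) \<le> 1 * ((norm E)\<^sup>2 / (2 * \<tau>))"
    using g \<tau> by (intro mult_right_mono) auto
  moreover have "g * (2 * lip_R S * C_dist S * \<Delta>) \<le> 1 * (2 * lip_R S * C_dist S * \<Delta>)"
    using g \<Delta> lip_R_nonneg C_dist_pos by (intro mult_right_mono) auto
  ultimately have "Phi S (Retr S x (g *\<^sub>R \<eta>)) \<le> Phi S x - relax_min A * ((norm e)\<^sup>2 / (2 * step A))
      - relax_min A * ((\<sigma> - \<tau> / 2) * h\<^sup>2) + (norm E)\<^sup>2 / (2 * \<tau>) + 2 * lip_R S * C_dist S * \<Delta>"
    using sum 1 unfolding distrib_left right_diff_distrib by linarith
  thus ?thesis unfolding e_def E_def G_def h_def by (simp add: mult.assoc)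
qed

text \<open>One element of the set suffices. \<open>s\<close> is the subgradient of the prox step at
  a dual minimizer, and the normal vector \<open>v\<close> cancels the multiplier and the normal
  part of the gradient at \<open>x\<close>. What remains is a gradient difference, the scaled step
  and the error.\<close>

lemma criticality_bound:
  assumes x: "x \<in> mfd S" and m: "m \<in> Tan S x" "norm m \<le> M_u S A"
  shows "(criticality S x (exact_step S A x m))\<^sup>2
    \<le> (1 + 2 * (lip_f S + 1 / step A)\<^sup>2) * (norm (exact_step S A x m))\<^sup>2
      + 2 * (norm (m - rgrad (mfd S) (fobj S) x))\<^sup>2"
proof -
  define e where "e = exact_step S A x m"
  define G where "G = rgrad (mfd S) (fobj S) x"
  obtain l where l: "\<And>l'. dual S A x m l \<le> dual S A x m l'" using dual_attains_min[OF x] by blast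
  define b where "b = transpose (Bmat S x) *v l"
  have we: "e = prox_step x (m + b)" using dual_minimizer(1)[OF x l] unfolding b_def e_def by simp
  define s where "s = - ((m + b) + (1 / step A) *\<^sub>R e)"
  have s: "s \<in> subdiff (reg S) (x + e)" by (rule prox_step_subgradient(1)[OF we s_def])
  define v where "v = b - (gradient (fobj S) x - G)"
  have v: "v \<in> normal_space (mfd S) x"
    unfolding normal_space_def orthogonal_def
  proof (intro CollectI ballI)
    fix t assume "t \<in> tangent_space (mfd S) x"
    hence t: "t \<in> Tan S x" by (simp add: Tan_def)
    have "b \<bullet> t = 0" unfolding b_def by (rule transpose_Bmat_orthogonal[OF x t])
    moreover have "(gradient (fobj S) x - G) \<bullet> t = 0"
      unfolding G_def rgrad_eq proj_tan_def
      by (rule closest_point_subspace_orthogonal[OF subspace_Tan[OF x] t])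
    ultimately show "v \<bullet> t = 0" unfolding v_def by (simp add: inner_diff_left)
  qed
  have eT: "e \<in> Tan S x" unfolding e_def by (rule exact_step(1)[OF x])
  have ed: "norm e \<le> delta S" unfolding e_def by (rule exact_step_delta[OF x m(2)])
  define p where "p = gradient (fobj S) (x + e) + s + v"
  let ?V = "{gradient (fobj S) (x + e) + s + v | s v. s \<in> subdiff (reg S) (x + e) \<and> v \<in> normal_space (mfd S) x}"
  have "infdist 0 ?V \<le> dist 0 p" by (rule infdist_le) (use s v in \<open>auto simp: p_def\<close>)
  hence "infdist 0 ?V \<le> norm p" by simp
  also have "p = (gradient (fobj S) (x + e) - gradient (fobj S) x) - (1 / step A) *\<^sub>R e - (m - G)"
    unfolding p_def s_def v_def by simp
  also have "norm \<dots> \<le> norm (gradient (fobj S) (x + e) - gradient (fobj S) x) + norm ((1 / step A) *\<^sub>R e) + norm (m - G)"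
    using norm_triangle_ineq4[of "(gradient (fobj S) (x + e) - gradient (fobj S) x) - (1 / step A) *\<^sub>R e" "m - G"]
      norm_triangle_ineq4[of "gradient (fobj S) (x + e) - gradient (fobj S) x" "(1 / step A) *\<^sub>R e"] by linarith
  also have "\<dots> \<le> lip_f S * norm e + 1 / step A * norm e + norm (m - G)"
    using gradient_fobj_lipschitz[of "x + e" x] delta_nbhd[OF x eT ed] subsetD[OF nbhd(2) x] step by simp
  also have "\<dots> = (lip_f S + 1 / step A) * norm e + norm (m - G)" by (simp add: algebra_simps)
  finally have "(infdist 0 ?V)\<^sup>2 \<le> ((lip_f S + 1 / step A) * norm e + norm (m - G))\<^sup>2"
    by (intro power_mono) (auto simp: infdist_nonneg)
  also have "\<dots> \<le> 2 * ((lip_f S + 1 / step A) * norm e)\<^sup>2 + 2 * (norm (m - G))\<^sup>2"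
    using sum_squares_bound[of "(lip_f S + 1 / step A) * norm e" "norm (m - G)"] unfolding power2_sum by linarith
  finally have "(infdist 0 ?V)\<^sup>2 \<le> 2 * (lip_f S + 1 / step A)\<^sup>2 * (norm e)\<^sup>2 + 2 * (norm (m - G))\<^sup>2"
    by (simp add: power_mult_distrib)
  moreover have "(criticality S x e)\<^sup>2 = (infdist 0 ?V)\<^sup>2 + (norm e)\<^sup>2"
    unfolding criticality_def by (rule real_sqrt_pow2) simp
  ultimately show ?thesis unfolding e_def[symmetric] G_def[symmetric] by (simp add: algebra_simps)
qed

end

section \<open>Runs of the algorithm\<close>

text \<open>Clipping must not leave the tangent space. Projecting the clipped point onto
  \<open>T\<close> keeps it in the ball and no farther from \<open>u\<close>, so by uniqueness of
  the closest point it was in \<open>T\<close> already.\<close>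

lemma closest_point_cball_in_subspace:
  fixes T :: "'a::euclidean_space set"
  assumes T: "subspace T" and u: "u \<in> T" and r: "r \<ge> 0"
  shows "closest_point (cball 0 r) u \<in> T" "norm (closest_point (cball 0 r) u) \<le> r"
proof -
  let ?p = "closest_point (cball 0 r) u"
  have ne: "cball (0::'a) r \<noteq> {}" using r by simp
  have p: "?p \<in> cball 0 r" by (rule closest_point_in_set[OF closed_cball ne])
  thus "norm ?p \<le> r" by simp
  have uT: "closest_point T u = u" using u T by (simp add: closest_point_self)
  have "closest_point T ?p = ?p"
  proof (rule closest_point_unique[OF convex_cball closed_cball])
    show "closest_point T ?p \<in> cball 0 r"
      using norm_closest_point_subspace_le(1)[OF T, of ?p] p by simp
    show "\<forall>z\<in>cball 0 r. dist u (closest_point T ?p) \<le> dist u z"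
    proof
      fix z :: 'a assume z: "z \<in> cball 0 r"
      have "dist u (closest_point T ?p) = norm (closest_point T (u - ?p))"
        using closest_point_subspace_diff[OF T, of u ?p] uT by (simp add: dist_norm)
      also have "\<dots> \<le> norm (u - ?p)" by (rule norm_closest_point_subspace_le(1)[OF T])
      also have "\<dots> \<le> dist u z" using closest_point_le[OF closed_cball z, of u] by (simp add: dist_norm)
      finally show "dist u (closest_point T ?p) \<le> dist u z" .
    qed
  qed
  thus "?p \<in> T" using closest_point_subspace_in[OF T] by metis
qed

section \<open>Invariants and measurability along a run\<close>

locale irpmvr_run = irpmvr_problem S A + irpmvr_steps S A X
  for S :: "('d::finite, 'p::finite) setting" and A :: "'d params" and X :: "('w, 's, 'd, 'p) run"
begin

text \<open>Tangency of \<open>mit\<close> is what \<open>inexact_step\<close> requires, and the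
  norm bound is what \<open>C_alpha\<close> refers to. Both survive because transport and clipping
  are projections and momentum takes convex combinations.\<close>

lemma run_invariant:
  assumes \<omega>: "\<omega> \<in> space (prb X)"
  shows "xit X k \<omega> \<in> mfd S \<and> mbar X k \<omega> \<in> Tan S (xit X k \<omega>) \<and> norm (mbar X k \<omega>) \<le> M_u S A \<and>
    mit X k \<omega> \<in> Tan S (xit X k \<omega>) \<and> norm (mit X k \<omega>) \<le> M_u S A"
proof (induction k)
  case 0
  let ?g = "rgrad (mfd S) (fobj S) (start A)"
  have g: "?g \<in> Tan S (start A)" "norm ?g \<le> M_u S A"
    using proj_tan_in[OF start] norm_rgrad_fobj_le[OF start] M_u_ge(1) by (auto simp: rgrad_eq)
  have "mit X 0 \<omega> = ?g" using momentum[OF \<omega>, of 0] init[OF \<omega>] by (simp add: algebra_simps)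
  thus ?case using init[OF \<omega>] start g by simp
next
  case (Suc k)
  let ?x = "xit X (Suc k) \<omega>"
  have "xit X k \<omega> \<in> mfd S" using Suc by simp
  hence "eta X k \<omega> \<in> Tan S (xit X k \<omega>)" and T0: "subspace (Tan S (xit X k \<omega>))"
    using tangent_step[OF \<omega>] proj_tan_in subspace_Tan by auto
  hence x: "?x \<in> mfd S"
    using retract[OF \<omega>, of k] Retr_in Suc by (simp add: subspace_scale)
  have T: "subspace (Tan S ?x)" by (rule subspace_Tan[OF x])
  have mb: "mbar X (Suc k) \<omega> \<in> Tan S ?x" "norm (mbar X (Suc k) \<omega>) \<le> M_u S A"
    using transport[OF \<omega>, of k] proj_tan_in[OF x] norm_proj_tan_le[OF x, of "mit X k \<omega>"] Suc by auto
  have uh: "uhat X (Suc k) \<omega> \<in> Tan S ?x" "norm (uhat X (Suc k) \<omega>) \<le> M_u S A"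
    using closest_point_cball_in_subspace[OF T estimator_tangent[OF _ \<omega>], of "M_u S A"] M_u_ge(2)
      clipped[OF _ \<omega>, of "Suc k"] by auto
  let ?c = "mom X (Suc k) \<omega>"
  have c: "0 \<le> ?c" "?c \<le> 1" using params_range[OF \<omega>, of "Suc k"] mom_max by auto
  have "mit X (Suc k) \<omega> \<in> Tan S ?x"
    unfolding momentum[OF \<omega>] using T mb uh by (intro subspace_add subspace_scale)
  moreover have "norm (mit X (Suc k) \<omega>) \<le> M_u S A"
  proof -
    have "norm (mit X (Suc k) \<omega>) \<le> ?c * norm (mbar X (Suc k) \<omega>) + (1 - ?c) * norm (uhat X (Suc k) \<omega>)"
      unfolding momentum[OF \<omega>] using norm_triangle_ineq[of "?c *\<^sub>R mbar X (Suc k) \<omega>" "(1 - ?c) *\<^sub>R uhat X (Suc k) \<omega>"] c by simp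
    also have "\<dots> \<le> ?c * M_u S A + (1 - ?c) * M_u S A"
      using mb uh c by (intro add_mono mult_left_mono) auto
    finally show ?thesis by (simp add: algebra_simps)
  qed
  ultimately show ?case using x mb by simp
qed

lemma xit_in: "\<omega> \<in> space (prb X) \<Longrightarrow> xit X k \<omega> \<in> mfd S"
  and mit_in: "\<omega> \<in> space (prb X) \<Longrightarrow> mit X k \<omega> \<in> Tan S (xit X k \<omega>)"
  and norm_mit_le: "\<omega> \<in> space (prb X) \<Longrightarrow> norm (mit X k \<omega>) \<le> M_u S A"
  using run_invariant by blast+

lemma wit_eq: "\<omega> \<in> space (prb X) \<Longrightarrow>
    wit X k \<omega> = prox_step (xit X k \<omega>) (mit X k \<omega> + transpose (Bmat S (xit X k \<omega>)) *v lam X k \<omega>)"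
  using primal_point unfolding prox_step_def by simp

lemma err_bound: "\<omega> \<in> space (prb X) \<Longrightarrow> norm (err S X k \<omega>) \<le> 2 * M_u S A"
  unfolding err_def
  using norm_triangle_ineq4[of "mit X k \<omega>" "rgrad (mfd S) (fobj S) (xit X k \<omega>)"]
    norm_mit_le[of \<omega> k] norm_rgrad_fobj_le[OF xit_in, of \<omega> k] M_u_ge(1) by linarith

lemma rv_events_subset: "Y \<in> measurable (prb X) N \<Longrightarrow> rv_events (prb X) Y N \<subseteq> sets (prb X)"
  unfolding rv_events_def by (auto intro: measurable_sets)

lemma subalgebra_hist: "subalgebra (prb X) (hist X k)"
proof -
  let ?G = "(\<Union>j\<in>{..k}. rv_events (prb X) (xit X j) borel \<union> rv_events (prb X) (mbar X j) borel
          \<union> rv_events (prb X) (est X j) (est_space X)) \<union>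
      (\<Union>j\<in>{1..<k}. rv_events (prb X) (batch X j) (count_space UNIV)) \<union>
      (\<Union>j\<in>{..<k}. rv_events (prb X) (uit X j) borel \<union> rv_events (prb X) (lam X j) borel
          \<union> rv_events (prb X) (wit X j) borel \<union> rv_events (prb X) (eta X j) borel)"
  have G: "?G \<subseteq> sets (prb X)"
    by (intro Un_least UN_least rv_events_subset random_variables)
  hence "?G \<subseteq> Pow (space (prb X))" using sets.sets_into_space by blast
  moreover have "sigma_sets (space (prb X)) ?G \<subseteq> sets (prb X)"
    using G by (rule sets.sigma_sets_subset)
  ultimately show ?thesis unfolding subalgebra_def hist_def by simp
qed

lemma sigma_finite_subalgebra_hist: "sigma_finite_subalgebra (prb X) (hist X k)"
proof -
  interpret prob_space "prb X" by (rule prob)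
  interpret finite_measure_subalgebra "prb X" "hist X k"
    by unfold_locales (rule subalgebra_hist)
  show ?thesis by (rule sigma_finite_subalgebra_axioms)
qed

lemma measurable_hist: "f \<in> borel_measurable (hist X k) \<Longrightarrow> f \<in> borel_measurable (prb X)"
  by (rule measurable_from_subalg[OF subalgebra_hist])

lemma uhat_measurable: "uhat X k \<in> borel_measurable (prb X)"
proof (cases "k = 0")
  case True
  have "(\<lambda>\<omega>. rgrad (mfd S) (fobj S) (start A)) \<in> borel_measurable (prb X)" by simp
  thus ?thesis by (rule measurable_cong[THEN iffD2, rotated]) (simp add: True init(3))
next
  case False
  have "continuous_on UNIV (closest_point (cball (0::real^'d) (M_u S A)))"
    using M_u_ge(2) by (intro continuous_on_closest_point) auto
  hence "(\<lambda>\<omega>. closest_point (cball 0 (M_u S A)) (uit X k \<omega>)) \<in> borel_measurable (prb X)"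
    using random_variables(4)[of k] by (rule borel_measurable_continuous_on)
  thus ?thesis by (rule measurable_cong[THEN iffD2, rotated]) (simp add: clipped[OF False])
qed

lemma mit_measurable: "mit X k \<in> borel_measurable (prb X)"
proof -
  note [measurable] = uhat_measurable random_variables(5) measurable_hist[OF params_adapted(3)]
  have "(\<lambda>\<omega>. mom X k \<omega> *\<^sub>R mbar X k \<omega> + (1 - mom X k \<omega>) *\<^sub>R uhat X k \<omega>) \<in> borel_measurable (prb X)"
    by measurable
  thus ?thesis by (rule measurable_cong[THEN iffD2, rotated]) (simp add: momentum)
qed

lemma err_measurable: "err S X k \<in> borel_measurable (prb X)"
proof -
  have M: "mfd S \<in> sets borel" by (intro borel_closed compact_imp_closed compact_mfd)
  \<comment> \<open>Continuity is known on the manifold only; the extension by 0 is Borel on the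
    whole space and agrees with the gradient along the run.\<close>
  define h where "h x = (if x \<in> mfd S then rgrad (mfd S) (fobj S) x else 0)" for x
  have "h \<in> borel_measurable borel"
    unfolding h_def
    by (rule borel_measurable_continuous_on_if[OF M continuous_on_rgrad_fobj]) simp
  hence "(\<lambda>\<omega>. h (xit X k \<omega>)) \<in> borel_measurable (prb X)"
    using random_variables(3)[of k] by (rule measurable_compose[rotated])
  hence "(\<lambda>\<omega>. mit X k \<omega> - h (xit X k \<omega>)) \<in> borel_measurable (prb X)"
    using mit_measurable by measurable
  thus ?thesis by (rule measurable_cong[THEN iffD2, rotated]) (simp add: h_def xit_in err_def)
qed

end

section \<open>From conditional to expected dissipation\<close>

lemma ennreal_dissipation:
  fixes a b d :: ennreal and p c \<mu> \<nu> :: real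
  assumes "enn2ereal a + ereal \<mu> * ereal p \<le> ereal c * (ereal p - enn2ereal b) + ereal \<nu> * enn2ereal d"
    and "d < \<top>" and "c > 0" "\<mu> > 0" "\<nu> > 0" "p \<ge> 0"
  shows "a + ennreal c * b \<le> ennreal c * ennreal p + ennreal \<nu> * d"
proof -
  obtain d' where d': "d = ennreal d'" "d' \<ge> 0" using assms(2) by (cases d) auto
  \<comment> \<open>An infinite \<open>b\<close> would make the right side minus infinity, below a
    nonnegative left side. With \<open>b\<close> and \<open>d\<close> finite, so is
    \<open>a\<close>, and the inequality becomes one between reals.\<close>
  have b: "b \<noteq> \<top>"
  proof
    assume "b = \<top>"
    hence eb: "enn2ereal b = \<infinity>" by simp
    have "ereal c * (ereal p - enn2ereal b) + ereal \<nu> * enn2ereal d = - \<infinity>"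
      unfolding eb using d' assms(3) by simp
    hence "enn2ereal a + ereal \<mu> * ereal p \<le> - \<infinity>" using assms(1) by (simp only:)
    moreover have "enn2ereal a + ereal \<mu> * ereal p \<ge> 0" using assms(4,6) by simp
    ultimately have "(0::ereal) \<le> - \<infinity>" by (rule order_trans[rotated])
    thus False by simp
  qed
  then obtain b' where b': "b = ennreal b'" "b' \<ge> 0" by (cases b) auto
  have "a \<noteq> \<top>"
  proof
    assume "a = \<top>"
    hence "enn2ereal a + ereal \<mu> * ereal p = \<infinity>" by simp
    thus False using assms(1) b' d' by simp
  qed
  then obtain a' where a': "a = ennreal a'" "a' \<ge> 0" by (cases a) auto
  have "a' + \<mu> * p \<le> c * (p - b') + \<nu> * d'" using assms(1) a' b' d' by simp
  moreover have "\<mu> * p \<ge> 0" using assms by simp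
  ultimately have "a' + c * b' \<le> c * p + \<nu> * d'" by (simp add: algebra_simps)
  thus ?thesis using a' b' d' assms by (simp flip: ennreal_mult' ennreal_plus add: ennreal_leI)
qed

text \<open>With \<open>c * p'\<close> moved to the left, only sums of nonnegative terms remain, so
  the conditional inequality can be integrated before the integrability of the potentials is
  settled.\<close>

lemma nn_integral_dissipation:
  fixes e h p p' :: "'w \<Rightarrow> real"
  assumes sub: "sigma_finite_subalgebra M F" and
    meas [measurable]: "e \<in> borel_measurable M" "h \<in> borel_measurable M" "p \<in> borel_measurable M" "p' \<in> borel_measurable M"
    and p: "\<And>\<omega>. \<omega> \<in> space M \<Longrightarrow> p \<omega> \<ge> 0" and hD: "\<And>\<omega>. \<omega> \<in> space M \<Longrightarrow> h \<omega> \<le> D"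
    and const: "c > 0" "\<mu> > 0" "\<nu> > 0"
    and ae: "AE \<omega> in M. enn2ereal (nn_cond_exp M F (\<lambda>\<omega>. ennreal (e \<omega>)) \<omega>) + ereal \<mu> * ereal (p \<omega>)
      \<le> ereal c * (ereal (p \<omega>) - enn2ereal (nn_cond_exp M F (\<lambda>\<omega>. ennreal (p' \<omega>)) \<omega>))
        + ereal \<nu> * enn2ereal (nn_cond_exp M F (\<lambda>\<omega>. ennreal (h \<omega>)) \<omega>)"
  shows "(\<integral>\<^sup>+\<omega>. ennreal (e \<omega>) \<partial>M) + ennreal c * (\<integral>\<^sup>+\<omega>. ennreal (p' \<omega>) \<partial>M)
    \<le> ennreal c * (\<integral>\<^sup>+\<omega>. ennreal (p \<omega>) \<partial>M) + ennreal \<nu> * (\<integral>\<^sup>+\<omega>. ennreal (h \<omega>) \<partial>M)"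
proof -
  interpret sigma_finite_subalgebra M F by (rule sub)
  let ?ce = "\<lambda>Y. nn_cond_exp M F (\<lambda>\<omega>. ennreal (Y \<omega>))"
  have int: "(\<integral>\<^sup>+\<omega>. ?ce Y \<omega> \<partial>M) = (\<integral>\<^sup>+\<omega>. ennreal (Y \<omega>) \<partial>M)" if "Y \<in> borel_measurable M" for Y :: "'w \<Rightarrow> real"
    using nn_cond_exp_intg[of "\<lambda>_. 1" "\<lambda>\<omega>. ennreal (Y \<omega>)"] that by simp
  \<comment> \<open>A bounded \<open>h\<close> has a finite conditional expectation almost surely,
    which excludes competing infinities on the right side.\<close>
  have "AE \<omega> in M. ?ce h \<omega> \<le> nn_cond_exp M F (\<lambda>_. ennreal D) \<omega>"
    by (rule nn_cond_exp_mono) (auto intro!: AE_I2 ennreal_leI hD)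
  moreover have "AE \<omega> in M. ennreal D = nn_cond_exp M F (\<lambda>_. ennreal D) \<omega>"
    by (rule nn_cond_exp_F_meas) simp
  ultimately have "AE \<omega> in M. ?ce h \<omega> < \<top>"
    by eventually_elim (metis ennreal_less_top le_less_trans)
  with ae AE_space have "AE \<omega> in M. ?ce e \<omega> + ennreal c * ?ce p' \<omega> \<le> ennreal c * ennreal (p \<omega>) + ennreal \<nu> * ?ce h \<omega>"
  proof eventually_elim
    case (elim \<omega>)
    show ?case by (rule ennreal_dissipation[OF elim(1) elim(3) const p[OF elim(2)]])
  qed
  hence "(\<integral>\<^sup>+\<omega>. ?ce e \<omega> + ennreal c * ?ce p' \<omega> \<partial>M) \<le> (\<integral>\<^sup>+\<omega>. ennreal c * ennreal (p \<omega>) + ennreal \<nu> * ?ce h \<omega> \<partial>M)"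
    by (rule nn_integral_mono_AE)
  thus ?thesis by (simp add: nn_integral_add nn_integral_cmult int)
qed

text \<open>Telescoping by addition: \<open>ennreal\<close> has no cancellation at infinity, so the
  last potential stays on the left.\<close>

lemma telescoped_dissipation:
  fixes e h p :: "nat \<Rightarrow> ennreal"
  assumes "\<And>k. e k + c * p (Suc k) \<le> c * p k + \<nu> * h k"
  shows "(\<Sum>k<n. e k) + c * p n \<le> c * p 0 + \<nu> * (\<Sum>k<n. h k)"
proof (induction n)
  case (Suc n)
  have "(\<Sum>k<Suc n. e k) + c * p (Suc n) = (\<Sum>k<n. e k) + (e n + c * p (Suc n))" by (simp add: add.assoc)
  also have "\<dots> \<le> (\<Sum>k<n. e k) + (c * p n + \<nu> * h n)" by (intro add_left_mono assms)
  also have "\<dots> = ((\<Sum>k<n. e k) + c * p n) + \<nu> * h n" by (simp add: add.assoc)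
  also have "\<dots> \<le> (c * p 0 + \<nu> * (\<Sum>k<n. h k)) + \<nu> * h n" by (intro add_right_mono Suc)
  also have "\<dots> = c * p 0 + \<nu> * (\<Sum>k<Suc n. h k)" by (simp add: distrib_left add.assoc)
  finally show ?case .
qed simp

section \<open>Pathwise bounds and expectations for accurate runs\<close>

locale irpmvr_accurate_run = irpmvr_small_step S A + irpmvr_run S A X
  for S :: "('d::finite, 'p::finite) setting" and A :: "'d params" and X :: "('w, 's, 'd, 'p) run" +
  assumes accurate: "inner_accuracy S A X"
begin

lemma wit_accuracy:
  assumes \<omega>: "\<omega> \<in> space (prb X)"
  shows "norm (Bmat S (xit X k \<omega>) *v wit X k \<omega>) \<le> tol X k \<omega>"
proof -
  have "norm (gradient (dual_at S A X k \<omega>) (lam X k \<omega>)) \<le> tol X k \<omega>"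
    using accurate \<omega> unfolding inner_accuracy_def by blast
  thus ?thesis unfolding dual_at_def gradient_dual[OF xit_in[OF \<omega>]] wit_eq[OF \<omega>] by simp
qed

lemma tol_range: "\<omega> \<in> space (prb X) \<Longrightarrow> 0 \<le> tol X k \<omega> \<and> tol X k \<omega> \<le> tol_max A"
  using params_range by simp

lemma norm_eta_le:
  assumes \<omega>: "\<omega> \<in> space (prb X)"
  shows "norm (eta X k \<omega>) \<le> delta S"
proof -
  have "tol X k \<omega> \<le> tol_max A" using tol_range[OF \<omega>] by blast
  thus ?thesis
    unfolding tangent_step[OF \<omega>]
    by (rule inexact_step_delta[OF xit_in[OF \<omega>] mit_in[OF \<omega>] norm_mit_le[OF \<omega>] wit_eq[OF \<omega>] wit_accuracy[OF \<omega>]])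
qed

lemma run_descent:
  assumes \<omega>: "\<omega> \<in> space (prb X)" and \<tau>: "\<tau> > 0"
    and \<sigma>: "\<sigma> = 1 / (2 * step A) - L_F S / 2 - L_R S" "\<sigma> - \<tau> / 2 \<ge> 0"
  shows "relax_min A / (2 * step A) * (norm (exact_step S A (xit X k \<omega>) (mit X k \<omega>)))\<^sup>2
    \<le> Phi S (xit X k \<omega>) - Phi S (xit X (Suc k) \<omega>) - relax_min A * (\<sigma> - \<tau> / 2) * (norm (eta X k \<omega>))\<^sup>2
    + (norm (err S X k \<omega>))\<^sup>2 / (2 * \<tau>) + 2 * lip_R S * C_dist S * tol X k \<omega>"
proof -
  have r: "relax_min A \<le> relax X k \<omega>" "relax X k \<omega> \<le> 1" using params_range[OF \<omega>, of k] by auto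
  have t: "0 \<le> tol X k \<omega>" "tol X k \<omega> \<le> tol_max A" using tol_range[OF \<omega>, of k] by auto
  show ?thesis
    using one_step_descent[OF xit_in[OF \<omega>] mit_in[OF \<omega>] norm_mit_le[OF \<omega>] wit_eq[OF \<omega>] wit_accuracy[OF \<omega>]
        t tangent_step[OF \<omega>] r \<tau> \<sigma>]
    unfolding retract[OF \<omega>] err_def by linarith
qed

lemma theta_bound:
  assumes \<omega>: "\<omega> \<in> space (prb X)"
  shows "(theta S A X k \<omega>)\<^sup>2 \<le> (1 + 2 * (lip_f S + 1 / step A)\<^sup>2) * (norm (exact_step S A (xit X k \<omega>) (mit X k \<omega>)))\<^sup>2
      + 2 * (norm (err S X k \<omega>))\<^sup>2"
  unfolding theta_def err_def by (rule criticality_bound[OF xit_in[OF \<omega>] mit_in[OF \<omega>] norm_mit_le[OF \<omega>]])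

lemma square_integrable:
  shows "integrable (prb X) (\<lambda>\<omega>. (norm (err S X k \<omega>))\<^sup>2)" "integrable (prb X) (\<lambda>\<omega>. (norm (eta X k \<omega>))\<^sup>2)"
    and "integrable (prb X) (\<lambda>\<omega>. Phi S (xit X k \<omega>))"
proof -
  interpret prob_space "prb X" by (rule prob)
  note [measurable] = err_measurable random_variables
  have bound: "integrable (prb X) (\<lambda>\<omega>. (norm (Y \<omega>))\<^sup>2)"
    if [measurable]: "Y \<in> borel_measurable (prb X)" and B: "\<And>\<omega>. \<omega> \<in> space (prb X) \<Longrightarrow> norm (Y \<omega>) \<le> B"
    for Y :: "'w \<Rightarrow> real^'d" and B
  proof (rule integrable_const_bound[where B = "B\<^sup>2"])
    show "AE \<omega> in prb X. norm ((norm (Y \<omega>))\<^sup>2) \<le> B\<^sup>2"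
      using power_mono[OF B norm_ge_zero, of _ 2] by (intro AE_I2) simp
  qed measurable
  show "integrable (prb X) (\<lambda>\<omega>. (norm (err S X k \<omega>))\<^sup>2)"
    by (rule bound[OF err_measurable err_bound])
  show "integrable (prb X) (\<lambda>\<omega>. (norm (eta X k \<omega>))\<^sup>2)"
    by (rule bound[OF random_variables(8) norm_eta_le])
  have "bounded (Phi S ` mfd S)"
    using continuous_on_subset[OF continuous_Phi subset_UNIV] compact_mfd
    by (intro compact_imp_bounded compact_continuous_image)
  then obtain B where "\<And>x. x \<in> mfd S \<Longrightarrow> norm (Phi S x) \<le> B" unfolding bounded_iff by blast
  moreover have "(\<lambda>\<omega>. Phi S (xit X k \<omega>)) \<in> borel_measurable (prb X)"
    using continuous_Phi random_variables(3) by (rule borel_measurable_continuous_on)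
  ultimately show "integrable (prb X) (\<lambda>\<omega>. Phi S (xit X k \<omega>))"
    by (intro integrable_const_bound[where B = B]) (auto intro!: AE_I2 simp: xit_in)
qed

lemma expected_error_sum:
  assumes ed: "error_dissipation S c_e \<mu> \<nu> X" and const: "c_e > 0" "\<mu> > 0" "\<nu> > 0"
  shows "(\<Sum>k<n. \<integral>\<omega>. (norm (err S X k \<omega>))\<^sup>2 \<partial>prb X)
    \<le> c_e * (\<integral>\<omega>. pot X 0 \<omega> \<partial>prb X) + \<nu> * (\<Sum>k<n. \<integral>\<omega>. (norm (eta X k \<omega>))\<^sup>2 \<partial>prb X)"
proof -
  interpret prob_space "prb X" by (rule prob)
  let ?e = "\<lambda>k \<omega>. (norm (err S X k \<omega>))\<^sup>2" and ?h = "\<lambda>k \<omega>. (norm (eta X k \<omega>))\<^sup>2"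
  have pot: "pot X k \<in> borel_measurable (prb X)" for k
    using ed measurable_hist unfolding error_dissipation_def by blast
  have pot0: "pot X k \<omega> \<ge> 0" if "\<omega> \<in> space (prb X)" for k \<omega>
    using ed that unfolding error_dissipation_def by blast
  have intp: "integrable (prb X) (pot X 0)" using ed unfolding error_dissipation_def by blast
  note [measurable] = err_measurable random_variables
  have step: "(\<integral>\<^sup>+\<omega>. ennreal (?e k \<omega>) \<partial>prb X) + ennreal c_e * (\<integral>\<^sup>+\<omega>. ennreal (pot X (Suc k) \<omega>) \<partial>prb X)
    \<le> ennreal c_e * (\<integral>\<^sup>+\<omega>. ennreal (pot X k \<omega>) \<partial>prb X) + ennreal \<nu> * (\<integral>\<^sup>+\<omega>. ennreal (?h k \<omega>) \<partial>prb X)" for k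
  proof (rule nn_integral_dissipation[OF sigma_finite_subalgebra_hist _ _ pot pot pot0 _ const, where D = "(delta S)\<^sup>2"])
    show "?e k \<in> borel_measurable (prb X)" "?h k \<in> borel_measurable (prb X)" by measurable
    show "?h k \<omega> \<le> (delta S)\<^sup>2" if "\<omega> \<in> space (prb X)" for \<omega>
      using norm_eta_le[OF that] by (intro power_mono) auto
    show "AE \<omega> in prb X. enn2ereal (nn_cond_exp (prb X) (hist X k) (\<lambda>\<omega>. ennreal (?e k \<omega>)) \<omega>) + ereal \<mu> * ereal (pot X k \<omega>)
      \<le> ereal c_e * (ereal (pot X k \<omega>) - enn2ereal (nn_cond_exp (prb X) (hist X k) (\<lambda>\<omega>. ennreal (pot X (Suc k) \<omega>)) \<omega>))
        + ereal \<nu> * enn2ereal (nn_cond_exp (prb X) (hist X k) (\<lambda>\<omega>. ennreal (?h k \<omega>)) \<omega>)"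
      using ed unfolding error_dissipation_def cexp_def by blast
  qed auto
  have "(\<Sum>k<n. \<integral>\<^sup>+\<omega>. ennreal (?e k \<omega>) \<partial>prb X)
     \<le> (\<Sum>k<n. \<integral>\<^sup>+\<omega>. ennreal (?e k \<omega>) \<partial>prb X) + ennreal c_e * (\<integral>\<^sup>+\<omega>. ennreal (pot X n \<omega>) \<partial>prb X)" by simp
  also have "\<dots> \<le> ennreal c_e * (\<integral>\<^sup>+\<omega>. ennreal (pot X 0 \<omega>) \<partial>prb X) + ennreal \<nu> * (\<Sum>k<n. \<integral>\<^sup>+\<omega>. ennreal (?h k \<omega>) \<partial>prb X)"
    using telescoped_dissipation[where e = "\<lambda>k. \<integral>\<^sup>+\<omega>. ennreal (?e k \<omega>) \<partial>prb X"
        and p = "\<lambda>k. \<integral>\<^sup>+\<omega>. ennreal (pot X k \<omega>) \<partial>prb X" and h = "\<lambda>k. \<integral>\<^sup>+\<omega>. ennreal (?h k \<omega>) \<partial>prb X",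
        OF step, of n] by simp
  finally have "(\<Sum>k<n. ennreal (\<integral>\<omega>. ?e k \<omega> \<partial>prb X))
      \<le> ennreal c_e * ennreal (\<integral>\<omega>. pot X 0 \<omega> \<partial>prb X) + ennreal \<nu> * (\<Sum>k<n. ennreal (\<integral>\<omega>. ?h k \<omega> \<partial>prb X))"
    by (simp add: nn_integral_eq_integral square_integrable intp pot0)
  also have "\<dots> = ennreal (c_e * (\<integral>\<omega>. pot X 0 \<omega> \<partial>prb X) + \<nu> * (\<Sum>k<n. \<integral>\<omega>. ?h k \<omega> \<partial>prb X))"
  proof -
    have "0 \<le> (\<integral>\<omega>. pot X 0 \<omega> \<partial>prb X)" using pot0 by (rule Bochner_Integration.integral_nonneg)
    moreover have "0 \<le> (\<Sum>k<n. \<integral>\<omega>. ?h k \<omega> \<partial>prb X)" by (intro sum_nonneg Bochner_Integration.integral_nonneg) simp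
    moreover have "(\<Sum>k<n. ennreal (\<integral>\<omega>. ?h k \<omega> \<partial>prb X)) = ennreal (\<Sum>k<n. \<integral>\<omega>. ?h k \<omega> \<partial>prb X)"
      by (rule sum_ennreal) simp
    ultimately show ?thesis using const by (simp add: ennreal_mult ennreal_plus)
  qed
  also have "(\<Sum>k<n. ennreal (\<integral>\<omega>. ?e k \<omega> \<partial>prb X)) = ennreal (\<Sum>k<n. \<integral>\<omega>. ?e k \<omega> \<partial>prb X)"
    by (rule sum_ennreal) simp
  finally have "ennreal (\<Sum>k<n. \<integral>\<omega>. ?e k \<omega> \<partial>prb X)
      \<le> ennreal (c_e * (\<integral>\<omega>. pot X 0 \<omega> \<partial>prb X) + \<nu> * (\<Sum>k<n. \<integral>\<omega>. ?h k \<omega> \<partial>prb X))" .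
  moreover have "0 \<le> c_e * (\<integral>\<omega>. pot X 0 \<omega> \<partial>prb X) + \<nu> * (\<Sum>k<n. \<integral>\<omega>. ?h k \<omega> \<partial>prb X)"
    using const pot0
    by (intro add_nonneg_nonneg mult_nonneg_nonneg sum_nonneg Bochner_Integration.integral_nonneg) auto
  ultimately show ?thesis by (simp only: ennreal_le_iff)
qed

end

context irpmvr_accurate_run
begin

text \<open>The majorant \<open>Y\<close> is built from objective differences, steps and errors,
  whose expectations can be summed; \<open>nn_integral_mono\<close> passes from it to
  \<open>theta\<close> whatever the measurability of \<open>theta\<close>.\<close>

lemma expected_theta_sum:
  assumes ed: "error_dissipation S c_e \<mu> \<nu> X" and const: "c_e > 0" "\<mu> > 0" "\<nu> > 0" and \<kappa>: "\<kappa> \<ge> 0"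
    and \<tau>: "\<tau> > 0" and \<sigma>: "\<sigma> = 1 / (2 * step A) - L_F S / 2 - L_R S" "\<sigma> - \<tau> / 2 \<ge> 0"
    and a: "a_eta = relax_min A * (\<sigma> - \<tau> / 2) - \<nu> / (2 * \<tau>) - 2 * lip_R S * C_dist S * \<kappa>"
    and C: "C \<ge> 0" "(1 + 2 * (lip_f S + 1 / step A)\<^sup>2) \<le> C * (relax_min A / (2 * step A))" "2 * \<nu> \<le> C * a_eta"
    and tol: "\<And>k \<omega>. k < n \<Longrightarrow> \<omega> \<in> space (prb X) \<Longrightarrow>
      tol X k \<omega> \<le> \<kappa> * (norm (if k = 0 then 0 else eta X (k - 1) \<omega>))\<^sup>2 + s"
  shows "\<exists>Y. (\<forall>k<n. (\<integral>\<^sup>+\<omega>. ennreal ((theta S A X k \<omega>)\<^sup>2) \<partial>prb X) \<le> ennreal (Y k)) \<and>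
    (\<Sum>k<n. Y k) \<le> C * (Phi S (start A) - (INF x\<in>mfd S. Phi S x))
      + c_e * (2 + C / (2 * \<tau>)) * (\<integral>\<omega>. pot X 0 \<omega> \<partial>prb X)
      + real n * (2 * C * lip_R S * C_dist S * s)"
proof -
  interpret prob_space "prb X" by (rule prob)
  define c where "c = 2 * lip_R S * C_dist S"
  have c: "c \<ge> 0" unfolding c_def using lip_R_nonneg C_dist_pos by simp
  define e where "e k \<omega> = (norm (err S X k \<omega>))\<^sup>2" for k \<omega>
  define h where "h k \<omega> = (norm (eta X k \<omega>))\<^sup>2" for k \<omega>
  define h' where "h' k \<omega> = (norm (if k = 0 then 0 else eta X (k - 1) \<omega>))\<^sup>2" for k \<omega>
  define P where "P k \<omega> = Phi S (xit X k \<omega>)" for k \<omega>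
  define b where "b = relax_min A * (\<sigma> - \<tau> / 2)"
  define Z where "Z k \<omega> = P k \<omega> - P (Suc k) \<omega> - b * h k \<omega> + e k \<omega> / (2 * \<tau>) + c * (\<kappa> * h' k \<omega> + s)" for k \<omega>
  define Y where "Y k \<omega> = C * Z k \<omega> + 2 * e k \<omega>" for k \<omega>
  have ie: "integrable (prb X) (e k)" and ih: "integrable (prb X) (h k)" and iP: "integrable (prb X) (P k)" for k
    unfolding e_def[abs_def] h_def[abs_def] P_def[abs_def] by (rule square_integrable)+
  have ih': "integrable (prb X) (h' k)" for k
    using ih[of "k - 1"] unfolding h'_def[abs_def] h_def[abs_def] by (cases "k = 0") auto
  have iY: "integrable (prb X) (Y k)" for k
    unfolding Y_def[abs_def] Z_def[abs_def] using ie ih iP ih' by (intro Bochner_Integration.integrable_add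
      Bochner_Integration.integrable_diff integrable_mult_right integrable_divide integrable_const) auto
  have ub: "(theta S A X k \<omega>)\<^sup>2 \<le> Y k \<omega>" if k: "k < n" and \<omega>: "\<omega> \<in> space (prb X)" for k \<omega>
  proof -
    define q where "q = (norm (exact_step S A (xit X k \<omega>) (mit X k \<omega>)))\<^sup>2"
    have "relax_min A / (2 * step A) * q \<le> P k \<omega> - P (Suc k) \<omega> - b * h k \<omega> + e k \<omega> / (2 * \<tau>) + c * tol X k \<omega>"
      using run_descent[OF \<omega> \<tau> \<sigma>, of k] unfolding q_def P_def b_def h_def e_def c_def .
    also have "c * tol X k \<omega> \<le> c * (\<kappa> * h' k \<omega> + s)"
      using tol[OF k \<omega>] c unfolding h'_def by (rule mult_left_mono)
    finally have "relax_min A / (2 * step A) * q \<le> Z k \<omega>" unfolding Z_def by simp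
    hence "C * (relax_min A / (2 * step A) * q) \<le> C * Z k \<omega>" using C(1) by (rule mult_left_mono)
    moreover have "(1 + 2 * (lip_f S + 1 / step A)\<^sup>2) * q \<le> C * (relax_min A / (2 * step A)) * q"
      using C(2) by (rule mult_right_mono) (simp add: q_def)
    ultimately show ?thesis using theta_bound[OF \<omega>, of k] unfolding Y_def q_def[symmetric] e_def by simp
  qed
  have 1: "(\<integral>\<^sup>+\<omega>. ennreal ((theta S A X k \<omega>)\<^sup>2) \<partial>prb X) \<le> ennreal (\<integral>\<omega>. Y k \<omega> \<partial>prb X)" if k: "k < n" for k
  proof -
    have Y0: "0 \<le> Y k \<omega>" if "\<omega> \<in> space (prb X)" for \<omega>
      using ub[OF k that] zero_le_power2 order_trans by blast
    have "(\<integral>\<^sup>+\<omega>. ennreal ((theta S A X k \<omega>)\<^sup>2) \<partial>prb X) \<le> (\<integral>\<^sup>+\<omega>. ennreal (Y k \<omega>) \<partial>prb X)"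
      by (intro nn_integral_mono ennreal_leI ub k)
    also have "\<dots> = ennreal (\<integral>\<omega>. Y k \<omega> \<partial>prb X)"
      by (rule nn_integral_eq_integral[OF iY]) (intro AE_I2 Y0)
    finally show ?thesis .
  qed
  define E where "E k = (\<integral>\<omega>. e k \<omega> \<partial>prb X)" for k
  define H where "H k = (\<integral>\<omega>. h k \<omega> \<partial>prb X)" for k
  define H' where "H' k = (\<integral>\<omega>. h' k \<omega> \<partial>prb X)" for k
  define Q where "Q k = (\<integral>\<omega>. P k \<omega> \<partial>prb X)" for k
  have YE: "(\<integral>\<omega>. Y k \<omega> \<partial>prb X) = C * (Q k - Q (Suc k) - b * H k + E k / (2 * \<tau>) + c * (\<kappa> * H' k + s)) + 2 * E k" for k
    unfolding Y_def Z_def E_def H_def H'_def Q_def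
    using ie ih iP ih' by (simp add: prob_space)
  have H0: "H k \<ge> 0" for k unfolding H_def h_def by (rule Bochner_Integration.integral_nonneg) simp
  have H'0: "H' 0 = 0" unfolding H'_def h'_def by simp
  have H'S: "H' (Suc k) = H k" for k unfolding H'_def H_def h'_def h_def by simp
  \<comment> \<open>The tolerance looks one step back and starts from a zero step, so the shifted
    sum is part of the unshifted one.\<close>
  have "(\<Sum>k<n. H' k) \<le> (\<Sum>k<n. H k)"
  proof (cases n)
    case (Suc m)
    have "(\<Sum>k<n. H' k) = (\<Sum>k<m. H k)" unfolding Suc sum.lessThan_Suc_shift H'0 H'S by simp
    also have "\<dots> \<le> (\<Sum>k<n. H k)" unfolding Suc using H0 by simp
    finally show ?thesis .
  qed simp
  hence HH: "c * (\<kappa> * (\<Sum>k<n. H' k)) \<le> c * (\<kappa> * (\<Sum>k<n. H k))" using c \<kappa> by (intro mult_left_mono)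
  have EE: "(\<Sum>k<n. E k) \<le> c_e * (\<integral>\<omega>. pot X 0 \<omega> \<partial>prb X) + \<nu> * (\<Sum>k<n. H k)"
    unfolding E_def H_def e_def h_def by (rule expected_error_sum[OF ed const])
  have "(\<Sum>k<n. Q k - Q (Suc k)) = Q 0 - Q n" by (rule sum_lessThan_telescope')
  moreover have "Q 0 = Phi S (start A)"
  proof -
    have "Q 0 = (\<integral>\<omega>. Phi S (start A) \<partial>prb X)"
      unfolding Q_def P_def by (rule Bochner_Integration.integral_cong) (auto simp: init(1))
    thus ?thesis by (simp add: prob_space)
  qed
  moreover have "(INF x\<in>mfd S. Phi S x) \<le> Q n"
  proof -
    have "(\<integral>\<omega>. (INF x\<in>mfd S. Phi S x) \<partial>prb X) \<le> Q n"
      unfolding Q_def by (rule integral_mono) (auto simp: iP P_def intro: Phi_ge_INF xit_in)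
    thus ?thesis by (simp add: prob_space)
  qed
  ultimately have QQ: "(\<Sum>k<n. Q k - Q (Suc k)) \<le> Phi S (start A) - (INF x\<in>mfd S. Phi S x)" by simp
  define SE where "SE = (\<Sum>k<n. E k)"
  define SH where "SH = (\<Sum>k<n. H k)"
  define SH' where "SH' = (\<Sum>k<n. H' k)"
  define SQ where "SQ = (\<Sum>k<n. Q k - Q (Suc k))"
  define D where "D = Phi S (start A) - (INF x\<in>mfd S. Phi S x)"
  define p where "p = (\<integral>\<omega>. pot X 0 \<omega> \<partial>prb X)"
  have SH0: "SH \<ge> 0" unfolding SH_def using H0 by (intro sum_nonneg)
  have "(\<Sum>k<n. \<integral>\<omega>. Y k \<omega> \<partial>prb X) = C * (SQ - b * SH + SE / (2 * \<tau>) + c * (\<kappa> * SH') + c * (real n * s)) + 2 * SE"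
    unfolding YE SE_def SH_def SH'_def SQ_def
    by (simp add: sum.distrib sum_subtractf sum_distrib_left[symmetric] sum_distrib_right[symmetric] sum_divide_distrib[symmetric] algebra_simps)
  also have "\<dots> \<le> C * (D - b * SH + (c_e * p + \<nu> * SH) / (2 * \<tau>) + c * (\<kappa> * SH) + c * (real n * s)) + 2 * (c_e * p + \<nu> * SH)"
  proof -
    have "SE / (2 * \<tau>) \<le> (c_e * p + \<nu> * SH) / (2 * \<tau>)"
      using EE \<tau> unfolding SE_def SH_def p_def by (intro divide_right_mono) auto
    hence "SQ - b * SH + SE / (2 * \<tau>) + c * (\<kappa> * SH') + c * (real n * s)
        \<le> D - b * SH + (c_e * p + \<nu> * SH) / (2 * \<tau>) + c * (\<kappa> * SH) + c * (real n * s)"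
      using QQ HH unfolding SQ_def D_def SH_def SH'_def by linarith
    hence "C * (SQ - b * SH + SE / (2 * \<tau>) + c * (\<kappa> * SH') + c * (real n * s))
        \<le> C * (D - b * SH + (c_e * p + \<nu> * SH) / (2 * \<tau>) + c * (\<kappa> * SH) + c * (real n * s))"
      using C(1) by (rule mult_left_mono)
    moreover have "2 * SE \<le> 2 * (c_e * p + \<nu> * SH)" using EE unfolding SE_def SH_def p_def by simp
    ultimately show ?thesis by (rule add_mono)
  qed
  \<comment> \<open>The coefficient of \<open>SH\<close> collects the decrease, the error traded in
    both of its places, and the adaptive tolerance; by the choice of \<open>a_eta\<close> it is
    \<open>2 * \<nu> - C * a_eta\<close>.\<close>
  also have "\<dots> = C * D + c_e * (2 + C / (2 * \<tau>)) * p + real n * (C * c * s) - (C * a_eta - 2 * \<nu>) * SH"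
    unfolding a b_def[symmetric] c_def[symmetric] by (simp add: algebra_simps add_divide_distrib)
  also have "\<dots> \<le> C * D + c_e * (2 + C / (2 * \<tau>)) * p + real n * (C * c * s)"
    using C(3) SH0 by simp
  finally have "(\<Sum>k<n. \<integral>\<omega>. Y k \<omega> \<partial>prb X) \<le> C * D + c_e * (2 + C / (2 * \<tau>)) * p + real n * (2 * C * lip_R S * C_dist S * s)"
    unfolding c_def by (simp add: mult.assoc mult.left_commute)
  thus ?thesis using 1 unfolding D_def p_def by (intro exI[of _ "\<lambda>k. \<integral>\<omega>. Y k \<omega> \<partial>prb X"]) simp
qed

end

section \<open>Inner iterations\<close>

text \<open>The first success comes no later than \<open>j\<close>. Candidates may be whole stages,
  so monotone counters are what makes an earlier candidate no more expensive.\<close>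

lemma inner_iterations_le:
  assumes "meets rt g \<Delta> j" and mono: "\<And>i. i \<le> j \<Longrightarrow> snd (rt g \<Delta> i) \<le> snd (rt g \<Delta> j)"
  shows "inner_iterations rt g \<Delta> \<le> enat (snd (rt g \<Delta> j))"
  using assms unfolding inner_iterations_def by (auto intro: Least_le)

section \<open>Cost of single inner solves and of their sum\<close>

context irpmvr_run
begin

abbreviation dual_grad :: "nat \<Rightarrow> 'w \<Rightarrow> real^'p \<Rightarrow> real^'p" where
  "dual_grad k \<omega> \<equiv> gradient (dual_at S A X k \<omega>)"

lemma dual_at_smooth:
  assumes \<omega>: "\<omega> \<in> space (prb X)"
  shows "smooth_convex (dual_at S A X k \<omega>) (gradient (dual_at S A X k \<omega>)) (dual_lip S A) 0"
    and "\<exists>z. (\<forall>y. dual_at S A X k \<omega> z \<le> dual_at S A X k \<omega> y) \<and> norm z \<le> dual_radius S A"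
  unfolding dual_at_def
  using smooth_convex_dual[OF xit_in[OF \<omega>]] gradient_dual[OF xit_in[OF \<omega>]]
    dual_minimizer_exists[OF xit_in[OF \<omega>] norm_mit_le[OF \<omega>]] by auto

lemma FISTA_call:
  assumes \<omega>: "\<omega> \<in> space (prb X)" and t: "tol X k \<omega> > 0"
  shows "\<exists>N. inner_iterations (routine_FISTA S A) (dual_grad k \<omega>) (tol X k \<omega>) \<le> enat N \<and>
    real N \<le> 2 * dual_lip S A * dual_radius S A / tol X k \<omega> + 1"
proof -
  interpret smooth_convex "dual_at S A X k \<omega>" "dual_grad k \<omega>" "dual_lip S A" 0
    by (rule dual_at_smooth(1)[OF \<omega>])
  obtain z where z: "\<And>y. dual_at S A X k \<omega> z \<le> dual_at S A X k \<omega> y" "norm z \<le> dual_radius S A"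
    using dual_at_smooth(2)[OF \<omega>] by blast
  obtain j where "norm (dual_grad k \<omega> (fst (fista (dual_grad k \<omega>) (dual_lip S A) 0 j))) \<le> tol X k \<omega>"
    "real j \<le> 2 * dual_lip S A * dual_radius S A / tol X k \<omega> + 1"
    using fista_complexity[OF z t] by blast
  thus ?thesis
    using inner_iterations_le[of "routine_FISTA S A" "dual_grad k \<omega>" "tol X k \<omega>" j]
    unfolding meets_def routine_FISTA_def by auto
qed

lemma NFG_call:
  assumes \<omega>: "\<omega> \<in> space (prb X)" and t: "tol X k \<omega> > 0"
    and \<rho>: "\<rho> > 0" "\<rho> * dual_radius S A < 1" and L1: "L1 = dual_lip S A + 2 * \<rho> * tol_max A"
  shows "\<exists>N. inner_iterations (routine_NFG S A \<rho>) (dual_grad k \<omega>) (tol X k \<omega>) \<le> enat N \<and>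
    real N \<le> sqrt (L1 / (\<rho> * tol X k \<omega>))
      * max 0 (ln ((2 * L1 * dual_radius S A / ((1 - \<rho> * dual_radius S A) * tol X k \<omega>))\<^sup>2)) + 1"
proof -
  interpret smooth_convex "dual_at S A X k \<omega>" "dual_grad k \<omega>" "dual_lip S A" 0
    by (rule dual_at_smooth(1)[OF \<omega>])
  obtain z where z: "\<And>y. dual_at S A X k \<omega> z \<le> dual_at S A X k \<omega> y" "norm z \<le> dual_radius S A"
    using dual_at_smooth(2)[OF \<omega>] by blast
  have "tol X k \<omega> \<le> tol_max A" using params_range[OF \<omega>] by simp
  from fgm_complexity[OF z dual_radius_pos t this \<rho> L1]
  obtain j where "norm (dual_grad k \<omega> (fst (fgm (\<lambda>y. dual_grad k \<omega> y + (\<rho> * tol X k \<omega>) *\<^sub>R y)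
      (dual_lip S A + \<rho> * tol X k \<omega>) (\<rho> * tol X k \<omega>) 0 j))) \<le> tol X k \<omega>"
    "real j \<le> sqrt (L1 / (\<rho> * tol X k \<omega>))
      * max 0 (ln ((2 * L1 * dual_radius S A / ((1 - \<rho> * dual_radius S A) * tol X k \<omega>))\<^sup>2)) + 1"
    by blast
  thus ?thesis
    using inner_iterations_le[of "routine_NFG S A \<rho>" "dual_grad k \<omega>" "tol X k \<omega>" j]
    unfolding meets_def routine_NFG_def by auto
qed

lemma AR_call:
  assumes \<omega>: "\<omega> \<in> space (prb X)" and t: "tol X k \<omega> > 0"
    and \<rho>: "\<rho> > 0" "5 * \<rho> * dual_radius S A \<le> 1"
  shows "\<exists>N. inner_iterations (routine_AR S A \<rho>) (dual_grad k \<omega>) (tol X k \<omega>) \<le> enat N \<and>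
    real N \<le> 34 + (17 * sqrt (2 * dual_lip S A * dual_radius S A) + 32 * sqrt (dual_lip S A / \<rho>)) / sqrt (tol X k \<omega>)"
proof -
  interpret smooth_convex "dual_at S A X k \<omega>" "dual_grad k \<omega>" "dual_lip S A" 0
    by (rule dual_at_smooth(1)[OF \<omega>])
  obtain z where z: "\<And>y. dual_at S A X k \<omega> z \<le> dual_at S A X k \<omega> y" "norm z \<le> dual_radius S A"
    using dual_at_smooth(2)[OF \<omega>] by blast
  let ?N = "\<lambda>s. \<Sum>i=1..s. ar_length (dual_lip S A) (\<rho> * tol X k \<omega>) i"
  obtain s where s: "norm (dual_grad k \<omega> (fst (ar (dual_grad k \<omega>) (dual_lip S A) (\<rho> * tol X k \<omega>) 0 s))) \<le> tol X k \<omega>"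
    "real (?N s) \<le> 34 + (17 * sqrt (2 * dual_lip S A * dual_radius S A) + 32 * sqrt (dual_lip S A / \<rho>)) / sqrt (tol X k \<omega>)"
    using ar_complexity[OF z t \<rho>] by blast
  have "?N i \<le> ?N s" if "i \<le> s" for i using that by (intro sum_mono2) auto
  hence "inner_iterations (routine_AR S A \<rho>) (dual_grad k \<omega>) (tol X k \<omega>) \<le> enat (?N s)"
    using inner_iterations_le[of "routine_AR S A \<rho>" "dual_grad k \<omega>" "tol X k \<omega>" s] s(1)
    unfolding meets_def routine_AR_def by simp
  thus ?thesis using s(2) by blast
qed

lemma total_inner_le:
  assumes "\<And>k. k < n \<Longrightarrow> \<exists>N. inner_iterations rt (gradient (dual_at S A X k \<omega>)) (tol X k \<omega>) \<le> enat N \<and> real N \<le> b"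
  shows "ereal_of_enat (total_inner S A rt X n \<omega>) \<le> ereal (real n * b)"
proof -
  have "\<exists>N. total_inner S A rt X n \<omega> \<le> enat N \<and> real N \<le> real n * b"
    using assms
  proof (induction n)
    case 0
    show ?case by (auto simp: total_inner_def zero_enat_def)
  next
    case (Suc n)
    obtain N where N: "total_inner S A rt X n \<omega> \<le> enat N" "real N \<le> real n * b"
      using Suc.IH Suc.prems by (meson less_SucI)
    obtain N' where N': "inner_iterations rt (gradient (dual_at S A X n \<omega>)) (tol X n \<omega>) \<le> enat N'" "real N' \<le> b"
      using Suc.prems by blast
    have "total_inner S A rt X (Suc n) \<omega> \<le> enat N + enat N'"
      using add_mono[OF N(1) N'(1)] unfolding total_inner_def by simp
    thus ?case using N(2) N'(2) by (intro exI[of _ "N + N'"]) (simp add: algebra_simps)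
  qed
  then obtain N where N: "total_inner S A rt X n \<omega> \<le> enat N" "real N \<le> real n * b" by blast
  have "ereal_of_enat (total_inner S A rt X n \<omega>) \<le> ereal_of_enat (enat N)"
    using N(1) by (simp only: ereal_of_enat_le_iff)
  also have "\<dots> \<le> ereal (real n * b)" using N(2) by simp
  finally show ?thesis .
qed

end


section \<open>Charging constants to powers and logarithms of a bounded \<epsilon>\<close>

lemma nat_ceiling_budget:
  assumes "0 < \<epsilon>" "\<epsilon>\<^sup>2 \<le> E" "a \<le> b"
  shows "real (max 1 (nat \<lceil>2 * a / \<epsilon>\<^sup>2\<rceil>)) \<le> (2 * E + 2 * max 0 b) / \<epsilon>\<^sup>2"
proof -
  have e: "\<epsilon>\<^sup>2 > 0" using assms by simp
  have "2 * a / \<epsilon>\<^sup>2 \<le> 2 * max 0 b / \<epsilon>\<^sup>2" using e assms by (intro divide_right_mono) auto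
  moreover have "0 \<le> 2 * max 0 b / \<epsilon>\<^sup>2" using e by simp
  ultimately have "real (nat \<lceil>2 * a / \<epsilon>\<^sup>2\<rceil>) \<le> 2 * max 0 b / \<epsilon>\<^sup>2 + 1" by linarith
  hence "real (max 1 (nat \<lceil>2 * a / \<epsilon>\<^sup>2\<rceil>)) \<le> 2 * max 0 b / \<epsilon>\<^sup>2 + 2"
    using \<open>0 \<le> 2 * max 0 b / \<epsilon>\<^sup>2\<close> by (simp add: max_def)
  \<comment> \<open>Rounding up and the minimum of one iteration cost a constant, which is a
    multiple of \<open>1 / \<epsilon>\<^sup>2\<close> because \<open>\<epsilon>\<^sup>2\<close> is
    bounded by \<open>E\<close>.\<close>
  moreover have "2 \<le> 2 * E / \<epsilon>\<^sup>2" using assms e by (simp add: field_simps)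
  ultimately show ?thesis unfolding add_divide_distrib by linarith
qed

text \<open>Bounding the argument by \<open>(1 + P) * (1 + 1 / \<epsilon>\<^sup>2)\<close> separates
  a constant from the logarithm; the constant becomes a multiple of that logarithm, which never
  drops below \<open>ln (1 + 1 / E)\<close>.\<close>

lemma ln_square_le_ln_budget:
  fixes P :: real
  assumes "P > 0" "\<epsilon> > 0" "\<epsilon>\<^sup>2 \<le> E" "E > 0"
  shows "max 0 (ln ((P / \<epsilon>\<^sup>2)\<^sup>2)) \<le> (2 * ln (1 + P) / ln (1 + 1 / E) + 2) * ln (1 + 1 / \<epsilon>\<^sup>2)"
    and "1 \<le> ln (1 + 1 / \<epsilon>\<^sup>2) / ln (1 + 1 / E)"
proof -
  have e: "\<epsilon>\<^sup>2 > 0" using assms by simp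
  have l0: "ln (1 + 1 / E) > 0" by (rule ln_gt_zero) (use assms in simp)
  have le: "ln (1 + 1 / E) \<le> ln (1 + 1 / \<epsilon>\<^sup>2)"
  proof -
    have "1 / E \<le> 1 / \<epsilon>\<^sup>2" by (rule divide_left_mono[OF assms(3) zero_le_one mult_pos_pos[OF assms(4) e]])
    thus ?thesis using assms by (intro ln_mono) (auto simp: add_pos_pos)
  qed
  thus l1: "1 \<le> ln (1 + 1 / \<epsilon>\<^sup>2) / ln (1 + 1 / E)" using l0 by simp
  have "P / \<epsilon>\<^sup>2 \<le> (1 + P) * (1 + 1 / \<epsilon>\<^sup>2)" using assms e by (simp add: field_simps)
  hence "ln (P / \<epsilon>\<^sup>2) \<le> ln ((1 + P) * (1 + 1 / \<epsilon>\<^sup>2))"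
    using assms e by (intro ln_mono) auto
  also have "\<dots> = ln (1 + P) + ln (1 + 1 / \<epsilon>\<^sup>2)"
    using assms e by (intro ln_mult_pos) (auto simp: add_pos_pos)
  finally have "ln ((P / \<epsilon>\<^sup>2)\<^sup>2) \<le> 2 * ln (1 + P) + 2 * ln (1 + 1 / \<epsilon>\<^sup>2)"
    using assms e by (simp add: ln_realpow)
  moreover have "0 \<le> ln (1 + P)" "0 \<le> ln (1 + 1 / \<epsilon>\<^sup>2)" using assms(1) by (auto intro!: ln_ge_zero)
  ultimately have "max 0 (ln ((P / \<epsilon>\<^sup>2)\<^sup>2)) \<le> 2 * ln (1 + P) * 1 + 2 * ln (1 + 1 / \<epsilon>\<^sup>2)" by simp
  also have "\<dots> \<le> 2 * ln (1 + P) * (ln (1 + 1 / \<epsilon>\<^sup>2) / ln (1 + 1 / E)) + 2 * ln (1 + 1 / \<epsilon>\<^sup>2)"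
    using l1 assms by (intro add_right_mono mult_left_mono) auto
  finally show "max 0 (ln ((P / \<epsilon>\<^sup>2)\<^sup>2)) \<le> (2 * ln (1 + P) / ln (1 + 1 / E) + 2) * ln (1 + 1 / \<epsilon>\<^sup>2)"
    by (simp add: distrib_right)
qed

theorem theorem5p5:
  fixes S :: "('d::finite, 'p::finite) setting" and A :: "'d params"
    and c_e \<mu> \<nu> \<kappa> \<sigma>\<^sub>0 \<tau> a_eta a_etahat C_Theta C_comp C_tol :: real
    and A\<^sub>0 :: "real \<Rightarrow> real" and K :: "real \<Rightarrow> real \<Rightarrow> nat"
  assumes "valid_setting S" and "valid_params S A"
    and "c_e > 0" and "\<mu> > 0" and "\<nu> > 0" and "\<kappa> \<ge> 0"
    and "0 < step_max A"
    and "step_max A < min (C_alpha S A)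
           (1 / (L_F S + 2 * L_R S + 2 * sqrt (\<nu> / relax_min A)
                 + 4 * lip_R S * C_dist S * \<kappa> / relax_min A))"
    and "\<sigma>\<^sub>0 = 1 / (2 * step A) - L_F S / 2 - L_R S"
    and "\<tau> = sqrt (\<nu> / relax_min A)"
    and "a_eta = relax_min A * (\<sigma>\<^sub>0 - \<tau> / 2) - \<nu> / (2 * \<tau>) - 2 * lip_R S * C_dist S * \<kappa>"
    and "a_etahat = relax_min A / (2 * step A)"
    and "C_Theta = 1 + 2 * (lip_f S + 1 / step A)\<^sup>2"
    and "C_comp = max (C_Theta / a_etahat) (2 * \<nu> / a_eta)"
    and "C_tol = max 1 (4 * C_comp * lip_R S * C_dist S)"
    and "A\<^sub>0 = (\<lambda>E0. C_comp * (Phi S (start A) - (INF x\<in>mfd S. Phi S x))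
                   + c_e * (2 + C_comp / (2 * \<tau>)) * E0)"
    and "K = (\<lambda>E0 \<epsilon>. max 1 (nat \<lceil>2 * A\<^sub>0 E0 / \<epsilon>\<^sup>2\<rceil>))"
  shows
    "(\<forall>\<epsilon> E0. \<forall>X :: ('w, 's, 'd, 'p) run.
        0 < \<epsilon> \<and> \<epsilon>\<^sup>2 / C_tol \<le> tol_max A \<and>
        irpmvr S A X \<and> error_dissipation S c_e \<mu> \<nu> X \<and>
        E0 = prob_space.expectation (prb X) (pot X 0) \<and>
        tolerance_rule A \<kappa> (\<epsilon>\<^sup>2 / C_tol) (K E0 \<epsilon>) X \<longrightarrow>
        Min ((\<lambda>k. \<integral>\<^sup>+\<omega>. ennreal ((theta S A X k \<omega>)\<^sup>2) \<partial>prb X) ` {..<K E0 \<epsilon>})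
          \<le> ennreal (\<epsilon>\<^sup>2))
     \<and>
     (\<forall>e0. \<exists>C. \<forall>\<epsilon> E0 \<omega>. \<forall>X :: ('w, 's, 'd, 'p) run.
        0 < \<epsilon> \<and> \<epsilon>\<^sup>2 / C_tol \<le> tol_max A \<and>
        irpmvr_steps S A X \<and> uses_routine S A (routine_FISTA S A) X \<and>
        error_dissipation S c_e \<mu> \<nu> X \<and>
        E0 = prob_space.expectation (prb X) (pot X 0) \<and> E0 \<le> e0 \<and>
        tolerance_rule A \<kappa> (\<epsilon>\<^sup>2 / C_tol) (K E0 \<epsilon>) X \<and> \<omega> \<in> space (prb X) \<longrightarrow>
        ereal_of_enat (total_inner S A (routine_FISTA S A) X (K E0 \<epsilon>) \<omega>)
          \<le> ereal (C * (1 / \<epsilon> ^ 4)))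
     \<and>
     (\<forall>e0 \<rho>. 0 < \<rho> \<and> \<rho> * dual_radius S A < 1 \<longrightarrow>
       (\<exists>C. \<forall>\<epsilon> E0 \<omega>. \<forall>X :: ('w, 's, 'd, 'p) run.
        0 < \<epsilon> \<and> \<epsilon>\<^sup>2 / C_tol \<le> tol_max A \<and>
        irpmvr_steps S A X \<and> uses_routine S A (routine_NFG S A \<rho>) X \<and>
        error_dissipation S c_e \<mu> \<nu> X \<and>
        E0 = prob_space.expectation (prb X) (pot X 0) \<and> E0 \<le> e0 \<and>
        tolerance_rule A \<kappa> (\<epsilon>\<^sup>2 / C_tol) (K E0 \<epsilon>) X \<and> \<omega> \<in> space (prb X) \<longrightarrow>
        ereal_of_enat (total_inner S A (routine_NFG S A \<rho>) X (K E0 \<epsilon>) \<omega>)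
          \<le> ereal (C * (1 / \<epsilon> ^ 3 * ln (1 + 1 / \<epsilon>\<^sup>2)))))
     \<and>
     (\<forall>e0 \<rho>. 0 < \<rho> \<and> 5 * \<rho> * dual_radius S A \<le> 1 \<longrightarrow>
       (\<exists>C. \<forall>\<epsilon> E0 \<omega>. \<forall>X :: ('w, 's, 'd, 'p) run.
        0 < \<epsilon> \<and> \<epsilon>\<^sup>2 / C_tol \<le> tol_max A \<and>
        irpmvr_steps S A X \<and> uses_routine S A (routine_AR S A \<rho>) X \<and>
        error_dissipation S c_e \<mu> \<nu> X \<and>
        E0 = prob_space.expectation (prb X) (pot X 0) \<and> E0 \<le> e0 \<and>
        tolerance_rule A \<kappa> (\<epsilon>\<^sup>2 / C_tol) (K E0 \<epsilon>) X \<and> \<omega> \<in> space (prb X) \<longrightarrow>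
        ereal_of_enat (total_inner S A (routine_AR S A \<rho>) X (K E0 \<epsilon>) \<omega>)
          \<le> ereal (C * (1 / \<epsilon> ^ 3))))"
proof -
  interpret irpmvr_problem S A
    using assms(1,2) by (simp add: irpmvr_problem_def)
  define \<gamma> where "\<gamma> = relax_min A"
  define \<alpha> where "\<alpha> = step A"
  define lc where "lc = lip_R S * C_dist S"
  have \<gamma>: "\<gamma> > 0" unfolding \<gamma>_def using relax_min by simp
  have \<alpha>: "\<alpha> > 0" unfolding \<alpha>_def using step by simp
  have lc: "lc \<ge> 0" unfolding lc_def using lip_R_nonneg C_dist_pos by simp
  have \<tau>: "\<tau> > 0" unfolding assms(10) using assms(5) relax_min by simp
  have \<tau>2: "\<nu> = \<gamma> * \<tau>\<^sup>2" unfolding assms(10) \<gamma>_def using assms(5) relax_min by simp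
  have small: "step A < C_alpha S A" using assms(8) step by simp
  define D where "D = L_F S + 2 * L_R S + 2 * \<tau> + 4 * lc * \<kappa> / \<gamma>"
  have D: "D > 0" unfolding D_def using consts_pos \<tau> lc \<gamma> assms(6) by (simp add: add_pos_nonneg)
  have "\<alpha> < 1 / D"
    using assms(8) step unfolding D_def lc_def \<alpha>_def \<gamma>_def assms(10) by (simp add: mult.assoc)
  hence DD: "D < 1 / \<alpha>" using D \<alpha> by (simp add: field_simps)
  have kg: "4 * lc * \<kappa> / \<gamma> \<ge> 0" using lc assms(6) \<gamma> by simp
  have \<sigma>: "\<sigma>\<^sub>0 - \<tau> / 2 \<ge> 0"
    using DD kg \<tau> unfolding assms(9) D_def \<alpha>_def by simp
  \<comment> \<open>With \<open>\<nu> = \<gamma> * \<tau>\<^sup>2\<close> the two terms in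
    \<open>\<tau>\<close> are equal and add up to \<open>\<gamma> * \<tau>\<close>; positivity of
    \<open>a_eta\<close> is then the condition \<open>\<alpha> < 1 / D\<close>.\<close>
  have "a_eta = \<gamma> / 2 * (1 / \<alpha> - D)"
    unfolding assms(11) assms(9) D_def \<tau>2 \<alpha>_def[symmetric] \<gamma>_def[symmetric] lc_def using \<tau> \<gamma> \<alpha>
    by (simp add: field_simps power2_eq_square)
  moreover have "\<gamma> / 2 * (1 / \<alpha> - D) > 0" by (rule mult_pos_pos) (use \<gamma> DD in auto)
  ultimately have a_eta: "a_eta > 0" by simp
  have a_hat: "a_etahat > 0" unfolding assms(12) using step relax_min by simp
  have CT: "C_Theta > 0" unfolding assms(13) by (simp add: add_pos_nonneg)
  have Cc: "C_comp > 0" "C_Theta \<le> C_comp * a_etahat" "2 * \<nu> \<le> C_comp * a_eta"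
  proof -
    have "C_Theta / a_etahat \<le> C_comp" "2 * \<nu> / a_eta \<le> C_comp" unfolding assms(14) by auto
    thus "C_Theta \<le> C_comp * a_etahat" "2 * \<nu> \<le> C_comp * a_eta" using a_hat a_eta by (auto simp: field_simps)
    show "C_comp > 0" unfolding assms(14) using CT a_hat by (simp add: less_max_iff_disj)
  qed
  have Ct: "C_tol \<ge> 1" "4 * C_comp * lc \<le> C_tol" unfolding assms(15) lc_def by (auto simp: mult.assoc)
  \<comment> \<open>The initial potential varies with the run and is bounded by \<open>e0\<close>
    only; monotonicity makes the outer budget uniform over runs.\<close>
  have A0_mono: "A\<^sub>0 u \<le> A\<^sub>0 v" if "u \<le> v" for u v
    unfolding assms(16) using that assms(3) Cc(1) \<tau> by (intro add_left_mono mult_left_mono) auto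
  define E where "E = C_tol * tol_max A"
  have eps: "\<epsilon>\<^sup>2 \<le> E" "E > 0" if "0 < \<epsilon>" "\<epsilon>\<^sup>2 / C_tol \<le> tol_max A" for \<epsilon>
  proof -
    show 1: "\<epsilon>\<^sup>2 \<le> E" using that(2) Ct(1) unfolding E_def by (simp add: field_simps)
    thus "E > 0" using that(1) by (meson less_le_trans zero_less_power)
  qed
  \<comment> \<open>Before index \<open>n\<close> the floor of the rule is active and lies below the
    cap, so each inner call has a tolerance of order at least
    \<open>\<epsilon>\<^sup>2\<close>.\<close>
  have tol_ge: "\<epsilon>\<^sup>2 / C_tol \<le> tol X k \<omega>"
    if "\<epsilon>\<^sup>2 / C_tol \<le> tol_max A" "tolerance_rule A \<kappa> (\<epsilon>\<^sup>2 / C_tol) n X" "k < n" "\<omega> \<in> space (prb X)"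
    for \<epsilon> n k \<omega> and X :: "('w, 's, 'd, 'p) run"
    using that unfolding tolerance_rule_def by auto
  define outer where "outer e0 = 2 * E + 2 * max 0 (A\<^sub>0 e0)" for e0
  have budget: "real (K E0 \<epsilon>) \<le> outer e0 / \<epsilon>\<^sup>2"
    if "0 < \<epsilon>" "\<epsilon>\<^sup>2 / C_tol \<le> tol_max A" "E0 \<le> e0" for E0 e0 \<epsilon>
    unfolding assms(17) outer_def by (rule nat_ceiling_budget[OF that(1) eps(1)[OF that(1,2)] A0_mono[OF that(3)]])
  have total: "ereal_of_enat (total_inner S A rt X (K E0 \<epsilon>) \<omega>) \<le> ereal (outer e0 / \<epsilon>\<^sup>2 * b)"
    if "0 < \<epsilon>" "\<epsilon>\<^sup>2 / C_tol \<le> tol_max A" "E0 \<le> e0" "0 \<le> b" and X: "irpmvr_steps S A X"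
      and call: "\<And>k. k < K E0 \<epsilon> \<Longrightarrow>
        \<exists>N. inner_iterations rt (gradient (dual_at S A X k \<omega>)) (tol X k \<omega>) \<le> enat N \<and> real N \<le> b"
    for \<epsilon> E0 e0 b rt \<omega> and X :: "('w, 's, 'd, 'p) run"
  proof -
    interpret irpmvr_steps S A X by (rule X)
    interpret irpmvr_run S A X ..
    have "ereal_of_enat (total_inner S A rt X (K E0 \<epsilon>) \<omega>) \<le> ereal (real (K E0 \<epsilon>) * b)"
      by (rule total_inner_le[OF call])
    also have "\<dots> \<le> ereal (outer e0 / \<epsilon>\<^sup>2 * b)"
      using mult_right_mono[OF budget[OF that(1-3)] that(4)] by (simp only: ereal_less_eq)
    finally show ?thesis .
  qed

  have part1: "Min ((\<lambda>k. \<integral>\<^sup>+\<omega>. ennreal ((theta S A X k \<omega>)\<^sup>2) \<partial>prb X) ` {..<K E0 \<epsilon>}) \<le> ennreal (\<epsilon>\<^sup>2)"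
    if e: "0 < \<epsilon>" "\<epsilon>\<^sup>2 / C_tol \<le> tol_max A" and X: "irpmvr S A X" and ed: "error_dissipation S c_e \<mu> \<nu> X"
      and E0: "E0 = prob_space.expectation (prb X) (pot X 0)"
      and rule: "tolerance_rule A \<kappa> (\<epsilon>\<^sup>2 / C_tol) (K E0 \<epsilon>) X"
    for \<epsilon> E0 and X :: "('w, 's, 'd, 'p) run"
  proof -
    interpret irpmvr_steps S A X using X unfolding irpmvr_def by blast
    interpret irpmvr_run S A X ..
    interpret irpmvr_accurate_run S A X
      by unfold_locales (use X small in \<open>auto simp: irpmvr_def\<close>)
    define n where "n = K E0 \<epsilon>"
    have n1: "n \<ge> 1" and nA: "2 * A\<^sub>0 E0 / \<epsilon>\<^sup>2 \<le> real n"
      unfolding n_def assms(17) using real_nat_ceiling_ge[of "2 * A\<^sub>0 E0 / \<epsilon>\<^sup>2"] by auto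
    have "tol X k \<omega> \<le> \<kappa> * (norm (if k = 0 then 0 else eta X (k - 1) \<omega>))\<^sup>2 + \<epsilon>\<^sup>2 / C_tol"
      if "k < n" "\<omega> \<in> space (prb X)" for k \<omega>
    proof -
      have "0 \<le> \<kappa> * (norm (if k = 0 then 0 else eta X (k - 1) \<omega>))\<^sup>2" using assms(6) by simp
      moreover have "0 \<le> \<epsilon>\<^sup>2 / C_tol" using Ct(1) by simp
      moreover have "tol X k \<omega> = min (tol_max A) (max (\<kappa> * (norm (if k = 0 then 0 else eta X (k - 1) \<omega>))\<^sup>2)
          (\<epsilon>\<^sup>2 / C_tol))"
        using rule that unfolding tolerance_rule_def n_def by auto
      moreover have "min u (max v v') \<le> v + v'" if "0 \<le> v" "0 \<le> v'" for u v v' :: real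
        using that by linarith
      ultimately show ?thesis by (simp only:)
    qed
    from expected_theta_sum[OF ed assms(3-6) \<tau> assms(9) \<sigma> assms(11) less_imp_le[OF Cc(1)]
        Cc(2)[unfolded assms(12,13)] Cc(3) this]
    obtain Y where Y: "\<And>k. k < n \<Longrightarrow> (\<integral>\<^sup>+\<omega>. ennreal ((theta S A X k \<omega>)\<^sup>2) \<partial>prb X) \<le> ennreal (Y k)"
      and sumY: "(\<Sum>k<n. Y k) \<le> A\<^sub>0 E0 + real n * (2 * C_comp * lip_R S * C_dist S * (\<epsilon>\<^sup>2 / C_tol))"
      unfolding assms(16) E0 by blast
    have "A\<^sub>0 E0 \<le> real n * (\<epsilon>\<^sup>2 / 2)" using nA e(1) by (simp add: field_simps)
    \<comment> \<open>The factor 4 in \<open>C_tol\<close> grants the tolerance floor half of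
      \<open>\<epsilon>\<^sup>2\<close>; the factor 2 in \<open>K\<close> reserves the other half
      for \<open>A\<^sub>0 E0\<close>.\<close>
    moreover have "2 * C_comp * lip_R S * C_dist S * (\<epsilon>\<^sup>2 / C_tol) \<le> \<epsilon>\<^sup>2 / 2"
    proof -
      have "4 * C_comp * lc * \<epsilon>\<^sup>2 \<le> C_tol * \<epsilon>\<^sup>2" using Ct(2) by (rule mult_right_mono) simp
      thus ?thesis using Ct(1) unfolding lc_def by (simp add: field_simps)
    qed
    hence "real n * (2 * C_comp * lip_R S * C_dist S * (\<epsilon>\<^sup>2 / C_tol)) \<le> real n * (\<epsilon>\<^sup>2 / 2)"
      by (intro mult_left_mono) auto
    ultimately have "(\<Sum>k<n. Y k) \<le> (\<Sum>k<n. \<epsilon>\<^sup>2)" using sumY by simp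
    moreover have "{..<n} \<noteq> {}" using n1 by (auto simp: lessThan_empty_iff)
    ultimately obtain k where k: "k < n" "Y k \<le> \<epsilon>\<^sup>2"
      using sum_strict_mono[of "{..<n}" "\<lambda>_. \<epsilon>\<^sup>2" Y] by (meson finite_lessThan lessThan_iff not_le)
    have "Min ((\<lambda>k. \<integral>\<^sup>+\<omega>. ennreal ((theta S A X k \<omega>)\<^sup>2) \<partial>prb X) ` {..<n})
        \<le> (\<integral>\<^sup>+\<omega>. ennreal ((theta S A X k \<omega>)\<^sup>2) \<partial>prb X)"
      using k(1) by (intro Min_le) auto
    also have "\<dots> \<le> ennreal (\<epsilon>\<^sup>2)" using Y[OF k(1)] k(2) by (meson ennreal_leI order_trans)
    finally show ?thesis unfolding n_def .
  qed

  define w where "w = dual_lip S A * dual_radius S A"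
  have w: "w > 0" unfolding w_def using dual_lip_pos dual_radius_pos by simp

  define admissible where "admissible rt e0 \<epsilon> E0 \<omega> X \<longleftrightarrow>
      0 < \<epsilon> \<and> \<epsilon>\<^sup>2 / C_tol \<le> tol_max A \<and> irpmvr_steps S A X \<and> uses_routine S A rt X \<and>
      error_dissipation S c_e \<mu> \<nu> X \<and> E0 = prob_space.expectation (prb X) (pot X 0) \<and> E0 \<le> e0 \<and>
      tolerance_rule A \<kappa> (\<epsilon>\<^sup>2 / C_tol) (K E0 \<epsilon>) X \<and> \<omega> \<in> space (prb X)"
    for rt e0 \<epsilon> E0 \<omega> and X :: "('w, 's, 'd, 'p) run"
  have admissibleD: "0 < \<epsilon>" "\<epsilon>\<^sup>2 / C_tol \<le> tol_max A" "irpmvr_steps S A X" "E0 \<le> e0"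
      "tolerance_rule A \<kappa> (\<epsilon>\<^sup>2 / C_tol) (K E0 \<epsilon>) X" "\<omega> \<in> space (prb X)"
    if "admissible rt e0 \<epsilon> E0 \<omega> X" for rt e0 \<epsilon> E0 \<omega> and X :: "('w, 's, 'd, 'p) run"
    using that by (auto simp: admissible_def)

  have part2: "\<exists>C. \<forall>\<epsilon> E0 \<omega>. \<forall>X :: ('w, 's, 'd, 'p) run. admissible (routine_FISTA S A) e0 \<epsilon> E0 \<omega> X \<longrightarrow>
        ereal_of_enat (total_inner S A (routine_FISTA S A) X (K E0 \<epsilon>) \<omega>)
          \<le> ereal (C * (1 / \<epsilon> ^ 4))" for e0
  proof (intro exI allI impI)
    fix \<epsilon> E0 \<omega> and X :: "('w, 's, 'd, 'p) run"
    assume "admissible (routine_FISTA S A) e0 \<epsilon> E0 \<omega> X"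
    note e = admissibleD(1,2)[OF this] and X = admissibleD(3)[OF this] and E0 = admissibleD(4)[OF this]
      and rule = admissibleD(5)[OF this] and \<omega> = admissibleD(6)[OF this]
    interpret irpmvr_steps S A X by (rule X)
    interpret irpmvr_run S A X ..
    \<comment> \<open>The cost at the tolerance floor, plus \<open>E / \<epsilon>\<^sup>2\<close> to
      pay for the additive 1.\<close>
    let ?b = "(2 * w * C_tol + E) / \<epsilon>\<^sup>2"
    have "ereal_of_enat (total_inner S A (routine_FISTA S A) X (K E0 \<epsilon>) \<omega>)
        \<le> ereal (outer e0 / \<epsilon>\<^sup>2 * ?b)"
    proof (rule total[OF e E0 _ X])
      show "0 \<le> ?b" using w Ct(1) eps[OF e] by simp
      fix k assume k: "k < K E0 \<epsilon>"
      have ge: "\<epsilon>\<^sup>2 / C_tol \<le> tol X k \<omega>" by (rule tol_ge[OF e(2) rule k \<omega>])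
      have p: "0 < \<epsilon>\<^sup>2 / C_tol" using e Ct(1) by simp
      have "2 * w / tol X k \<omega> \<le> 2 * w / (\<epsilon>\<^sup>2 / C_tol)"
        by (rule divide_left_mono[OF ge _ mult_pos_pos[OF less_le_trans[OF p ge] p]]) (use w in simp)
      moreover have "1 \<le> E / \<epsilon>\<^sup>2" using eps[OF e] e by simp
      ultimately have "2 * dual_lip S A * dual_radius S A / tol X k \<omega> + 1 \<le> ?b"
        unfolding w_def by (simp add: add_divide_distrib mult.assoc)
      thus "\<exists>N. inner_iterations (routine_FISTA S A) (gradient (dual_at S A X k \<omega>)) (tol X k \<omega>) \<le> enat N \<and> real N \<le> ?b"
        using FISTA_call[OF \<omega>, of k] ge p by fastforce
    qed
    also have "outer e0 / \<epsilon>\<^sup>2 * ?b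
        = (outer e0 * (2 * w * C_tol + E)) * (1 / \<epsilon> ^ 4)"
      by (simp add: power_add[symmetric])
    finally show "ereal_of_enat (total_inner S A (routine_FISTA S A) X (K E0 \<epsilon>) \<omega>)
        \<le> ereal ((outer e0 * (2 * w * C_tol + E)) * (1 / \<epsilon> ^ 4))" .
  qed

  have part3: "\<exists>C. \<forall>\<epsilon> E0 \<omega>. \<forall>X :: ('w, 's, 'd, 'p) run. admissible (routine_NFG S A \<rho>) e0 \<epsilon> E0 \<omega> X \<longrightarrow>
        ereal_of_enat (total_inner S A (routine_NFG S A \<rho>) X (K E0 \<epsilon>) \<omega>)
          \<le> ereal (C * (1 / \<epsilon> ^ 3 * ln (1 + 1 / \<epsilon>\<^sup>2)))"
    if \<rho>: "0 < \<rho>" "\<rho> * dual_radius S A < 1" for e0 \<rho>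
  proof -
    define L1 where "L1 = dual_lip S A + 2 * \<rho> * tol_max A"
    have L1: "L1 > 0" unfolding L1_def using dual_lip_pos \<rho> tol_max by (simp add: add_pos_nonneg)
    define r where "r = 1 - \<rho> * dual_radius S A"
    have r: "r > 0" unfolding r_def using \<rho> by simp
    define P where "P = 2 * L1 * dual_radius S A / r * C_tol"
    have P: "P > 0" unfolding P_def using L1 dual_radius_pos r Ct(1) by simp
    \<comment> \<open>The first summand is the square root times the logarithm at the tolerance
      floor. The second pays for the additive 1, which must be dominated by
      \<open>sqrt E / \<epsilon>\<close> times
      \<open>ln (1 + 1 / \<epsilon>\<^sup>2) / ln (1 + 1 / E)\<close>.\<close>
    define Q where "Q = sqrt (L1 * C_tol / \<rho>) * (2 * ln (1 + P) / ln (1 + 1 / E) + 2) + sqrt E / ln (1 + 1 / E)"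
    show ?thesis
    proof (intro exI allI impI)
      fix \<epsilon> E0 \<omega> and X :: "('w, 's, 'd, 'p) run"
      assume "admissible (routine_NFG S A \<rho>) e0 \<epsilon> E0 \<omega> X"
    note e = admissibleD(1,2)[OF this] and X = admissibleD(3)[OF this] and E0 = admissibleD(4)[OF this]
      and rule = admissibleD(5)[OF this] and \<omega> = admissibleD(6)[OF this]
      interpret irpmvr_steps S A X by (rule X)
      interpret irpmvr_run S A X ..
      define l where "l = ln (1 + 1 / \<epsilon>\<^sup>2)"
      have p: "0 < \<epsilon>\<^sup>2 / C_tol" using e Ct(1) by simp
      have l: "l \<ge> 0" unfolding l_def by (rule ln_ge_zero) simp
      have lE: "ln (1 + 1 / E) > 0" by (rule ln_gt_zero) (use eps[OF e] in simp)
      have Q: "Q \<ge> 0" unfolding Q_def using L1 Ct(1) \<rho> P lE eps[OF e] by simp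
      let ?b = "Q / \<epsilon> * l"
      have "ereal_of_enat (total_inner S A (routine_NFG S A \<rho>) X (K E0 \<epsilon>) \<omega>)
          \<le> ereal (outer e0 / \<epsilon>\<^sup>2 * ?b)"
      proof (rule total[OF e E0 _ X])
        show "0 \<le> ?b" using Q l e by simp
        fix k assume k: "k < K E0 \<epsilon>"
        define t where "t = tol X k \<omega>"
        have ge: "\<epsilon>\<^sup>2 / C_tol \<le> t" unfolding t_def by (rule tol_ge[OF e(2) rule k \<omega>])
        have t: "t > 0" using ge p by linarith
        have inv: "1 / t \<le> C_tol / \<epsilon>\<^sup>2" using ge t e Ct(1) by (simp add: field_simps)
        have "L1 / \<rho> * (1 / t) \<le> L1 / \<rho> * (C_tol / \<epsilon>\<^sup>2)" using inv L1 \<rho> by (intro mult_left_mono) auto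
        hence "L1 / (\<rho> * t) \<le> L1 * C_tol / \<rho> / \<epsilon>\<^sup>2" by simp
        hence "sqrt (L1 / (\<rho> * t)) \<le> sqrt (L1 * C_tol / \<rho> / \<epsilon>\<^sup>2)" by (rule real_sqrt_le_mono)
        also have "\<dots> = sqrt (L1 * C_tol / \<rho>) / \<epsilon>"
          using e unfolding real_sqrt_divide[of _ "\<epsilon>\<^sup>2"] by simp
        finally have s1: "sqrt (L1 / (\<rho> * t)) \<le> sqrt (L1 * C_tol / \<rho>) / \<epsilon>" .
        have "2 * L1 * dual_radius S A / r * (1 / t) \<le> 2 * L1 * dual_radius S A / r * (C_tol / \<epsilon>\<^sup>2)"
          using inv L1 dual_radius_pos r by (intro mult_left_mono) auto
        hence q: "2 * L1 * dual_radius S A / (r * t) \<le> P / \<epsilon>\<^sup>2" unfolding P_def by simp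
        have q0: "2 * L1 * dual_radius S A / (r * t) > 0" using L1 dual_radius_pos r t by simp
        have "ln ((2 * L1 * dual_radius S A / (r * t))\<^sup>2) \<le> ln ((P / \<epsilon>\<^sup>2)\<^sup>2)"
          using q q0 by (intro ln_mono power_mono) auto
        hence "max 0 (ln ((2 * L1 * dual_radius S A / (r * t))\<^sup>2)) \<le> max 0 (ln ((P / \<epsilon>\<^sup>2)\<^sup>2))" by simp
        also have "\<dots> \<le> (2 * ln (1 + P) / ln (1 + 1 / E) + 2) * l"
          unfolding l_def by (rule ln_square_le_ln_budget(1)[OF P e(1) eps[OF e]])
        finally have s2: "max 0 (ln ((2 * L1 * dual_radius S A / (r * t))\<^sup>2)) \<le> (2 * ln (1 + P) / ln (1 + 1 / E) + 2) * l" .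
        have s12: "sqrt (L1 / (\<rho> * t)) * max 0 (ln ((2 * L1 * dual_radius S A / (r * t))\<^sup>2))
            \<le> sqrt (L1 * C_tol / \<rho>) / \<epsilon> * ((2 * ln (1 + P) / ln (1 + 1 / E) + 2) * l)"
          by (rule mult_mono[OF s1 s2]) (use L1 Ct(1) \<rho> e in auto)
        have bsplit: "(u * v + c / d) / \<epsilon> * l = u / \<epsilon> * (v * l) + c / \<epsilon> * (l / d)" for u v c d :: real
          by (simp add: add_divide_distrib distrib_right distrib_left mult.commute mult.left_commute)
        have "\<epsilon> \<le> sqrt E" using eps(1)[OF e] by (rule real_le_rsqrt)
        hence "1 \<le> sqrt E / \<epsilon>" using e by simp
        moreover have "1 \<le> l / ln (1 + 1 / E)"
          unfolding l_def by (rule ln_square_le_ln_budget(2)[OF P e(1) eps[OF e]])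
        ultimately have "1 * 1 \<le> sqrt E / \<epsilon> * (l / ln (1 + 1 / E))"
          by (intro mult_mono) auto
        hence "sqrt (L1 / (\<rho> * t)) * max 0 (ln ((2 * L1 * dual_radius S A / (r * t))\<^sup>2)) + 1 \<le> ?b"
          using s12 unfolding Q_def bsplit by simp
        thus "\<exists>N. inner_iterations (routine_NFG S A \<rho>) (gradient (dual_at S A X k \<omega>)) (tol X k \<omega>) \<le> enat N \<and> real N \<le> ?b"
          using NFG_call[OF \<omega> t[unfolded t_def] \<rho> L1_def] unfolding t_def r_def by fastforce
      qed
      also have "outer e0 / \<epsilon>\<^sup>2 * ?b
          = (outer e0 * Q) * (1 / \<epsilon> ^ 3 * ln (1 + 1 / \<epsilon>\<^sup>2))"
        unfolding l_def by (simp add: power2_eq_square power3_eq_cube)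
      finally show "ereal_of_enat (total_inner S A (routine_NFG S A \<rho>) X (K E0 \<epsilon>) \<omega>)
          \<le> ereal ((outer e0 * Q) * (1 / \<epsilon> ^ 3 * ln (1 + 1 / \<epsilon>\<^sup>2)))" .
    qed
  qed

  have part4: "\<exists>C. \<forall>\<epsilon> E0 \<omega>. \<forall>X :: ('w, 's, 'd, 'p) run. admissible (routine_AR S A \<rho>) e0 \<epsilon> E0 \<omega> X \<longrightarrow>
        ereal_of_enat (total_inner S A (routine_AR S A \<rho>) X (K E0 \<epsilon>) \<omega>)
          \<le> ereal (C * (1 / \<epsilon> ^ 3))"
    if \<rho>: "0 < \<rho>" "5 * \<rho> * dual_radius S A \<le> 1" for e0 \<rho>
  proof -
    define W where "W = 17 * sqrt (2 * dual_lip S A * dual_radius S A) + 32 * sqrt (dual_lip S A / \<rho>)"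
    have W: "W \<ge> 0" unfolding W_def using dual_lip_pos dual_radius_pos \<rho> by simp
    show ?thesis
    proof (intro exI allI impI)
      fix \<epsilon> E0 \<omega> and X :: "('w, 's, 'd, 'p) run"
      assume "admissible (routine_AR S A \<rho>) e0 \<epsilon> E0 \<omega> X"
    note e = admissibleD(1,2)[OF this] and X = admissibleD(3)[OF this] and E0 = admissibleD(4)[OF this]
      and rule = admissibleD(5)[OF this] and \<omega> = admissibleD(6)[OF this]
      interpret irpmvr_steps S A X by (rule X)
      interpret irpmvr_run S A X ..
      have p: "0 < \<epsilon>\<^sup>2 / C_tol" using e Ct(1) by simp
      \<comment> \<open>The constant 34 is paid with \<open>sqrt E / \<epsilon>\<close>, which is at
        least 1; \<open>sqrt C_tol\<close> comes from the tolerance floor.\<close>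
      let ?b = "(34 * sqrt E + W * sqrt C_tol) / \<epsilon>"
      have "ereal_of_enat (total_inner S A (routine_AR S A \<rho>) X (K E0 \<epsilon>) \<omega>)
          \<le> ereal (outer e0 / \<epsilon>\<^sup>2 * ?b)"
      proof (rule total[OF e E0 _ X])
        show "0 \<le> ?b" using W Ct(1) e eps[OF e] by simp
        fix k assume k: "k < K E0 \<epsilon>"
        define t where "t = tol X k \<omega>"
        have ge: "\<epsilon>\<^sup>2 / C_tol \<le> t" unfolding t_def by (rule tol_ge[OF e(2) rule k \<omega>])
        have t: "t > 0" using ge p by linarith
        have "sqrt (\<epsilon>\<^sup>2 / C_tol) \<le> sqrt t" using ge by (rule real_sqrt_le_mono)
        hence "\<epsilon> / sqrt C_tol \<le> sqrt t" using e by (simp add: real_sqrt_divide)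
        hence "W / sqrt t \<le> W / (\<epsilon> / sqrt C_tol)"
          by (intro divide_left_mono W mult_pos_pos) (use e Ct(1) t in auto)
        moreover have "1 \<le> sqrt E / \<epsilon>"
          using real_le_rsqrt[OF eps(1)[OF e]] e by simp
        ultimately have "34 + W / sqrt t \<le> ?b" by (simp add: add_divide_distrib)
        thus "\<exists>N. inner_iterations (routine_AR S A \<rho>) (gradient (dual_at S A X k \<omega>)) (tol X k \<omega>) \<le> enat N \<and> real N \<le> ?b"
          using AR_call[OF \<omega> t[unfolded t_def] \<rho>] unfolding t_def W_def by fastforce
      qed
      also have "outer e0 / \<epsilon>\<^sup>2 * ?b
          = (outer e0 * (34 * sqrt E + W * sqrt C_tol)) * (1 / \<epsilon> ^ 3)"
        by (simp add: power2_eq_square power3_eq_cube)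
      finally show "ereal_of_enat (total_inner S A (routine_AR S A \<rho>) X (K E0 \<epsilon>) \<omega>)
          \<le> ereal ((outer e0 * (34 * sqrt E + W * sqrt C_tol)) * (1 / \<epsilon> ^ 3))" .
    qed
  qed

  show ?thesis
  proof (intro conjI)
    show "\<forall>\<epsilon> E0. \<forall>X :: ('w, 's, 'd, 'p) run.
        0 < \<epsilon> \<and> \<epsilon>\<^sup>2 / C_tol \<le> tol_max A \<and>
        irpmvr S A X \<and> error_dissipation S c_e \<mu> \<nu> X \<and>
        E0 = prob_space.expectation (prb X) (pot X 0) \<and>
        tolerance_rule A \<kappa> (\<epsilon>\<^sup>2 / C_tol) (K E0 \<epsilon>) X \<longrightarrow>
        Min ((\<lambda>k. \<integral>\<^sup>+\<omega>. ennreal ((theta S A X k \<omega>)\<^sup>2) \<partial>prb X) ` {..<K E0 \<epsilon>}) \<le> ennreal (\<epsilon>\<^sup>2)"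
      by (intro allI impI, elim conjE) (rule part1)
  qed (use part2 part3 part4 in \<open>unfold admissible_def, blast\<close>)+
qed

end
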